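(* Let $t\ge2$ be a fixed integer and let $\hat m^{ens}_{k_n,boost}$ be the truncated ensemble of $B\ge 1$ ODT-based boosting trees (each with $k_n$ random ODTs of $t$ leaves, truncation level $\beta_n$), as defined in the context. Assume $\mathbf E(e^{cY^2})<\infty$ for some $c>0$ and that $m\in\mathcal G$, where, with $\sigma_0(v)=\mathbb I(v\ge0)$, $$\mathcal G=\Big\{\sum_{j=1}^\infty a_j\sigma_0(\theta_j^\top x+s_j):\ \sum_{j=1}^\infty|a_j|<\infty,\ \theta_j\in\mathbb R^p,\ s_j\in\mathbb R\Big\}.$$ If $\beta_n\asymp\ln n$ and $k_n\asymp\sqrt n$, then $$\mathbf E\left(\int|\hat m^{ens}_{k_n,boost}(x)-m(x)|^2\,d\mu(x)\right)=O\left(\frac{\ln^4n}{\sqrt n}\right).$$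
   Context: **Setting.** $p\ge1$ is fixed, $X$ is a random vector in $[0,1]^p$ with distribution $\mu$, $Y$ is a real random variable, $m(x)=\mathbf E(Y\mid X=x)$, $x\in[0,1]^p$, and $\mathcal D_n=\{(X_i,Y_i)\}_{i=1}^n$ are i.i.d. copies of $(X,Y)$. $\Theta^q=\{\theta\in\mathbb R^q:\|\theta\|_2=1\}$. For $\mathcal S\subseteq\{1,\dots,p\}$, $x_{\mathcal S}$ is the subvector of $x$ with coordinates in $\mathcal S$. **Random ODT with $t$ leaves on data $\{(X_i,R_i)\}_{i=1}^n$.** For $A\subseteq[0,1]^p$, $N(A)=\#\{i:X_i\in A\}$ and $\bar R_A$ is the mean of $R_i$ over $X_i\in A$ ($0$ if there are none). Let $\mathcal S_1,\dots,\mathcal S_{t-1}$ be i.i.d. random nonempty subsets of $\{1,\dots,p\}$, independent of the data, with $\mathbf P(\mathcal S)=\frac1p\binom p{\mathrm{Card}(\mathcal S)}^{-1}$. For a nonempty $\mathcal S$ of size $q$, $\theta\in\Theta^q$, $s\in\mathbb R$, let $A^+=\{x\in A:\theta^Tx_{\mathcal S}\le s\}$, $A^-=\{x\in A:\theta^Tx_{\mathcal S}>s\}$ and $$\Delta_{A,q}(\theta,s)=\frac1{N(A)}\Big[\sum_{X_i\in A}(R_i-\bar R_A)^2-\sum_{X_i\in A^+}(R_i-\bar R_{A^+})^2-\sum_{X_i\in A^-}(R_i-\bar R_{A^-})^2\Big].$$ Starting from layer $0$ consisting of the node $[0,1]^p$, nodes of the current layer are processed one after another: a node with at most one data point is passed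 unchanged to the next layer; a node $A$ with at least two data points is split, and if this is the $\tau$-th split it is split into $A^+,A^-$ using $\mathcal S=\mathcal S_\tau$ and a maximizer of $\Delta_{A,q}$ over $\Theta^q\times\mathbb R$, $q=\mathrm{Card}(\mathcal S_\tau)$; daughters go to the next layer. One stops as soon as there are $t$ leaves. The tree estimator at $x$ equals $\bar R_A$ with $A$ the leaf containing $x$. **Boosting tree with $k$ random ODTs.** Put $\mathcal D_n^1=\mathcal D_n$. For $j=1,\dots,k$: let $m_{n,t,\mathcal L_j}$ be the random ODT estimator with $t$ leaves built on $\mathcal D_n^j$ (with fresh independent random seeds for every tree); let $$m_{j,boost}(x)=\sum_{\ell=1}^ja^*_{j,\ell}m_{n,t,\mathcal L_\ell}(x),\qquad (a^*_{j,1},\dots,a^*_{j,j})\in\arg\min_{a_{j,1},\dots,a_{j,j}\in\mathbb R}\sum_{i=1}^n\Big(Y_i-\sum_{\ell=1}^ja_{j,\ell}m_{n,t,\mathcal L_\ell}(X_i)\Big)^2;$$ and put $\mathcal D_n^{j+1}=\{(X_i,Y_i-m_{j,boost}(X_i))\}_{i=1}^n$. The output is $m_{k,boost}$. **Ensemble.** Running this $B$ times with independent seeds on the same data gives $m^1_{k_n,boost},\dots,m^B_{k_n,boost}$, and $$\hat m^{ens}_{k_n,boost}(x)=\frac1B\sum_{b=1}^B\max\{\min\{m^b_{k_n,boost}(x),\beta_n\},-\beta_n\}.$$ $a_n\asymp b_n$ means that $a_n/b_n$ is bounded above and below by positive constants. The expectation is over the data and all random seeds. *)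

theory Defs
  imports "HOL-Probability.Probability"
begin

text \<open>
  Points live in \<open>real ^ 'p\<close>, so the dimension is \<open>CARD('p)\<close>, and coordinate sets are of type
  \<open>'p set\<close>. A sample of size \<open>n\<close> is given by design points \<open>x i\<close> and responses \<open>r i\<close>, \<open>i < n\<close>.
\<close>

abbreviation unit_cube :: "(real ^ 'p) set" where
  "unit_cube \<equiv> cbox 0 1"


section \<open>Oblique decision trees\<close>

definition node_points :: "nat \<Rightarrow> (nat \<Rightarrow> real ^ 'p) \<Rightarrow> (real ^ 'p) set \<Rightarrow> nat set" where
  "node_points n x A = {i. i < n \<and> x i \<in> A}"

text \<open>The mean over an empty node is 0, because division by zero yields 0.\<close>

definition node_mean ::
  "nat \<Rightarrow> (nat \<Rightarrow> real ^ 'p) \<Rightarrow> (nat \<Rightarrow> real) \<Rightarrow> (real ^ 'p) set \<Rightarrow> real" where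
  "node_mean n x r A = (\<Sum>i\<in>node_points n x A. r i) / real (card (node_points n x A))"

definition node_sse ::
  "nat \<Rightarrow> (nat \<Rightarrow> real ^ 'p) \<Rightarrow> (nat \<Rightarrow> real) \<Rightarrow> (real ^ 'p) set \<Rightarrow> real" where
  "node_sse n x r A = (\<Sum>i\<in>node_points n x A. (r i - node_mean n x r A)\<^sup>2)"

text \<open>
  For a coordinate set \<open>S\<close> of size \<open>q\<close>, the unit sphere of \<open>q\<close>-space is identified with the unit
  vectors of \<open>real ^ 'p\<close> supported in \<open>S\<close>; then \<open>\<theta> \<bullet> z\<close> is the product of \<open>\<theta>\<close> with the
  subvector of \<open>z\<close> on \<open>S\<close>.
\<close>

definition directions :: "'p set \<Rightarrow> (real ^ 'p) set" where
  "directions S = {\<theta>. norm \<theta> = 1 \<and> (\<forall>i. i \<notin> S \<longrightarrow> \<theta> $ i = 0)}"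

definition lower_daughter :: "(real ^ 'p) set \<Rightarrow> real ^ 'p \<Rightarrow> real \<Rightarrow> (real ^ 'p) set" where
  "lower_daughter A \<theta> s = {z \<in> A. \<theta> \<bullet> z \<le> s}"

definition upper_daughter :: "(real ^ 'p) set \<Rightarrow> real ^ 'p \<Rightarrow> real \<Rightarrow> (real ^ 'p) set" where
  "upper_daughter A \<theta> s = {z \<in> A. \<theta> \<bullet> z > s}"

definition impurity_gain ::
  "nat \<Rightarrow> (nat \<Rightarrow> real ^ 'p) \<Rightarrow> (nat \<Rightarrow> real) \<Rightarrow> (real ^ 'p) set \<Rightarrow> real ^ 'p \<Rightarrow> real \<Rightarrow> real" where
  "impurity_gain n x r A \<theta> s =
    (node_sse n x r A - node_sse n x r (lower_daughter A \<theta> s)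
       - node_sse n x r (upper_daughter A \<theta> s)) / real (card (node_points n x A))"

definition best_split ::
  "nat \<Rightarrow> (nat \<Rightarrow> real ^ 'p) \<Rightarrow> (nat \<Rightarrow> real) \<Rightarrow> 'p set \<Rightarrow> (real ^ 'p) set \<Rightarrow> real ^ 'p \<Rightarrow> real \<Rightarrow> bool"
  where
  "best_split n x r S A \<theta> s \<longleftrightarrow> \<theta> \<in> directions S \<and>
    (\<forall>\<theta>'\<in>directions S. \<forall>s'. impurity_gain n x r A \<theta>' s' \<le> impurity_gain n x r A \<theta> s)"

text \<open>
  \<open>odt_grow n x r t S cur handed L\<close>: if \<open>cur\<close> are the nodes of the current layer still to be processed
  and \<open>handed\<close> the nodes already handed to the next layer, then \<open>L\<close> is a possible final list of
  leaves. Nodes are kept in lists since daughters may be empty and hence equal as sets. Each split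
  adds exactly one node and growth starts from a single node, so while there are \<open>\<tau>\<close> nodes the
  \<open>\<tau>\<close>-th split is due, and it uses \<open>S \<tau>\<close>. Rule \<open>exhausted\<close> covers samples for which \<open>t\<close> leaves
  cannot be reached because no node has two data points. The relation is not functional: every
  maximiser of the impurity gain is admitted.
\<close>

inductive odt_grow ::
  "nat \<Rightarrow> (nat \<Rightarrow> real ^ 'p) \<Rightarrow> (nat \<Rightarrow> real) \<Rightarrow> nat \<Rightarrow> (nat \<Rightarrow> 'p set) \<Rightarrow>
    (real ^ 'p) set list \<Rightarrow> (real ^ 'p) set list \<Rightarrow> (real ^ 'p) set list \<Rightarrow> bool"
  for n :: nat and x :: "nat \<Rightarrow> real ^ 'p" and r :: "nat \<Rightarrow> real" and t :: nat
    and S :: "nat \<Rightarrow> 'p set"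
where
  enough: "length cur + length handed = t \<Longrightarrow> odt_grow n x r t S cur handed (handed @ cur)"
| exhausted: "\<lbrakk>length cur + length handed < t;
     \<forall>A\<in>set cur \<union> set handed. card (node_points n x A) \<le> 1\<rbrakk>
     \<Longrightarrow> odt_grow n x r t S cur handed (handed @ cur)"
| pass: "\<lbrakk>length (A # cur) + length handed < t; card (node_points n x A) \<le> 1;
     odt_grow n x r t S cur (handed @ [A]) L\<rbrakk>
     \<Longrightarrow> odt_grow n x r t S (A # cur) handed L"
| split: "\<lbrakk>length (A # cur) + length handed < t; card (node_points n x A) \<ge> 2;
     best_split n x r (S (length (A # cur) + length handed)) A \<theta> s;
     odt_grow n x r t S cur (handed @ [lower_daughter A \<theta> s, upper_daughter A \<theta> s]) L\<rbrakk>
     \<Longrightarrow> odt_grow n x r t S (A # cur) handed L"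
| new_layer: "\<lbrakk>length handed < t; handed \<noteq> []; odt_grow n x r t S handed [] L\<rbrakk>
     \<Longrightarrow> odt_grow n x r t S [] handed L"

text \<open>The leaves partition the unit cube, so on it the sum has a single nonzero indicator.\<close>

definition tree_function ::
  "nat \<Rightarrow> (nat \<Rightarrow> real ^ 'p) \<Rightarrow> (nat \<Rightarrow> real) \<Rightarrow> (real ^ 'p) set list \<Rightarrow> real ^ 'p \<Rightarrow> real" where
  "tree_function n x r L z = (\<Sum>A\<leftarrow>L. node_mean n x r A * indicator A z)"

definition is_odt_estimator ::
  "nat \<Rightarrow> (nat \<Rightarrow> real ^ 'p) \<Rightarrow> (nat \<Rightarrow> real) \<Rightarrow> nat \<Rightarrow> (nat \<Rightarrow> 'p set) \<Rightarrow> (real ^ 'p \<Rightarrow> real) \<Rightarrow> bool"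
  where
  "is_odt_estimator n x r t S f \<longleftrightarrow>
    (\<exists>L. odt_grow n x r t S [unit_cube] [] L \<and> f = tree_function n x r L)"


section \<open>Boosting and ensembles\<close>

definition boost_comb ::
  "(nat \<Rightarrow> real ^ 'p \<Rightarrow> real) \<Rightarrow> nat \<Rightarrow> (nat \<Rightarrow> real) \<Rightarrow> real ^ 'p \<Rightarrow> real" where
  "boost_comb g j a z = (\<Sum>l=1..j. a l * g l z)"

text \<open>
  \<open>S j\<close> are the coordinate sets used by the \<open>j\<close>-th tree. For \<open>j = 1\<close> the residuals are the
  responses themselves, as the combination of no trees is 0. Least squares coefficients need not be
  unique, and all of them are admitted.
\<close>

definition is_boosting_tree ::
  "nat \<Rightarrow> (nat \<Rightarrow> real ^ 'p) \<Rightarrow> (nat \<Rightarrow> real) \<Rightarrow> nat \<Rightarrow> nat \<Rightarrow> (nat \<Rightarrow> nat \<Rightarrow> 'p set) \<Rightarrow>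
    (real ^ 'p \<Rightarrow> real) \<Rightarrow> bool" where
  "is_boosting_tree n x y t k S f \<longleftrightarrow>
    (\<exists>(g :: nat \<Rightarrow> real ^ 'p \<Rightarrow> real) (a :: nat \<Rightarrow> nat \<Rightarrow> real).
      (\<forall>j\<in>{1..k}.
        is_odt_estimator n x (\<lambda>i. y i - boost_comb g (j - 1) (a (j - 1)) (x i)) t (S j) (g j) \<and>
        (\<forall>c. (\<Sum>i<n. (y i - boost_comb g j (a j) (x i))\<^sup>2)
              \<le> (\<Sum>i<n. (y i - boost_comb g j c (x i))\<^sup>2))) \<and>
      f = boost_comb g k (a k))"

definition truncated_ensemble ::
  "nat \<Rightarrow> real \<Rightarrow> (nat \<Rightarrow> real ^ 'p \<Rightarrow> real) \<Rightarrow> real ^ 'p \<Rightarrow> real" where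
  "truncated_ensemble B \<beta> f z = (\<Sum>b=1..B. max (min (f b z) \<beta>) (- \<beta>)) / real B"


section \<open>Probabilistic setting\<close>

definition is_regression_function ::
  "'w measure \<Rightarrow> ('w \<Rightarrow> real ^ 'p) \<Rightarrow> ('w \<Rightarrow> real) \<Rightarrow> (real ^ 'p \<Rightarrow> real) \<Rightarrow> bool" where
  "is_regression_function M X Y m \<longleftrightarrow> m \<in> borel_measurable borel \<and>
    (AE \<omega> in M. real_cond_exp M (vimage_algebra (space M) X borel) Y \<omega> = m (X \<omega>))"

definition iid_copies ::
  "'w measure \<Rightarrow> ('w \<Rightarrow> real ^ 'p) \<Rightarrow> ('w \<Rightarrow> real) \<Rightarrow>
    (nat \<Rightarrow> 'w \<Rightarrow> real ^ 'p) \<Rightarrow> (nat \<Rightarrow> 'w \<Rightarrow> real) \<Rightarrow> bool" where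
  "iid_copies M X Y Xs Ys \<longleftrightarrow>
    prob_space.indep_vars M (\<lambda>_. borel) (\<lambda>i \<omega>. (Xs i \<omega>, Ys i \<omega>)) UNIV \<and>
    (\<forall>i. distr M borel (\<lambda>\<omega>. (Xs i \<omega>, Ys i \<omega>)) = distr M borel (\<lambda>\<omega>. (X \<omega>, Y \<omega>)))"

text \<open>
  Seeds are indexed by (run in the ensemble, tree within the run, split within the tree).
\<close>

definition seed_index :: "nat \<Rightarrow> nat \<Rightarrow> nat \<Rightarrow> (nat \<times> nat \<times> nat) set" where
  "seed_index B k t = {1..B} \<times> {1..k} \<times> {1..<t}"

text \<open>
  The probabilities prescribed for the nonempty sets add up to 1, so seeds are nonempty almost
  surely. Independence of the seeds from the first \<open>n\<close> observations is stated through the generated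
  \<open>\<sigma>\<close>-algebras, because \<open>indep_var\<close> requires variables with values in the same type.
\<close>

definition admissible_seeds ::
  "'w measure \<Rightarrow> nat \<Rightarrow> (nat \<Rightarrow> 'w \<Rightarrow> real ^ 'p) \<Rightarrow> (nat \<Rightarrow> 'w \<Rightarrow> real) \<Rightarrow>
    (nat \<times> nat \<times> nat) set \<Rightarrow> (nat \<times> nat \<times> nat \<Rightarrow> 'w \<Rightarrow> 'p set) \<Rightarrow> bool" where
  "admissible_seeds M n Xs Ys I S \<longleftrightarrow>
    prob_space.indep_vars M (\<lambda>_. count_space UNIV) S I \<and>
    (\<forall>e\<in>I. \<forall>s. s \<noteq> {} \<longrightarrow>
      measure M {\<omega> \<in> space M. S e \<omega> = s} =
        1 / real CARD('p) * inverse (real (CARD('p) choose card s))) \<and>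
    prob_space.indep_set M
      (sets (vimage_algebra (space M) (\<lambda>\<omega>. \<lambda>i\<in>{..<n}. (Xs i \<omega>, Ys i \<omega>))
        (Pi\<^sub>M {..<n} (\<lambda>_. borel))))
      (sets (vimage_algebra (space M) (\<lambda>\<omega>. \<lambda>e\<in>I. S e \<omega>)
        (Pi\<^sub>M I (\<lambda>_. count_space UNIV))))"


section \<open>Function class and orders of magnitude\<close>

definition heaviside :: "real \<Rightarrow> real" where
  "heaviside v = (if v \<ge> 0 then 1 else 0)"

text \<open>Membership only concerns the values on the unit cube, the domain of the regression function.\<close>

definition ridge_step_class :: "(real ^ 'p \<Rightarrow> real) set" where
  "ridge_step_class = {f. \<exists>(a :: nat \<Rightarrow> real) (\<theta> :: nat \<Rightarrow> real ^ 'p) (s :: nat \<Rightarrow> real).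
     summable (\<lambda>j. \<bar>a j\<bar>) \<and> (\<forall>z\<in>unit_cube. f z = (\<Sum>j. a j * heaviside (\<theta> j \<bullet> z + s j)))}"

definition same_order :: "(nat \<Rightarrow> real) \<Rightarrow> (nat \<Rightarrow> real) \<Rightarrow> bool" where
  "same_order a b \<longleftrightarrow> (\<exists>c C. 0 < c \<and> 0 < C \<and> (\<forall>\<^sub>F n in sequentially. c \<le> a n / b n \<and> a n / b n \<le> C))"

end

theory Submission
  imports Defs
begin

text \<open>
  Least squares refitting makes the residuals orthogonal to the current fit, so boosting
  behaves like the orthogonal greedy algorithm: whenever the first split of a tree may use all
  coordinates, it captures at least the correlation of the residuals with the best half-space, and
  the excess training error over \<open>m\<close> drops from \<open>\<delta>\<close> to at most \<open>\<delta> - \<delta>\<^sup>2 / (4 V\<^sup>2)\<close>, where \<open>V\<close> bounds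
  the \<open>\<ell>\<^sub>1\<close> norm of the ridge coefficients. By Hoeffding's inequality a fixed proportion of the trees is
  of this kind, so the training error is \<open>O(1 / k)\<close>.

  A boosted tree is a combination of \<open>k t\<close> indicators of cells cut out by at most \<open>t - 1\<close> half-spaces. On
  \<open>2 n\<close> points the truncated combinations are covered by \<open>exp (O(k ln n))\<close> of them in the supremum norm,
  because it suffices to count the sign patterns of affine functions. For the generalisation error,
  the deviation of population from empirical loss is symmetrised with a ghost sample in
  expectation; a quadratic offset, taken from the excess loss itself, dominates the variance of
  the signed sum, which gives the fast rate \<open>\<beta>\<^sup>2 k ln n / n\<close> without ratio-type inequalities.
\<close>

text \<open>The tree relations are not functional and admit uncountably many fits, so the selected
  fit is known only through joint measurability and membership in the class of step functions.
  Suprema are therefore taken over a countable subclass that approximates every step function on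
  each finite point set.

  The offset comes from splitting one identity. With \<open>d\<close> the error of the truncated fit
  and \<open>e\<close> the truncated response minus the regression function, put
  \<open>\<psi> = 3/2 d^2 - 4 d e\<close> and \<open>q = d^2 / 2\<close>. Then
  \<open>\<psi> - q\<close> integrates to the risk up to a truncation bias,
  \<open>\<psi> + q\<close> is twice the excess loss at a data point, and \<open>\<psi>^2\<close> is
  at most \<open>242 \<beta>^2 q\<close>, so that \<open>q\<close> can pay for the variance.

  Truncated responses leave noise that is not centred; square-exponential moments make this bias and
  the event that some response exceeds \<open>\<beta>\<close> of lower order once
  \<open>\<beta>\<close> grows like \<open>ln n\<close>. Training error \<open>1 / k\<close> and
  complexity \<open>\<beta>^2 k ln n / n\<close> balance, up to logarithms, at \<open>k\<close> of
  order \<open>sqrt n\<close>.\<close>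

section \<open>Sign patterns and covering numbers\<close>

text \<open>Sign patterns of an affine family in \<open>card J\<close> parameters. The
  parameter-free part \<open>c\<close> is kept separate so that eliminating a parameter gives a
  family of the same kind; the levels of a truncated function later enter through it as
  well.\<close>

definition affine_patterns ::
  "'i set \<Rightarrow> 'j set \<Rightarrow> ('i \<Rightarrow> real) \<Rightarrow> ('j \<Rightarrow> 'i \<Rightarrow> real) \<Rightarrow> 'i set set" where
  "affine_patterns I J c W = range (\<lambda>a. {i \<in> I. c i + (\<Sum>j\<in>J. a j * W j i) > 0})"

lemma affine_patterns_subset: "affine_patterns I J c W \<subseteq> Pow I"
  by (auto simp: affine_patterns_def)

lemma finite_affine_patterns: "finite I \<Longrightarrow> finite (affine_patterns I J c W)"
  by (meson affine_patterns_subset finite_Pow_iff finite_subset)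

text \<open>The step of Sauer-type counting: restriction to \<open>I\<close> identifies two members
  of \<open>F\<close> exactly when they differ in \<open>x\<close> alone, and the second summand
  counts these collisions.\<close>

lemma card_le_insert_split:
  assumes "finite I" and "x \<notin> I" and F: "F \<subseteq> Pow (insert x I)"
  shows "card F \<le> card ((\<lambda>T. T \<inter> I) ` F) + card {T. T \<subseteq> I \<and> T \<in> F \<and> insert x T \<in> F}"
proof -
  define A where "A = {T \<in> F. x \<notin> T}"
  define B where "B = (\<lambda>T. T - {x}) ` {T \<in> F. x \<in> T}"
  have finF: "finite F" using F assms(1) finite_subset by blast
  have "F = A \<union> {T \<in> F. x \<in> T}" "A \<inter> {T \<in> F. x \<in> T} = {}" by (auto simp: A_def)
  then have "card F = card A + card {T \<in> F. x \<in> T}"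
    using finF by (metis (no_types, lifting) card_Un_disjoint finite_Un)
  also have "card {T \<in> F. x \<in> T} = card B"
    unfolding B_def by (rule card_image[symmetric]) (auto simp: inj_on_def)
  also have "card A + card B = card (A \<union> B) + card (A \<inter> B)"
    by (rule card_Un_Int) (use finF in \<open>auto simp: A_def B_def\<close>)
  also have "card (A \<union> B) \<le> card ((\<lambda>T. T \<inter> I) ` F)"
  proof (rule card_mono)
    show "finite ((\<lambda>T. T \<inter> I) ` F)" using finF by simp
    show "A \<union> B \<subseteq> (\<lambda>T. T \<inter> I) ` F"
    proof
      fix T assume "T \<in> A \<union> B"
      then consider "T \<in> A" | T' where "T' \<in> F" "x \<in> T'" "T = T' - {x}" by (auto simp: B_def)
      then show "T \<in> (\<lambda>T. T \<inter> I) ` F"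
      proof cases
        case 1
        then have "T = T \<inter> I" "T \<in> F" using F by (auto simp: A_def)
        then show ?thesis by blast
      next
        case 2
        then have "T = T' \<inter> I" using F assms(2) by auto
        then show ?thesis using 2 by blast
      qed
    qed
  qed
  also have "card (A \<inter> B) \<le> card {T. T \<subseteq> I \<and> T \<in> F \<and> insert x T \<in> F}"
  proof (rule card_mono)
    show "finite {T. T \<subseteq> I \<and> T \<in> F \<and> insert x T \<in> F}"
      by (rule finite_subset[OF _ finF]) auto
    show "A \<inter> B \<subseteq> {T. T \<subseteq> I \<and> T \<in> F \<and> insert x T \<in> F}"
      using F by (auto simp: A_def B_def insert_absorb)
  qed
  finally show ?thesis by simp
qed

text \<open>
  A sign pattern of all but one of the affine functions extends in both ways to the last one only if
  it occurs on the zero set of the last one, where one parameter can be eliminated.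
\<close>

lemma card_affine_patterns:
  fixes W :: "'j \<Rightarrow> 'i \<Rightarrow> real"
  assumes "finite I" and "finite J"
  shows "card (affine_patterns I J c W) \<le> (card I + 1) ^ card J"
  using assms
proof (induction I arbitrary: c W J rule: finite_induct)
  case empty
  have "card (affine_patterns {} J c W) \<le> card {{} :: 'i set}"
    by (rule card_mono) (auto simp: affine_patterns_def)
  then show ?case by simp
next
  case (insert x I)
  define F where "F = affine_patterns (insert x I) J c W"
  define D where "D = {T. T \<subseteq> I \<and> T \<in> F \<and> insert x T \<in> F}"
  have im: "(\<lambda>T. T \<inter> I) ` F = affine_patterns I J c W"
    unfolding F_def affine_patterns_def image_image
    by (rule image_cong) (use insert.hyps in auto)
  have 1: "card F \<le> card (affine_patterns I J c W) + card D"
    using card_le_insert_split[OF insert.hyps(1,2), of F]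
    by (simp only: im D_def) (simp add: F_def affine_patterns_subset)
  have IH: "card (affine_patterns I J c W) \<le> (card I + 1) ^ card J"
    by (rule insert.IH) fact
  have 2: "card F \<le> (card I + 2) ^ card J"
  proof (cases "D = {}")
    case True
    then have "card F \<le> (card I + 1) ^ card J" using 1 IH by simp
    also have "\<dots> \<le> (card I + 2) ^ card J" by (rule power_mono) auto
    finally show ?thesis .
  next
    case False
    define l where "l = (\<lambda>a i. c i + (\<Sum>j\<in>J. a j * W j i))"
    have F_l: "F = range (\<lambda>a. {i \<in> insert x I. l a i > 0})"
      by (simp add: F_def affine_patterns_def l_def)
    have ab: "\<exists>a b. l a x \<le> 0 \<and> l b x > 0 \<and> {i\<in>I. l a i > 0} = T \<and> {i\<in>I. l b i > 0} = T"
      if "T \<in> D" for T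
    proof -
      from that obtain a b where T: "T \<subseteq> I" and a: "T = {i \<in> insert x I. l a i > 0}"
        and b: "insert x T = {i \<in> insert x I. l b i > 0}"
        by (auto simp: D_def F_l)
      have "x \<notin> T" using T insert.hyps by auto
      then have "l a x \<le> 0" using a by force
      moreover have "l b x > 0" using b by auto
      moreover have "{i\<in>I. l a i > 0} = T" using a \<open>x \<notin> T\<close> by auto
      moreover have "{i\<in>I. l b i > 0} = T" using b T \<open>x \<notin> T\<close> insert.hyps(2) by (auto simp: set_eq_iff)
      ultimately show ?thesis by blast
    qed
    \<comment> \<open>Otherwise the sign at \<open>x\<close> is that of \<open>c x\<close> for every
      parameter, and no pattern could extend in both ways.\<close>
    have "\<exists>j\<in>J. W j x \<noteq> 0"
    proof (rule ccontr)
      assume *: "\<not> ?thesis"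
      obtain T where "T \<in> D" using False by blast
      from ab[OF this] obtain a b where "l a x \<le> 0" "l b x > 0" by blast
      moreover have "l a x = c x" "l b x = c x" using * by (simp_all add: l_def)
      ultimately show False by simp
    qed
    then obtain j where j: "j \<in> J" "W j x \<noteq> 0" by blast
    \<comment> \<open>Solve \<open>l e x = 0\<close> for the coefficient of \<open>j\<close> and
      substitute; the remaining functions are affine in the parameters
      \<open>J - {j}\<close>.\<close>
    define c' where "c' = (\<lambda>i. c i - (c x / W j x) * W j i)"
    define W' where "W' = (\<lambda>h i. W h i - (W h x / W j x) * W j i)"
    have "D \<subseteq> affine_patterns I (J - {j}) c' W'"
    proof
      fix T assume "T \<in> D"
      from ab[OF this] obtain a b where ax: "l a x \<le> 0" and bx: "l b x > 0"
        and aT: "{i\<in>I. l a i > 0} = T" and bT: "{i\<in>I. l b i > 0} = T" by blast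
      \<comment> \<open>The point of the segment from \<open>a\<close> to \<open>b\<close> at which
        the function at \<open>x\<close> vanishes. Both ends have the pattern \<open>T\<close> on
        \<open>I\<close>, so by convexity this point has it too; \<open>\<tau> < 1\<close> keeps the
        positive signs strict.\<close>
      define \<tau> where "\<tau> = - l a x / (l b x - l a x)"
      define e where "e = (\<lambda>j. (1 - \<tau>) * a j + \<tau> * b j)"
      have den: "l b x - l a x > 0" using ax bx by simp
      have \<tau>0: "0 \<le> \<tau>" "\<tau> < 1" using ax bx by (auto simp: \<tau>_def divide_simps)
      have le: "l e i = (1 - \<tau>) * l a i + \<tau> * l b i" for i
      proof -
        have "(\<Sum>j\<in>J. e j * W j i) = (\<Sum>j\<in>J. (1 - \<tau>) * (a j * W j i) + \<tau> * (b j * W j i))"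
          by (intro sum.cong refl) (simp add: e_def algebra_simps)
        also have "\<dots> = (1 - \<tau>) * (\<Sum>j\<in>J. a j * W j i) + \<tau> * (\<Sum>j\<in>J. b j * W j i)"
          by (simp add: sum.distrib sum_distrib_left)
        finally show ?thesis by (simp add: l_def algebra_simps)
      qed
      have "l e x = l a x + \<tau> * (l b x - l a x)" unfolding le by algebra
      then have ex: "l e x = 0" unfolding \<tau>_def using den by simp
      have eT: "{i\<in>I. l e i > 0} = T"
      proof -
        have "l e i > 0 \<longleftrightarrow> i \<in> T" if "i \<in> I" for i
        proof (cases "i \<in> T")
          case True
          then have "l a i > 0" "l b i > 0" using aT bT by auto
          then have "(1 - \<tau>) * l a i > 0" "\<tau> * l b i \<ge> 0" using \<tau>0 by auto
          then have "l e i > 0" unfolding le by linarith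
          then show ?thesis using True by simp
        next
          case False
          then have "l a i \<le> 0" "l b i \<le> 0" using aT bT that by force+
          then have "(1 - \<tau>) * l a i \<le> 0" "\<tau> * l b i \<le> 0"
            using \<tau>0 by (auto simp: mult_nonneg_nonpos)
          then have "l e i \<le> 0" unfolding le by linarith
          then show ?thesis using False by simp
        qed
        then show ?thesis using aT by auto
      qed
      have "c' i + (\<Sum>h\<in>J - {j}. e h * W' h i) = l e i" for i
      proof -
        have "(\<Sum>h\<in>J - {j}. e h * W' h i) = (\<Sum>h\<in>J. e h * W' h i)"
          using j insert.prems by (simp add: sum.remove[of J j] W'_def)
        also have "\<dots> = (\<Sum>h\<in>J. e h * W h i) - (W j i / W j x) * (\<Sum>h\<in>J. e h * W h x)"
        proof -
          have "(\<Sum>h\<in>J. e h * W' h i)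
              = (\<Sum>h\<in>J. e h * W h i - (W j i / W j x) * (e h * W h x))"
            by (intro sum.cong refl) (simp add: W'_def algebra_simps)
          then show ?thesis by (simp add: sum_subtractf sum_distrib_left)
        qed
        also have "(\<Sum>h\<in>J. e h * W h x) = - c x" using ex by (simp add: l_def)
        finally show ?thesis by (simp add: c'_def l_def)
      qed
      then have "T = {i\<in>I. c' i + (\<Sum>h\<in>J - {j}. e h * W' h i) > 0}" using eT by simp
      then show "T \<in> affine_patterns I (J - {j}) c' W'"
        unfolding affine_patterns_def by blast
    qed
    then have "card D \<le> card (affine_patterns I (J - {j}) c' W')"
      by (intro card_mono finite_affine_patterns insert.hyps)
    also have "\<dots> \<le> (card I + 1) ^ card (J - {j})"
      by (rule insert.IH) (use insert.prems in simp)
    also have "card (J - {j}) = card J - 1" using j insert.prems by simp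
    finally have cD: "card D \<le> (card I + 1) ^ (card J - 1)" .
    obtain d where d: "card J = Suc d"
      using j insert.prems by (metis card_gt_0_iff empty_iff gr0_implies_Suc)
    have "card F \<le> (card I + 1) ^ Suc d + (card I + 1) ^ d"
      using 1 IH cD unfolding d by simp
    also have "\<dots> = (card I + 2) * (card I + 1) ^ d" by simp
    also have "\<dots> \<le> (card I + 2) * (card I + 2) ^ d"
      by (intro mult_left_mono power_mono) auto
    also have "\<dots> = (card I + 2) ^ card J" by (simp add: d)
    finally show ?thesis .
  qed
  then show ?case using insert.hyps unfolding F_def by simp
qed

section \<open>Half-spaces and tree cells on finite point sets\<close>

lemma card_halfspace_traces:
  fixes Q :: "(real ^ 'p) set"
  assumes "finite Q"
  shows "card (range (\<lambda>(\<theta> :: real ^ 'p, s). {z \<in> Q. \<theta> \<bullet> z > s})) \<le> (card Q + 1) ^ (CARD('p) + 1)"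
    and "finite (range (\<lambda>(\<theta> :: real ^ 'p, s). {z \<in> Q. \<theta> \<bullet> z > s}))"
proof -
  \<comment> \<open>The threshold is a further parameter, with weight -1 at index
    \<open>None\<close>; hence the exponent \<open>CARD('p) + 1\<close>.\<close>
  define W :: "'p option \<Rightarrow> real ^ 'p \<Rightarrow> real"
    where "W = (\<lambda>h z. case h of None \<Rightarrow> - 1 | Some j \<Rightarrow> z $ j)"
  have "range (\<lambda>(\<theta> :: real ^ 'p, s). {z \<in> Q. \<theta> \<bullet> z > s}) \<subseteq> affine_patterns Q UNIV (\<lambda>_. 0) W"
  proof (clarsimp)
    fix \<theta> :: "real ^ 'p" and s
    define a where "a = (\<lambda>h. case h of None \<Rightarrow> s | Some j \<Rightarrow> \<theta> $ j)"
    have "(\<Sum>h\<in>UNIV. a h * W h z) = \<theta> \<bullet> z - s" for z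
      by (simp add: UNIV_option_conv sum.reindex a_def W_def inner_vec_def)
    then have "{z \<in> Q. \<theta> \<bullet> z > s} = {z \<in> Q. 0 + (\<Sum>h\<in>UNIV. a h * W h z) > 0}" by auto
    then show "{z \<in> Q. \<theta> \<bullet> z > s} \<in> affine_patterns Q UNIV (\<lambda>_. 0) W"
      unfolding affine_patterns_def by (intro image_eqI[where x = a]) auto
  qed
  then have "card (range (\<lambda>(\<theta> :: real ^ 'p, s). {z \<in> Q. \<theta> \<bullet> z > s}))
      \<le> card (affine_patterns Q UNIV (\<lambda>_. 0) W)"
    and fin: "finite (range (\<lambda>(\<theta> :: real ^ 'p, s). {z \<in> Q. \<theta> \<bullet> z > s}))"
    by (rule card_mono[OF finite_affine_patterns[OF assms]],
        rule finite_subset[OF _ finite_affine_patterns[OF assms]])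
  moreover have "card (affine_patterns Q UNIV (\<lambda>_. 0) W) \<le> (card Q + 1) ^ (CARD('p) + 1)"
    using card_affine_patterns[OF assms, of "UNIV :: 'p option set" "\<lambda>_. 0" W]
    by (simp add: card_UNIV_option)
  ultimately show "card (range (\<lambda>(\<theta> :: real ^ 'p, s). {z \<in> Q. \<theta> \<bullet> z > s}))
    \<le> (card Q + 1) ^ (CARD('p) + 1)" by simp
  show "finite (range (\<lambda>(\<theta> :: real ^ 'p, s). {z \<in> Q. \<theta> \<bullet> z > s}))" by (rule fin)
qed

text \<open>
  The set \<open>H\<close> of admitted splits is \<open>UNIV\<close> for the nodes of trees, and a countable dense set where
  suprema have to be measurable.
\<close>

fun cells :: "((real ^ 'p) \<times> real) set \<Rightarrow> nat \<Rightarrow> (real ^ 'p) set set" where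
  "cells H 0 = {unit_cube}"
| "cells H (Suc d) = cells H d
     \<union> (\<lambda>(A, \<theta>, s). lower_daughter A \<theta> s) ` (cells H d \<times> H)
     \<union> (\<lambda>(A, \<theta>, s). upper_daughter A \<theta> s) ` (cells H d \<times> H)"

lemma countable_cells: "countable H \<Longrightarrow> countable (cells H d)"
  by (induction d) auto

lemma cells_mono: "d \<le> d' \<Longrightarrow> cells H d \<subseteq> cells H d'"
  by (rule lift_Suc_mono_le) auto

lemma borel_cells:
  fixes A :: "(real ^ 'p) set"
  shows "A \<in> cells H d \<Longrightarrow> A \<in> sets borel"
proof (induction d arbitrary: A)
  case (Suc d)
  have lu: "lower_daughter A \<theta> s = A \<inter> {z. \<theta> \<bullet> z \<le> s}"
    "upper_daughter A \<theta> s = A \<inter> {z. \<theta> \<bullet> z > s}" for A :: "(real ^ 'p) set" and \<theta> s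
    by (auto simp: lower_daughter_def upper_daughter_def)
  have "lower_daughter A \<theta> s \<in> sets borel" "upper_daughter A \<theta> s \<in> sets borel"
    if "A \<in> sets borel" for A :: "(real ^ 'p) set" and \<theta> s
    unfolding lu by (intro sets.Int that borel_closed closed_halfspace_le borel_open open_halfspace_gt)+
  then show ?case using Suc by auto
qed auto

text \<open>One level of splitting multiplies the number of traces by at most
  \<open>3 * (N + 1) ^ (p + 1)\<close>: a cell is kept, or it is cut by one of the half-space traces
  and replaced by either side.\<close>

definition cell_trace_bound :: "nat \<Rightarrow> nat \<Rightarrow> nat \<Rightarrow> nat" where
  "cell_trace_bound p d N = (3 * (N + 1) ^ (p + 1)) ^ d"

lemma card_cell_traces:
  fixes Q :: "(real ^ 'p) set" and H :: "((real ^ 'p) \<times> real) set"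
  assumes "finite Q"
  shows "finite ((\<inter>) Q ` cells H d) \<and>
    card ((\<inter>) Q ` cells H d) \<le> cell_trace_bound CARD('p) d (card Q)"
proof (induction d)
  case 0
  then show ?case by (simp add: cell_trace_bound_def)
next
  case (Suc d)
  define U where "U = range (\<lambda>(\<theta> :: real ^ 'p, s). {z \<in> Q. \<theta> \<bullet> z > s})"
  define T where "T = (\<inter>) Q ` cells H d"
  define h where "h = (card Q + 1) ^ (CARD('p) + 1)"
  have U: "card U \<le> h" "finite U"
    using card_halfspace_traces[OF assms] by (simp_all add: U_def h_def)
  have T: "card T \<le> (3 * h) ^ d" "finite T"
    using Suc by (simp_all add: T_def h_def cell_trace_bound_def)
  \<comment> \<open>On \<open>Q\<close> an upper daughter is an intersection with a half-space trace
    and a lower daughter a difference, so the traces in \<open>U\<close> serve both.\<close>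
  have up: "Q \<inter> upper_daughter A \<theta> s = (Q \<inter> A) \<inter> {z \<in> Q. \<theta> \<bullet> z > s}"
    and lo: "Q \<inter> lower_daughter A \<theta> s = (Q \<inter> A) - {z \<in> Q. \<theta> \<bullet> z > s}" for A \<theta> s
    by (auto simp: upper_daughter_def lower_daughter_def)
  have mem: "{z \<in> Q. \<theta> \<bullet> z > s} \<in> U" for \<theta> s unfolding U_def by auto
  have sub: "(\<inter>) Q ` cells H (Suc d) \<subseteq>
      T \<union> (\<lambda>(A, B). A - B) ` (T \<times> U) \<union> (\<lambda>(A, B). A \<inter> B) ` (T \<times> U)" (is "_ \<subseteq> ?R")
  proof
    fix V assume "V \<in> (\<inter>) Q ` cells H (Suc d)"
    then consider A where "A \<in> cells H d" "V = Q \<inter> A"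
      | A \<theta> s where "A \<in> cells H d" "V = Q \<inter> lower_daughter A \<theta> s"
      | A \<theta> s where "A \<in> cells H d" "V = Q \<inter> upper_daughter A \<theta> s" by auto
    then show "V \<in> ?R"
    proof cases
      case 1
      then show ?thesis by (auto simp: T_def)
    next
      case 2
      then have "V = (\<lambda>(A, B). A - B) (Q \<inter> A, {z \<in> Q. \<theta> \<bullet> z > s})" by (simp add: lo)
      moreover have "(Q \<inter> A, {z \<in> Q. \<theta> \<bullet> z > s}) \<in> T \<times> U" using 2 mem by (auto simp: T_def)
      ultimately show ?thesis by blast
    next
      case 3
      then have "V = (\<lambda>(A, B). A \<inter> B) (Q \<inter> A, {z \<in> Q. \<theta> \<bullet> z > s})" by (simp add: up)
      moreover have "(Q \<inter> A, {z \<in> Q. \<theta> \<bullet> z > s}) \<in> T \<times> U" using 3 mem by (auto simp: T_def)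
      ultimately show ?thesis by blast
    qed
  qed
  have fin: "finite ?R" using T U by auto
  have "card ((\<inter>) Q ` cells H (Suc d)) \<le> card ?R" by (rule card_mono[OF fin sub])
  also have "\<dots> \<le> card T + card ((\<lambda>(A, B). A - B) ` (T \<times> U)) + card ((\<lambda>(A, B). A \<inter> B) ` (T \<times> U))"
    by (meson add_le_mono card_Un_le le_trans order_refl)
  also have "\<dots> \<le> card T + card (T \<times> U) + card (T \<times> U)"
    by (intro add_mono card_image_le) (use T U in auto)
  also have "\<dots> \<le> (3 * h) ^ d + (3 * h) ^ d * h + (3 * h) ^ d * h"
    unfolding card_cartesian_product by (intro add_mono mult_mono T U) auto
  also have "\<dots> \<le> (3 * h) ^ d * h + (3 * h) ^ d * h + (3 * h) ^ d * h"
  proof -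
    have "1 \<le> h" unfolding h_def by (rule one_le_power) simp
    then show ?thesis by simp
  qed
  also have "\<dots> = cell_trace_bound CARD('p) (Suc d) (card Q)"
    unfolding cell_trace_bound_def h_def[symmetric] by simp
  finally show ?case using finite_subset[OF sub fin] by blast
qed

text \<open>\<open>H\<close> and \<open>R\<close> are parameters so that one definition gives all
  boosted fits (\<open>UNIV\<close> for both) and a countable subclass (dense \<open>H\<close>,
  rational coefficients). The cells may overlap, as those of different trees do.\<close>

definition step_functions ::
  "((real ^ 'p) \<times> real) set \<Rightarrow> real set \<Rightarrow> nat \<Rightarrow> nat \<Rightarrow> (real ^ 'p \<Rightarrow> real) set" where
  "step_functions H R d D =
    {f. \<exists>c A. (\<forall>i<D. c i \<in> R \<and> A i \<in> cells H d) \<and> f = (\<lambda>z. \<Sum>i<D. c i * indicator (A i) z)}"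

lemma countable_step_functions:
  assumes "countable H" and "countable R"
  shows "countable (step_functions H R d D)"
proof -
  define G where "G = (\<lambda>(c, A) z. \<Sum>i<D. c i * indicator (A i) z :: real)
    ` (PiE {..<D} (\<lambda>_. R) \<times> PiE {..<D} (\<lambda>_. cells H d))"
  have "step_functions H R d D \<subseteq> G"
  proof
    fix f assume "f \<in> step_functions H R d D"
    then obtain c A where cA: "\<forall>i<D. c i \<in> R \<and> A i \<in> cells H d"
      and f: "f = (\<lambda>z. \<Sum>i<D. c i * indicator (A i) z)" by (auto simp: step_functions_def)
    have "f = (\<lambda>(c, A) z. \<Sum>i<D. c i * indicator (A i) z) (restrict c {..<D}, restrict A {..<D})"
      unfolding f prod.case by (intro ext sum.cong refl) simp
    moreover have "(restrict c {..<D}, restrict A {..<D})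
        \<in> PiE {..<D} (\<lambda>_. R) \<times> PiE {..<D} (\<lambda>_. cells H d)" using cA by auto
    ultimately show "f \<in> G" unfolding G_def by (rule image_eqI)
  qed
  moreover have "countable G" unfolding G_def
    by (intro countable_image countable_SIGMA countable_PiE countable_cells assms) auto
  ultimately show ?thesis by (rule countable_subset)
qed

lemma borel_measurable_step_functions:
  assumes "f \<in> step_functions H R d D"
  shows "f \<in> borel_measurable borel"
proof -
  obtain c A where "\<forall>i<D. c i \<in> R \<and> A i \<in> cells H d"
    and f: "f = (\<lambda>z. \<Sum>i<D. c i * indicator (A i) z)"
    using assms by (auto simp: step_functions_def)
  then have "A i \<in> sets borel" if "i < D" for i using that borel_cells by blast
  then show ?thesis unfolding f
    by (intro borel_measurable_sum borel_measurable_times borel_measurable_const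
        borel_measurable_indicator) simp
qed

text \<open>
  With \<open>N e \<ge> 2 \<beta>\<close>, the exceeded levels determine the truncation of \<open>f\<close> to \<open>[-\<beta>, \<beta>]\<close> up to \<open>e\<close>.
\<close>

definition exceedances ::
  "real \<Rightarrow> real \<Rightarrow> nat \<Rightarrow> (real ^ 'p) set \<Rightarrow> (real ^ 'p \<Rightarrow> real) \<Rightarrow> ((real ^ 'p) \<times> nat) set" where
  "exceedances \<beta> e N Q f = {(z, l). z \<in> Q \<and> l < N \<and> f z > - \<beta> + real l * e}"

text \<open>Each of the \<open>D\<close> cells has one of the traces on \<open>q\<close> points;
  once the traces are fixed, exceedance sets are sign patterns of an affine family with
  \<open>D\<close> parameters on the \<open>q * N\<close> pairs of a point and a level.\<close>

definition cover_bound :: "nat \<Rightarrow> nat \<Rightarrow> nat \<Rightarrow> nat \<Rightarrow> nat \<Rightarrow> nat" where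
  "cover_bound p d D N q = (cell_trace_bound p d q * (q * N + 1)) ^ D"

lemma card_exceedances:
  fixes Q :: "(real ^ 'p) set"
  assumes "finite Q"
  shows "finite (exceedances \<beta> e N Q ` step_functions H R d D) \<and>
    card (exceedances \<beta> e N Q ` step_functions H R d D) \<le> cover_bound CARD('p) d D N (card Q)"
proof -
  define T where "T = (\<inter>) Q ` cells H d"
  define P where "P = PiE {..<D} (\<lambda>_. T)"
  define G where "G = (\<lambda>A :: nat \<Rightarrow> (real ^ 'p) set. affine_patterns (Q \<times> {..<N}) {..<D}
    (\<lambda>(z, l). \<beta> - real l * e) (\<lambda>i (z, l). indicator (A i) z))"
  have T: "finite T" "card T \<le> cell_trace_bound CARD('p) d (card Q)"
    using card_cell_traces[OF assms, of H d] by (simp_all add: T_def)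
  have finP: "finite P" unfolding P_def by (intro finite_PiE T) auto
  have finQ: "finite (Q \<times> {..<N})" using assms by simp
  have sub: "exceedances \<beta> e N Q ` step_functions H R d D \<subseteq> (\<Union>A\<in>P. G A)"
  proof
    fix V assume "V \<in> exceedances \<beta> e N Q ` step_functions H R d D"
    then obtain c A where cA: "\<forall>i<D. A i \<in> cells H d"
      and V: "V = exceedances \<beta> e N Q (\<lambda>z. \<Sum>i<D. c i * indicator (A i) z)"
      by (auto simp: step_functions_def)
    define A' where "A' = (\<lambda>i\<in>{..<D}. Q \<inter> A i)"
    have "A' \<in> P" using cA by (auto simp: P_def A'_def T_def)
    moreover have "(\<Sum>i<D. c i * indicator (A i) z :: real) = (\<Sum>i<D. c i * indicator (A' i) z)"
      if "z \<in> Q" for z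
      by (intro sum.cong refl) (use that in \<open>auto simp: A'_def indicator_def\<close>)
    then have "V = {w \<in> Q \<times> {..<N}. (\<lambda>(z, l). \<beta> - real l * e) w
        + (\<Sum>i<D. c i * (\<lambda>(z, l). indicator (A' i) z) w) > 0}"
      unfolding V exceedances_def by auto
    then have "V \<in> G A'" unfolding G_def affine_patterns_def
      by (intro image_eqI[where x = c]) auto
    ultimately show "V \<in> (\<Union>A\<in>P. G A)" by blast
  qed
  have fin: "finite (\<Union>A\<in>P. G A)"
    using finP finite_affine_patterns[OF finQ] by (auto simp: G_def)
  have "card (exceedances \<beta> e N Q ` step_functions H R d D) \<le> card (\<Union>A\<in>P. G A)"
    by (rule card_mono[OF fin sub])
  also have "\<dots> \<le> (\<Sum>A\<in>P. card (G A))" by (rule card_UN_le[OF finP])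
  also have "\<dots> \<le> (\<Sum>A\<in>P. (card Q * N + 1) ^ D)"
    unfolding G_def by (intro sum_mono order_trans[OF card_affine_patterns[OF finQ]])
      (simp_all add: card_cartesian_product)
  also have "\<dots> = card T ^ D * (card Q * N + 1) ^ D" by (simp add: P_def card_PiE)
  also have "\<dots> \<le> cover_bound CARD('p) d D N (card Q)"
    unfolding cover_bound_def power_mult_distrib by (intro mult_right_mono power_mono T) auto
  finally show ?thesis using finite_subset[OF sub fin] by blast
qed

lemma cover_bound_mono:
  assumes "q \<le> q'"
  shows "cover_bound p d D N q \<le> cover_bound p d D N q'"
proof -
  have "(q + 1) ^ (p + 1) \<le> (q' + 1) ^ (p + 1)" by (rule power_mono) (use assms in simp_all)
  then have "cell_trace_bound p d q \<le> cell_trace_bound p d q'"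
    unfolding cell_trace_bound_def by (intro power_mono) simp_all
  moreover have "q * N + 1 \<le> q' * N + 1" using assms by simp
  ultimately show ?thesis unfolding cover_bound_def by (intro power_mono mult_le_mono) simp_all
qed

section \<open>Truncation and supremum-norm covers\<close>

definition truncate :: "real \<Rightarrow> real \<Rightarrow> real" where
  "truncate \<beta> u = max (min u \<beta>) (- \<beta>)"

lemma abs_truncate_le: "\<beta> \<ge> 0 \<Longrightarrow> \<bar>truncate \<beta> u\<bar> \<le> \<beta>"
  by (auto simp: truncate_def)

lemma truncate_id: "\<bar>u\<bar> \<le> \<beta> \<Longrightarrow> truncate \<beta> u = u"
  by (auto simp: truncate_def)

lemma truncate_lipschitz: "\<bar>truncate \<beta> u - truncate \<beta> v\<bar> \<le> \<bar>u - v\<bar>"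
  by (auto simp: truncate_def)

lemma borel_measurable_truncate [measurable]: "truncate \<beta> \<in> borel_measurable borel"
  unfolding truncate_def by measurable

lemma truncate_close_aux:
  assumes e: "e > 0" and N: "real N * e \<ge> 2 * \<beta>"
    and eq: "\<And>l. l < N \<Longrightarrow> u > - \<beta> + real l * e \<longleftrightarrow> v > - \<beta> + real l * e"
  shows "truncate \<beta> v \<le> truncate \<beta> u + e"
proof (rule ccontr)
  assume "\<not> ?thesis"
  then have lt: "truncate \<beta> u + e < truncate \<beta> v" by simp
  \<comment> \<open>The first level at or above the truncation of \<open>u\<close>. If the
    truncation of \<open>v\<close> were larger by more than \<open>e\<close>, this level would be
    exceeded by \<open>v\<close> and not by \<open>u\<close>.\<close>
  define l where "l = nat \<lceil>(truncate \<beta> u + \<beta>) / e\<rceil>"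
  have nn: "(truncate \<beta> u + \<beta>) / e \<ge> 0" using e by (simp add: truncate_def)
  have l: "real l = of_int \<lceil>(truncate \<beta> u + \<beta>) / e\<rceil>" unfolding l_def using nn by simp
  have "(truncate \<beta> u + \<beta>) / e \<le> real l" "real l < (truncate \<beta> u + \<beta>) / e + 1"
    unfolding l by linarith+
  then have l1: "truncate \<beta> u + \<beta> \<le> real l * e" and l2: "real l * e < truncate \<beta> u + \<beta> + e"
    using e by (simp_all add: field_simps)
  have v: "- \<beta> + real l * e < truncate \<beta> v" using l2 lt by linarith
  \<comment> \<open>For negative \<open>\<beta>\<close> the truncation is the constant
    \<open>- \<beta>\<close>.\<close>
  have \<beta>: "\<beta> \<ge> 0"
  proof (rule ccontr)
    assume "\<not> \<beta> \<ge> 0"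
    then have "truncate \<beta> u = - \<beta>" "truncate \<beta> v = - \<beta>" by (auto simp: truncate_def)
    then show False using lt e by simp
  qed
  have "truncate \<beta> v \<le> \<beta>" using abs_truncate_le[OF \<beta>, of v] by simp
  then have "real l * e < 2 * \<beta>" using v by linarith
  then have "real l * e < real N * e" using N by linarith
  then have lN: "l < N" using e by simp
  have "v > - \<beta> + real l * e"
  proof -
    have "- \<beta> + real l * e \<ge> - \<beta>" using e by simp
    then show ?thesis using v by (auto simp: truncate_def split: if_splits)
  qed
  then have "u > - \<beta> + real l * e" using eq[OF lN] by simp
  then show False using l1 v \<open>truncate \<beta> v \<le> \<beta>\<close> by (auto simp: truncate_def split: if_splits)
qed

lemma truncate_close:
  assumes "e > 0" and "real N * e \<ge> 2 * \<beta>"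
    and "\<And>l. l < N \<Longrightarrow> u > - \<beta> + real l * e \<longleftrightarrow> v > - \<beta> + real l * e"
  shows "\<bar>truncate \<beta> u - truncate \<beta> v\<bar> \<le> e"
proof -
  have "truncate \<beta> v \<le> truncate \<beta> u + e"
    by (rule truncate_close_aux[OF assms(1,2)]) (rule assms(3))
  moreover have "truncate \<beta> u \<le> truncate \<beta> v + e"
    by (rule truncate_close_aux[OF assms(1,2)]) (rule assms(3)[symmetric])
  ultimately show ?thesis by linarith
qed

text \<open>\<open>J\<close> picks one function for each exceedance set that occurs, so the cover
  consists of members of the class itself.\<close>

lemma step_functions_cover:
  fixes Q :: "(real ^ 'p) set"
  assumes "finite Q" and "card Q \<le> q" and "e > 0" and "real N * e \<ge> 2 * \<beta>"
  obtains J where "J \<subseteq> step_functions H R d D" and "finite J"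
    and "card J \<le> cover_bound CARD('p) d D N q"
    and "\<And>f. f \<in> step_functions H R d D \<Longrightarrow>
      \<exists>g\<in>J. \<forall>z\<in>Q. \<bar>truncate \<beta> (f z) - truncate \<beta> (g z)\<bar> \<le> e"
proof -
  let ?F = "step_functions H R d D" and ?E = "exceedances \<beta> e N Q"
  have "\<exists>J\<subseteq>?F. inj_on ?E J \<and> ?E ` ?F = ?E ` J"
    using subset_image_inj[of "?E ` ?F" ?E ?F] by simp
  then obtain J where J: "J \<subseteq> ?F" "inj_on ?E J" "?E ` J = ?E ` ?F" by metis
  have c: "finite (?E ` ?F)" "card (?E ` ?F) \<le> cover_bound CARD('p) d D N (card Q)"
    using card_exceedances[OF assms(1), of \<beta> e N H R d D] by simp_all
  have "finite J" using J c by (metis finite_imageD)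
  moreover have "card J \<le> cover_bound CARD('p) d D N q"
    using c J card_image[OF J(2)] cover_bound_mono[OF assms(2)] by (metis order_trans)
  moreover have "\<exists>g\<in>J. \<forall>z\<in>Q. \<bar>truncate \<beta> (f z) - truncate \<beta> (g z)\<bar> \<le> e" if "f \<in> ?F" for f
  proof -
    have "?E f \<in> ?E ` J" unfolding J(3) by (rule imageI[OF that])
    then obtain g where g: "?E f = ?E g" "g \<in> J" by (rule imageE)
    have "\<bar>truncate \<beta> (f z) - truncate \<beta> (g z)\<bar> \<le> e" if "z \<in> Q" for z
    proof (rule truncate_close[OF assms(3,4)])
      fix l assume "l < N"
      have "(z, l) \<in> ?E g \<longleftrightarrow> (z, l) \<in> ?E f" using g by simp
      then show "f z > - \<beta> + real l * e \<longleftrightarrow> g z > - \<beta> + real l * e"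
        using that \<open>l < N\<close> by (simp add: exceedances_def)
    qed
    then show ?thesis using g by blast
  qed
  ultimately show thesis using J that by blast
qed

section \<open>Countable subclasses that are dense on finite point sets\<close>

lemma countable_halfspaces:
  obtains H :: "((real ^ 'p) \<times> real) set" where "countable H"
    and "\<And>Q \<theta> s. finite Q \<Longrightarrow> \<exists>(\<theta>', s')\<in>H. \<forall>z\<in>Q. \<theta> \<bullet> z \<le> s \<longleftrightarrow> \<theta>' \<bullet> z \<le> s'"
proof -
  obtain H :: "((real ^ 'p) \<times> real) set" where H: "countable H"
    and dense: "\<And>X. open X \<Longrightarrow> X \<noteq> {} \<Longrightarrow> \<exists>d\<in>H. d \<in> X"
    using countable_dense_exists[where 'a = "(real ^ 'p) \<times> real"] by blast
  have "\<exists>(\<theta>', s')\<in>H. \<forall>z\<in>Q. \<theta> \<bullet> z \<le> s \<longleftrightarrow> \<theta>' \<bullet> z \<le> s'"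
    if Q: "finite Q" for Q :: "(real ^ 'p) set" and \<theta> s
  proof -
    \<comment> \<open>The extra element \<open>s + 1\<close> keeps the minimum defined when no point
      lies above the threshold.\<close>
    define U where "U = insert (s + 1) ((\<bullet>) \<theta> ` {z \<in> Q. \<theta> \<bullet> z > s})"
    have U: "finite U" "U \<noteq> {}" using Q by (auto simp: U_def)
    have "Min U > s" using U by (auto simp: U_def)
    define s1 where "s1 = (s + Min U) / 2"
    have s1: "s < s1" "s1 < Min U" using \<open>Min U > s\<close> by (auto simp: s1_def)
    have gt: "\<theta> \<bullet> z > s1" if "z \<in> Q" "\<theta> \<bullet> z > s" for z
      using Min_le[OF U(1), of "\<theta> \<bullet> z"] s1 that by (auto simp: U_def)
    \<comment> \<open>Raising the threshold into the gap above \<open>s\<close> makes all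
      inequalities strict. This is an open condition on direction and threshold, so a dense set
      contains a solution.\<close>
    define X where "X = (\<Inter>z\<in>Q. if \<theta> \<bullet> z \<le> s then {w. fst w \<bullet> z < snd w} else {w. fst w \<bullet> z > snd w})"
    have "open X" unfolding X_def
      by (intro open_INT Q ballI) (auto intro!: open_Collect_less continuous_intros)
    moreover have "(\<theta>, s1) \<in> X" using s1 gt by (auto simp: X_def)
    ultimately obtain w where w: "w \<in> H" "w \<in> X" using dense[of X] by blast
    have "\<theta> \<bullet> z \<le> s \<longleftrightarrow> fst w \<bullet> z \<le> snd w" if "z \<in> Q" for z
    proof -
      have "w \<in> (if \<theta> \<bullet> z \<le> s then {w. fst w \<bullet> z < snd w} else {w. fst w \<bullet> z > snd w})"
        using w(2) that unfolding X_def by blast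
      then show ?thesis by (auto split: if_splits)
    qed
    then show ?thesis using w(1) by (intro bexI[of _ w]) (auto split: prod.splits)
  qed
  with H that show thesis by blast
qed

lemma cells_trace_dense:
  fixes Q :: "(real ^ 'p) set"
  assumes H: "\<And>\<theta> s. \<exists>(\<theta>', s')\<in>H. \<forall>z\<in>Q. \<theta> \<bullet> z \<le> s \<longleftrightarrow> \<theta>' \<bullet> z \<le> s'"
    and "A \<in> cells UNIV d"
  shows "\<exists>A'\<in>cells H d. Q \<inter> A = Q \<inter> A'"
  using assms(2)
proof (induction d arbitrary: A)
  case (Suc d)
  then consider "A \<in> cells UNIV d"
    | B \<theta> s where "B \<in> cells UNIV d" "A = lower_daughter B \<theta> s"
    | B \<theta> s where "B \<in> cells UNIV d" "A = upper_daughter B \<theta> s" by auto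
  then show ?case
  proof cases
    case 1
    then show ?thesis using Suc.IH by fastforce
  next
    case 2
    then obtain B' where B': "B' \<in> cells H d" "Q \<inter> B = Q \<inter> B'" using Suc.IH by blast
    obtain \<theta>' s' where w: "(\<theta>', s') \<in> H" "\<forall>z\<in>Q. \<theta> \<bullet> z \<le> s \<longleftrightarrow> \<theta>' \<bullet> z \<le> s'"
      using H[of \<theta> s] by auto
    have "Q \<inter> A = Q \<inter> lower_daughter B' \<theta>' s'"
      using 2 B'(2) w(2) by (auto simp: lower_daughter_def)
    moreover have "lower_daughter B' \<theta>' s' \<in> cells H (Suc d)" using B'(1) w(1) by force
    ultimately show ?thesis by blast
  next
    case 3
    then obtain B' where B': "B' \<in> cells H d" "Q \<inter> B = Q \<inter> B'" using Suc.IH by blast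
    obtain \<theta>' s' where w: "(\<theta>', s') \<in> H" "\<forall>z\<in>Q. \<theta> \<bullet> z \<le> s \<longleftrightarrow> \<theta>' \<bullet> z \<le> s'"
      using H[of \<theta> s] by auto
    have "\<forall>z\<in>Q. \<theta> \<bullet> z > s \<longleftrightarrow> \<theta>' \<bullet> z > s'" using w(2) by (simp add: not_le[symmetric])
    then have "Q \<inter> A = Q \<inter> upper_daughter B' \<theta>' s'"
      using 3 B'(2) by (auto simp: upper_daughter_def)
    moreover have "upper_daughter B' \<theta>' s' \<in> cells H (Suc d)" using B'(1) w(1) by force
    ultimately show ?thesis by blast
  qed
qed auto

lemma step_functions_dense:
  fixes f :: "real ^ 'p \<Rightarrow> real"
  assumes H: "\<And>\<theta> s. \<exists>(\<theta>', s')\<in>H. \<forall>z\<in>Q. \<theta> \<bullet> z \<le> s \<longleftrightarrow> \<theta>' \<bullet> z \<le> s'"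
    and f: "f \<in> step_functions UNIV UNIV d D" and "e > 0"
  shows "\<exists>g\<in>step_functions H \<rat> d D. \<forall>z\<in>Q. \<bar>f z - g z\<bar> \<le> e"
proof -
  obtain c A where A: "\<forall>i<D. A i \<in> cells UNIV d"
    and f: "f = (\<lambda>z. \<Sum>i<D. c i * indicator (A i) z)"
    using f by (auto simp: step_functions_def)
  have "\<forall>i. \<exists>A'. i < D \<longrightarrow> A' \<in> cells H d \<and> Q \<inter> A i = Q \<inter> A'"
    using cells_trace_dense[OF H] A by blast
  then obtain A' where A': "\<And>i. i < D \<Longrightarrow> A' i \<in> cells H d"
    "\<And>i. i < D \<Longrightarrow> Q \<inter> A i = Q \<inter> A' i" by metis
  \<comment> \<open>Rounding \<open>D\<close> coefficients costs at most \<open>e'\<close> each; the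
    denominator \<open>D + 1\<close> keeps \<open>e'\<close> positive when
    \<open>D = 0\<close>.\<close>
  define e' where "e' = e / real (D + 1)"
  have e': "e' > 0" using assms(3) by (simp add: e'_def)
  have "\<exists>q\<in>\<rat>. \<bar>c i - q\<bar> \<le> e'" for i
  proof -
    obtain q where "q \<in> \<rat>" "c i - e' < q" "q < c i + e'"
      using Rats_dense_in_real[of "c i - e'" "c i + e'"] e' by auto
    then show ?thesis by (intro bexI[of _ q]) auto
  qed
  then obtain c' where c': "\<And>i. c' i \<in> \<rat>" "\<And>i. \<bar>c i - c' i\<bar> \<le> e'" by metis
  define g where "g = (\<lambda>z. \<Sum>i<D. c' i * indicator (A' i) z :: real)"
  have "g \<in> step_functions H \<rat> d D"
    unfolding step_functions_def g_def
    by (intro CollectI exI[of _ c'] exI[of _ A'] conjI refl allI impI) (simp_all add: A' c')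
  moreover have "\<bar>f z - g z\<bar> \<le> e" if z: "z \<in> Q" for z
  proof -
    have "f z - g z = (\<Sum>i<D. (c i - c' i) * indicator (A i) z)"
      unfolding f g_def sum_subtractf[symmetric]
    proof (intro sum.cong refl)
      fix i assume "i \<in> {..<D}"
      then have "z \<in> A i \<longleftrightarrow> z \<in> A' i" using A'(2)[of i] z by auto
      then show "c i * indicator (A i) z - c' i * indicator (A' i) z
          = (c i - c' i) * indicator (A i) z" by (simp add: indicator_def)
    qed
    also have "\<bar>\<dots>\<bar> \<le> (\<Sum>i<D. e')"
      by (intro order_trans[OF sum_abs] sum_mono)
        (use c' e' in \<open>auto simp: indicator_def abs_mult less_imp_le\<close>)
    also have "\<dots> \<le> e"
      using assms(3) by (simp add: e'_def field_simps)
    finally show ?thesis .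
  qed
  ultimately show ?thesis by blast
qed

section \<open>Training error of boosted trees\<close>

lemma finite_node_points [simp]: "finite (node_points n x A)"
  by (simp add: node_points_def)

lemma node_sse_le: "node_sse n x r A \<le> (\<Sum>i\<in>node_points n x A. (r i - c)\<^sup>2)"
proof -
  define P where "P = node_points n x A"
  define \<mu> where "\<mu> = node_mean n x r A"
  have fin: "finite P" by (simp add: P_def)
  \<comment> \<open>This kills the cross term below. On an empty node the mean is 0 by convention
    and the sum is empty.\<close>
  have \<mu>: "(\<Sum>i\<in>P. r i - \<mu>) = 0"
  proof (cases "card P = 0")
    case False
    then show ?thesis by (simp add: \<mu>_def node_mean_def P_def sum_subtractf)
  qed (use fin in simp)
  have "(\<Sum>i\<in>P. (r i - c)\<^sup>2) = (\<Sum>i\<in>P. (r i - \<mu>)\<^sup>2 + 2 * (\<mu> - c) * (r i - \<mu>) + (\<mu> - c)\<^sup>2)"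
    by (intro sum.cong refl) (simp add: power2_eq_square algebra_simps)
  also have "\<dots> = (\<Sum>i\<in>P. (r i - \<mu>)\<^sup>2) + 2 * (\<mu> - c) * (\<Sum>i\<in>P. r i - \<mu>) + real (card P) * (\<mu> - c)\<^sup>2"
    by (simp add: sum.distrib sum_distrib_left)
  finally show ?thesis unfolding \<mu> by (simp add: node_sse_def P_def \<mu>_def)
qed

lemma node_points_daughters:
  "node_points n x (lower_daughter A \<theta> s) \<union> node_points n x (upper_daughter A \<theta> s) = node_points n x A"
  "node_points n x (lower_daughter A \<theta> s) \<inter> node_points n x (upper_daughter A \<theta> s) = {}"
  by (auto simp: node_points_def lower_daughter_def upper_daughter_def)

text \<open>The mean of the parent competes in both daughters.\<close>

lemma daughters_sse_le:
  "node_sse n x r (lower_daughter A \<theta> s) + node_sse n x r (upper_daughter A \<theta> s) \<le> node_sse n x r A"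
proof -
  have "node_sse n x r (lower_daughter A \<theta> s) + node_sse n x r (upper_daughter A \<theta> s)
    \<le> (\<Sum>i\<in>node_points n x (lower_daughter A \<theta> s). (r i - node_mean n x r A)\<^sup>2)
      + (\<Sum>i\<in>node_points n x (upper_daughter A \<theta> s). (r i - node_mean n x r A)\<^sup>2)"
    by (intro add_mono node_sse_le)
  also have "\<dots> = node_sse n x r A"
    unfolding node_sse_def node_points_daughters(1)[of n x A \<theta> s, symmetric]
    by (rule sum.union_disjoint[symmetric]) (simp_all add: node_points_daughters)
  finally show ?thesis .
qed

lemma odt_grow_sse:
  "odt_grow n x r t S cur handed L \<Longrightarrow>
    (\<Sum>A\<leftarrow>L. node_sse n x r A) \<le> (\<Sum>A\<leftarrow>cur @ handed. node_sse n x r A)"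
proof (induction rule: odt_grow.induct)
  case (split A cur handed \<theta> s L)
  then show ?case using daughters_sse_le[of n x r A \<theta> s] by simp
qed auto

text \<open>The partition property of the leaves, in a form that tolerates repeated empty
  nodes.\<close>

lemma odt_grow_indicator:
  "odt_grow n x r t S cur handed L \<Longrightarrow>
    (\<Sum>A\<leftarrow>L. indicator A z :: real) = (\<Sum>A\<leftarrow>cur @ handed. indicator A z)"
proof (induction rule: odt_grow.induct)
  case (split A cur handed \<theta> s L)
  have "indicator (lower_daughter A \<theta> s) z + indicator (upper_daughter A \<theta> s) z = (indicator A z :: real)"
    by (auto simp: indicator_def lower_daughter_def upper_daughter_def)
  then show ?case using split by simp
qed auto

text \<open>Invariant: every split adds one node, so \<open>N\<close> nodes have arisen by
  \<open>N - 1\<close> splits and lie at depth at most \<open>N - 1\<close>.\<close>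

lemma odt_grow_cells:
  fixes cur :: "(real ^ 'p) set list"
  shows "odt_grow n x r t S cur handed L \<Longrightarrow>
    set cur \<union> set handed \<subseteq> cells UNIV (length cur + length handed - 1) \<Longrightarrow>
    length L \<le> t \<and> set L \<subseteq> cells UNIV (t - 1)"
proof (induction rule: odt_grow.induct)
  case (enough cur handed)
  then show ?case by auto
next
  case (exhausted cur handed)
  then have "cells UNIV (length cur + length handed - 1) \<subseteq> (cells UNIV (t - 1) :: (real ^ 'p) set set)"
    by (intro cells_mono) simp
  then show ?case using exhausted by auto
next
  case (pass A cur handed L)
  then show ?case by auto
next
  case (split A cur handed \<theta> s L)
  define d where "d = length cur + length handed"
  have A: "A \<in> cells UNIV d" "set cur \<union> set handed \<subseteq> cells UNIV d"
    using split.prems by (auto simp: d_def)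
  have "lower_daughter A \<theta> s \<in> cells UNIV (Suc d)" "upper_daughter A \<theta> s \<in> cells UNIV (Suc d)"
    using A(1) by force+
  moreover have "set cur \<union> set handed \<subseteq> cells UNIV (Suc d)" using A(2) by auto
  ultimately show ?case using split.IH by (auto simp: d_def)
next
  case (new_layer handed L)
  then show ?case by auto
qed

text \<open>Exactly one entry of the list has weight 1, and it picks out its own term on both
  sides.\<close>

lemma sum_list_indicator_square:
  fixes e m :: "'b \<Rightarrow> real"
  assumes "\<And>A. A \<in> set L \<Longrightarrow> e A = 0 \<or> e A = 1" and "(\<Sum>A\<leftarrow>L. e A) = 1"
  shows "(\<Sum>A\<leftarrow>L. e A * (\<rho> - m A)\<^sup>2) = (\<rho> - (\<Sum>A\<leftarrow>L. m A * e A))\<^sup>2"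
  using assms
proof (induction L)
  case (Cons B L)
  have nn: "(\<Sum>A\<leftarrow>L. e A) \<ge> 0" by (rule sum_list_nonneg) (use Cons.prems(1) in force)
  have zero: "e A = 0" if "(\<Sum>A\<leftarrow>L. e A) = 0" "A \<in> set L" for A
  proof -
    have "\<forall>v\<in>set (map e L). v = 0"
      using sum_list_nonneg_eq_0_iff[of "map e L"] that(1) Cons.prems(1) by force
    then show ?thesis using that by simp
  qed
  consider "e B = 0" | "e B = 1" using Cons.prems(1)[of B] by auto
  then show ?case
  proof cases
    case 1
    then show ?thesis using Cons by simp
  next
    case 2
    then have "(\<Sum>A\<leftarrow>L. e A) = 0" using Cons.prems(2) by simp
    then have z: "\<And>A. A \<in> set L \<Longrightarrow> e A = 0" using zero by blast
    have "(\<Sum>A\<leftarrow>L. e A * (\<rho> - m A)\<^sup>2) = 0" "(\<Sum>A\<leftarrow>L. m A * e A) = 0"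
      using z by (simp_all cong: map_cong)
    then show ?thesis using 2 by simp
  qed
qed simp

lemma sum_list_sum_swap:
  "(\<Sum>A\<leftarrow>L. \<Sum>i\<in>I. f A i) = (\<Sum>i\<in>I. \<Sum>A\<leftarrow>L. f A i :: real)"
  by (induction L) (simp_all add: sum.distrib)

lemma tree_function_sse:
  assumes "\<And>i. i < n \<Longrightarrow> (\<Sum>A\<leftarrow>L. indicator A (x i) :: real) = 1"
  shows "(\<Sum>i<n. (r i - tree_function n x r L (x i))\<^sup>2) = (\<Sum>A\<leftarrow>L. node_sse n x r A)"
proof -
  have sse: "node_sse n x r A = (\<Sum>i<n. indicator A (x i) * (r i - node_mean n x r A)\<^sup>2)" for A
    unfolding node_sse_def node_points_def
    by (intro sum.mono_neutral_cong_left) (auto simp: indicator_def)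
  show ?thesis unfolding sse sum_list_sum_swap tree_function_def
    by (intro sum.cong refl sum_list_indicator_square[symmetric] assms) (auto simp: indicator_def)
qed

text \<open>Only the split of the root is tracked, as later splits can only lower the error.
  \<open>t \<ge> 2\<close> and \<open>n \<ge> 2\<close> exclude every other rule at the
  root.\<close>

lemma odt_estimator_sse:
  assumes g: "is_odt_estimator n x r t S g" and t: "t \<ge> 2" and n: "n \<ge> 2"
    and x: "\<And>i. i < n \<Longrightarrow> x i \<in> unit_cube"
  obtains \<theta> s where "best_split n x r (S 1) unit_cube \<theta> s"
    and "(\<Sum>i<n. (r i - g (x i))\<^sup>2)
      \<le> node_sse n x r (lower_daughter unit_cube \<theta> s) + node_sse n x r (upper_daughter unit_cube \<theta> s)"
proof -
  obtain L where L: "odt_grow n x r t S [unit_cube] [] L" "g = tree_function n x r L"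
    using g unfolding is_odt_estimator_def by blast
  have one: "(\<Sum>A\<leftarrow>L. indicator A (x i) :: real) = 1" if "i < n" for i
    using odt_grow_indicator[OF L(1), of "x i"] x[OF that] by simp
  have fit: "(\<Sum>i<n. (r i - g (x i))\<^sup>2) = (\<Sum>A\<leftarrow>L. node_sse n x r A)"
    unfolding L(2) by (rule tree_function_sse[OF one])
  have "node_points n x unit_cube = {..<n}" using x by (auto simp: node_points_def)
  then have c: "card (node_points n x unit_cube) = n" by simp
  from L(1) show thesis
  proof cases
    case (split \<theta> s)
    have "(\<Sum>A\<leftarrow>L. node_sse n x r A)
      \<le> node_sse n x r (lower_daughter unit_cube \<theta> s) + node_sse n x r (upper_daughter unit_cube \<theta> s)"
      using odt_grow_sse[OF split(4)] by simp
    then show thesis using that[of \<theta> s] split fit by simp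
  qed (use t n c in auto)
qed

lemma odt_estimator_sse_le:
  assumes g: "is_odt_estimator n x r t S g" and t: "t \<ge> 2" and n: "n \<ge> 2"
    and x: "\<And>i. i < n \<Longrightarrow> x i \<in> unit_cube"
  shows "(\<Sum>i<n. (r i - g (x i))\<^sup>2) \<le> (\<Sum>i<n. (r i)\<^sup>2)"
proof -
  obtain \<theta> s where "(\<Sum>i<n. (r i - g (x i))\<^sup>2)
      \<le> node_sse n x r (lower_daughter unit_cube \<theta> s) + node_sse n x r (upper_daughter unit_cube \<theta> s)"
    using odt_estimator_sse[OF assms] by blast
  also have "\<dots> \<le> node_sse n x r unit_cube" by (rule daughters_sse_le)
  also have "\<dots> \<le> (\<Sum>i\<in>node_points n x unit_cube. (r i - 0)\<^sup>2)" by (rule node_sse_le)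
  also have "node_points n x unit_cube = {..<n}" using x by (auto simp: node_points_def)
  finally show ?thesis by simp
qed

text \<open>
  Comparing the chosen split with the one that is constant on the lower daughter and zero on the
  upper one.
\<close>

lemma odt_estimator_sse_gain:
  fixes x :: "nat \<Rightarrow> real ^ 'p"
  assumes g: "is_odt_estimator n x r t S g" and t: "t \<ge> 2" and n: "n \<ge> 2"
    and x: "\<And>i. i < n \<Longrightarrow> x i \<in> unit_cube"
    and S: "S 1 = UNIV" and \<phi>: "norm \<phi> = 1"
  shows "(\<Sum>i | i < n \<and> \<phi> \<bullet> x i \<le> u. r i)\<^sup>2
    \<le> real n * ((\<Sum>i<n. (r i)\<^sup>2) - (\<Sum>i<n. (r i - g (x i))\<^sup>2))"
proof -
  obtain \<theta> s where b: "best_split n x r (S 1) unit_cube \<theta> s"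
    and le: "(\<Sum>i<n. (r i - g (x i))\<^sup>2)
      \<le> node_sse n x r (lower_daughter unit_cube \<theta> s) + node_sse n x r (upper_daughter unit_cube \<theta> s)"
    using odt_estimator_sse[OF g t n x] by blast
  have np: "node_points n x unit_cube = {..<n}" using x by (auto simp: node_points_def)
  have "\<phi> \<in> directions (S 1)" using \<phi> S by (simp add: directions_def)
  then have "impurity_gain n x r unit_cube \<phi> u \<le> impurity_gain n x r unit_cube \<theta> s"
    using b unfolding best_split_def by blast
  then have opt: "node_sse n x r (lower_daughter unit_cube \<theta> s) + node_sse n x r (upper_daughter unit_cube \<theta> s)
    \<le> node_sse n x r (lower_daughter unit_cube \<phi> u) + node_sse n x r (upper_daughter unit_cube \<phi> u)"
    using n by (simp add: impurity_gain_def np divide_le_cancel)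
  define P where "P = {i. i < n \<and> \<phi> \<bullet> x i \<le> u}"
  define P' where "P' = {i. i < n \<and> \<phi> \<bullet> x i > u}"
  define \<sigma> where "\<sigma> = (\<Sum>i\<in>P. r i)"
  \<comment> \<open>Not the mean over \<open>P\<close> but the minimiser of
    \<open>n c^2 - 2 c \<sigma>\<close>: it gives the gain \<open>\<sigma>^2 / n\<close> directly,
    also for empty \<open>P\<close>.\<close>
  define c where "c = \<sigma> / real n"
  have PP: "{..<n} = P \<union> P'" "P \<inter> P' = {}" "finite P" "finite P'" by (auto simp: P_def P'_def)
  have lo: "node_points n x (lower_daughter unit_cube \<phi> u) = P"
    and up: "node_points n x (upper_daughter unit_cube \<phi> u) = P'"
    using x by (auto simp: P_def P'_def node_points_def lower_daughter_def upper_daughter_def)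
  have "node_sse n x r (lower_daughter unit_cube \<phi> u) + node_sse n x r (upper_daughter unit_cube \<phi> u)
    \<le> (\<Sum>i\<in>P. (r i - c)\<^sup>2) + (\<Sum>i\<in>P'. (r i - 0)\<^sup>2)"
    unfolding lo[symmetric] up[symmetric] by (intro add_mono node_sse_le)
  also have "(\<Sum>i\<in>P. (r i - c)\<^sup>2) = (\<Sum>i\<in>P. (r i)\<^sup>2 - 2 * c * r i + c\<^sup>2)"
    by (intro sum.cong refl) (simp add: power2_eq_square algebra_simps)
  also have "\<dots> = (\<Sum>i\<in>P. (r i)\<^sup>2) - 2 * c * \<sigma> + real (card P) * c\<^sup>2"
    by (simp add: sum.distrib sum_subtractf sum_distrib_left \<sigma>_def)
  also have "\<dots> \<le> (\<Sum>i\<in>P. (r i)\<^sup>2) - 2 * c * \<sigma> + real n * c\<^sup>2"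
  proof -
    have "card P \<le> card {..<n}" by (rule card_mono) (auto simp: P_def)
    then show ?thesis by (simp add: mult_right_mono)
  qed
  also have "real n * c\<^sup>2 = c * \<sigma>" using n by (simp add: c_def power2_eq_square)
  also have "(\<Sum>i\<in>P. (r i)\<^sup>2) - 2 * c * \<sigma> + c * \<sigma> + (\<Sum>i\<in>P'. (r i - 0)\<^sup>2)
      = (\<Sum>i<n. (r i)\<^sup>2) - \<sigma>\<^sup>2 / real n"
    unfolding PP(1) sum.union_disjoint[OF PP(3,4,2)] by (simp add: c_def power2_eq_square)
  finally have "(\<Sum>i<n. (r i - g (x i))\<^sup>2) \<le> (\<Sum>i<n. (r i)\<^sup>2) - \<sigma>\<^sup>2 / real n"
    using le opt by linarith
  then have "\<sigma>\<^sup>2 / real n \<le> (\<Sum>i<n. (r i)\<^sup>2) - (\<Sum>i<n. (r i - g (x i))\<^sup>2)" by linarith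
  then show ?thesis using n by (simp add: \<sigma>_def P_def divide_le_eq mult.commute)
qed

section \<open>Greedy approximation by boosting\<close>

lemma quadratic_nonneg_imp_zero:
  fixes u v :: real
  assumes "\<And>\<tau>. 0 \<le> \<tau>\<^sup>2 * v - 2 * \<tau> * u"
  shows "u = 0"
proof (rule ccontr)
  assume u: "u \<noteq> 0"
  \<comment> \<open>The natural test point is \<open>u / v\<close>; \<open>w\<close> replaces
    \<open>v\<close> so that the denominator is positive whatever the sign of
    \<open>v\<close>.\<close>
  define w where "w = \<bar>v\<bar> + 1"
  have w: "w > 0" "v \<le> w" by (simp_all add: w_def)
  have "0 \<le> (u / w)\<^sup>2 * v - 2 * (u / w) * u" by (rule assms)
  also have "\<dots> \<le> (u / w)\<^sup>2 * w - 2 * (u / w) * u" using w by (intro diff_right_mono mult_left_mono) auto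
  also have "\<dots> = - (u\<^sup>2 / w)" using w by (simp add: power2_eq_square field_simps)
  also have "\<dots> < 0" using u w by simp
  finally show False by simp
qed

text \<open>The correlation with \<open>r\<close> is linear, so a bound for half-space indicators
  extends to series of them at the price of the sum of the absolute coefficients.\<close>

lemma abs_sum_ridge_le:
  fixes x :: "nat \<Rightarrow> real ^ 'p"
  assumes a: "summable (\<lambda>j. \<bar>a j\<bar>)" "(\<Sum>j. \<bar>a j\<bar>) \<le> V" and "b \<ge> 0"
    and h: "\<And>i. i < n \<Longrightarrow> h (x i) = (\<Sum>j. a j * heaviside (\<theta> j \<bullet> x i + s j))"
    and b: "\<And>\<phi> u. norm \<phi> = 1 \<Longrightarrow> \<bar>\<Sum>i | i < n \<and> \<phi> \<bullet> x i \<le> u. r i\<bar> \<le> b"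
  shows "\<bar>\<Sum>i<n. r i * h (x i)\<bar> \<le> V * b"
proof -
  have hb: "\<bar>\<Sum>i<n. r i * heaviside (\<psi> \<bullet> x i + u)\<bar> \<le> b" for \<psi> :: "real ^ 'p" and u
  proof (cases "\<psi> = 0")
    case False
    \<comment> \<open>Normalised to a unit direction and reversed, because lower daughters are given
      by \<open>\<le>\<close>.\<close>
    define \<phi> where "\<phi> = (- 1 / norm \<psi>) *\<^sub>R \<psi>"
    have "norm \<phi> = 1" using False by (simp add: \<phi>_def)
    have "heaviside (\<psi> \<bullet> z + u) = (if \<phi> \<bullet> z \<le> u / norm \<psi> then 1 else 0)" for z
    proof -
      have "\<phi> \<bullet> z \<le> u / norm \<psi> \<longleftrightarrow> \<psi> \<bullet> z + u \<ge> 0"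
        using False by (auto simp: \<phi>_def divide_simps)
      then show ?thesis by (simp add: heaviside_def)
    qed
    then have "(\<Sum>i<n. r i * heaviside (\<psi> \<bullet> x i + u))
        = (\<Sum>i<n. if \<phi> \<bullet> x i \<le> u / norm \<psi> then r i else 0)"
      by (intro sum.cong refl) simp
    also have "\<dots> = (\<Sum>i | i < n \<and> \<phi> \<bullet> x i \<le> u / norm \<psi>. r i)"
      by (simp add: sum.inter_filter[symmetric])
    finally show ?thesis using b[OF \<open>norm \<phi> = 1\<close>] by simp
  next
    case True
    \<comment> \<open>For \<open>\<psi> = 0\<close> the step is constantly 0 or 1; the constant 1 is
      realised on the sample by a half-space that contains all its points.\<close>
    define \<phi> :: "real ^ 'p" where "\<phi> = axis undefined 1"
    define w where "w = Max (insert 0 ((\<lambda>i. \<phi> \<bullet> x i) ` {..<n}))"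
    have "\<phi> \<bullet> x i \<le> w" if "i < n" for i
      unfolding w_def by (rule Max_ge) (use that in auto)
    then have eq: "{i. i < n \<and> \<phi> \<bullet> x i \<le> w} = {..<n}" by auto
    have "norm \<phi> = 1" by (simp add: \<phi>_def norm_axis_1)
    from b[OF this, of w] have "\<bar>\<Sum>i<n. r i\<bar> \<le> b" unfolding eq .
    then show ?thesis using True assms(3) by (simp add: heaviside_def)
  qed
  define c where "c = (\<lambda>j. \<Sum>i<n. r i * heaviside (\<theta> j \<bullet> x i + s j))"
  have c: "\<bar>a j * c j\<bar> \<le> \<bar>a j\<bar> * b" for j
    unfolding abs_mult c_def by (intro mult_left_mono hb) simp
  have hs: "\<bar>heaviside v\<bar> \<le> 1" for v by (simp add: heaviside_def)
  have summ: "summable (\<lambda>j. a j * heaviside (\<theta> j \<bullet> x i + s j))" for i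
  proof (rule summable_comparison_test'[OF a(1), of 0])
    fix j :: nat
    show "norm (a j * heaviside (\<theta> j \<bullet> x i + s j)) \<le> \<bar>a j\<bar>"
      using mult_left_mono[OF hs abs_ge_zero[of "a j"]] by (simp add: abs_mult)
  qed
  have "(\<Sum>i<n. r i * h (x i)) = (\<Sum>i<n. \<Sum>j. r i * (a j * heaviside (\<theta> j \<bullet> x i + s j)))"
    by (intro sum.cong refl) (simp add: h suminf_mult[OF summ])
  also have "\<dots> = (\<Sum>j. \<Sum>i<n. r i * (a j * heaviside (\<theta> j \<bullet> x i + s j)))"
    by (intro suminf_sum[symmetric] summable_mult summ)
  also have "\<dots> = (\<Sum>j. a j * c j)"
    by (simp add: c_def sum_distrib_left mult.left_commute)
  finally have eq: "(\<Sum>i<n. r i * h (x i)) = (\<Sum>j. a j * c j)" .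
  have sb: "summable (\<lambda>j. \<bar>a j\<bar> * b)" using a(1) by (rule summable_mult2)
  have sac: "summable (\<lambda>j. \<bar>a j * c j\<bar>)"
    by (rule summable_comparison_test'[OF sb, of 0]) (use c in simp)
  have "\<bar>\<Sum>j. a j * c j\<bar> \<le> (\<Sum>j. \<bar>a j * c j\<bar>)"
    using summable_rabs[OF sac] .
  also have "\<dots> \<le> (\<Sum>j. \<bar>a j\<bar> * b)" by (rule suminf_le[OF c sac sb])
  also have "\<dots> = (\<Sum>j. \<bar>a j\<bar>) * b" using a(1) by (rule suminf_mult2[symmetric])
  also have "\<dots> \<le> V * b" using a(2) assms(3) by (rule mult_right_mono)
  finally show ?thesis by (simp add: eq)
qed

lemma greedy_rate_step:
  fixes d d' K :: real
  assumes "real N * d \<le> K" and "d' \<le> d" and "d > 0 \<Longrightarrow> d' \<le> d - d\<^sup>2 / K" and "K > 0"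
  shows "real (Suc N) * d' \<le> K"
proof (cases "d > 0")
  case True
  define z where "z = d / K"
  have z: "z > 0" "real N * z \<le> 1" using True assms by (simp_all add: z_def field_simps)
  have d: "d = K * z" using assms by (simp add: z_def)
  have d': "d' \<le> K * (z * (1 - z))" using assms(3)[OF True] assms(4)
    unfolding d by (simp add: power2_eq_square algebra_simps)
  show ?thesis
  proof (cases "z \<le> 1")
    case True
    have "real (Suc N) * d' \<le> real (Suc N) * (K * (z * (1 - z)))" by (rule mult_left_mono[OF d']) simp
    also have "\<dots> = K * ((real (Suc N) * z) * (1 - z))" by simp
    also have "\<dots> \<le> K * ((1 + z) * (1 - z))"
      using z True assms(4) by (intro mult_left_mono mult_right_mono) (auto simp: algebra_simps)
    also have "\<dots> = K - K * z\<^sup>2" by (simp add: power2_eq_square algebra_simps)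
    also have "\<dots> \<le> K" using assms(4) by simp
    finally show ?thesis .
  next
    \<comment> \<open>Here \<open>N = 0\<close>, and a single step already makes the excess
      nonpositive.\<close>
    case False
    then have "z * (1 - z) \<le> 0" using z by (intro mult_nonneg_nonpos) auto
    then have "d' \<le> 0" using d' assms(4) by (smt (verit) mult_nonneg_nonpos)
    then show ?thesis using assms(4) by (smt (verit) mult_nonneg_nonpos of_nat_0_le_iff)
  qed
next
  case False
  then have "d' \<le> 0" using assms(2) by simp
  then show ?thesis using assms(4) by (smt (verit) mult_nonneg_nonpos of_nat_0_le_iff)
qed

text \<open>
  Each tree whose first split may use all coordinates reduces the training error like a step of the
  orthogonal greedy algorithm, because the residuals are orthogonal to the current fit.
\<close>

lemma boosting_training_error:
  fixes x :: "nat \<Rightarrow> real ^ 'p"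
  assumes boost: "is_boosting_tree n x y t k S f" and t: "t \<ge> 2" and n: "n \<ge> 2"
    and x: "\<And>i. i < n \<Longrightarrow> x i \<in> unit_cube"
    and a: "summable (\<lambda>j. \<bar>\<alpha> j\<bar>)" "(\<Sum>j. \<bar>\<alpha> j\<bar>) \<le> V" and V: "V > 0"
    and h: "\<And>i. i < n \<Longrightarrow> h (x i) = (\<Sum>j. \<alpha> j * heaviside (\<theta> j \<bullet> x i + s j))"
  shows "real (card {j\<in>{1..k}. S j 1 = UNIV})
      * ((\<Sum>i<n. (y i - f (x i))\<^sup>2) - (\<Sum>i<n. (y i - h (x i))\<^sup>2)) \<le> 4 * V\<^sup>2 * real n"
proof -
  obtain g a where odt: "\<And>j. j \<in> {1..k} \<Longrightarrow>
        is_odt_estimator n x (\<lambda>i. y i - boost_comb g (j - 1) (a (j - 1)) (x i)) t (S j) (g j)"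
    and ls: "\<And>j c. j \<in> {1..k} \<Longrightarrow> (\<Sum>i<n. (y i - boost_comb g j (a j) (x i))\<^sup>2)
              \<le> (\<Sum>i<n. (y i - boost_comb g j c (x i))\<^sup>2)"
    and f: "f = boost_comb g k (a k)"
    using boost unfolding is_boosting_tree_def by blast
  define m where "m = (\<lambda>j i. boost_comb g j (a j) (x i))"
  define R where "R = (\<lambda>j. \<Sum>i<n. (y i - m j i)\<^sup>2)"
  define E where "E = (\<Sum>i<n. (y i - h (x i))\<^sup>2)"
  \<comment> \<open>From \<open>((R j - E) / 2)^2 \<le> V^2 n \<Delta>\<close>, where
    \<open>\<Delta>\<close> is the gain of the next tree.\<close>
  define K where "K = 4 * V\<^sup>2 * real n"
  have K: "K > 0" using V n by (simp add: K_def)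
  have orth: "(\<Sum>i<n. (y i - m j i) * m j i) = 0" if "j \<le> k" for j
  proof (cases "j = 0")
    case False
    show ?thesis
    proof (rule quadratic_nonneg_imp_zero)
      fix \<tau> :: real
      \<comment> \<open>Rescaling all coefficients by \<open>1 + \<tau>\<close> gives a competitor
        in the least squares problem, so the derivative in \<open>\<tau>\<close> vanishes at
        0.\<close>
      have "boost_comb g j (\<lambda>l. (1 + \<tau>) * a j l) z = (1 + \<tau>) * boost_comb g j (a j) z" for z
        by (simp add: boost_comb_def sum_distrib_left mult.assoc)
      then have "R j \<le> (\<Sum>i<n. (y i - (1 + \<tau>) * m j i)\<^sup>2)"
        using ls[of j "\<lambda>l. (1 + \<tau>) * a j l"] that False by (simp add: R_def m_def)
      also have "\<dots> = (\<Sum>i<n. (y i - m j i)\<^sup>2 + \<tau>\<^sup>2 * (m j i)\<^sup>2 - 2 * \<tau> * ((y i - m j i) * m j i))"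
        by (intro sum.cong refl) (simp add: power2_eq_square algebra_simps)
      also have "\<dots> = R j + \<tau>\<^sup>2 * (\<Sum>i<n. (m j i)\<^sup>2) - 2 * \<tau> * (\<Sum>i<n. (y i - m j i) * m j i)"
        by (simp add: R_def sum.distrib sum_subtractf sum_distrib_left)
      finally show "0 \<le> \<tau>\<^sup>2 * (\<Sum>i<n. (m j i)\<^sup>2) - 2 * \<tau> * (\<Sum>i<n. (y i - m j i) * m j i)" by simp
    qed
  qed (simp add: m_def boost_comb_def)
  have step: "R (Suc j) \<le> (\<Sum>i<n. ((y i - m j i) - g (Suc j) (x i))\<^sup>2)" if "Suc j \<le> k" for j
  proof -
    \<comment> \<open>Keeping the old coefficients and giving the new tree weight 1 is a competitor
      of the refit.\<close>
    have "boost_comb g (Suc j) ((a j)(Suc j := 1)) z = boost_comb g j (a j) z + g (Suc j) z" for z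
      by (simp add: boost_comb_def)
    moreover have "R (Suc j) \<le> (\<Sum>i<n. (y i - boost_comb g (Suc j) ((a j)(Suc j := 1)) (x i))\<^sup>2)"
      unfolding R_def m_def by (rule ls) (use that in simp)
    ultimately show ?thesis by (simp add: m_def diff_diff_eq)
  qed
  have odt': "is_odt_estimator n x (\<lambda>i. y i - m j i) t (S (Suc j)) (g (Suc j))" if "Suc j \<le> k" for j
    using odt[of "Suc j"] that by (simp add: m_def)
  have mono: "R (Suc j) \<le> R j" if "Suc j \<le> k" for j
    using step[OF that] odt_estimator_sse_le[OF odt'[OF that] t n x] by (simp add: R_def)
  have gain: "R (Suc j) - E \<le> (R j - E) - (R j - E)\<^sup>2 / K"
    if j: "Suc j \<le> k" and U: "S (Suc j) 1 = UNIV" and pos: "R j - E > 0" for j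
  proof -
    define r where "r = (\<lambda>i. y i - m j i)"
    define \<Delta> where "\<Delta> = R j - (\<Sum>i<n. (r i - g (Suc j) (x i))\<^sup>2)"
    have Rr: "R j = (\<Sum>i<n. (r i)\<^sup>2)" by (simp add: R_def r_def)
    have half: "(\<Sum>i | i < n \<and> \<phi> \<bullet> x i \<le> u. r i)\<^sup>2 \<le> real n * \<Delta>" if "norm \<phi> = 1" for \<phi> u
      using odt_estimator_sse_gain[OF odt'[OF j] t n x U that, of u]
      by (simp add: r_def \<Delta>_def R_def)
    have nD: "real n * \<Delta> \<ge> 0"
      using half[of "axis undefined 1" 0] by (simp add: norm_axis_1 order_trans[OF zero_le_power2])
    have b: "\<bar>\<Sum>i | i < n \<and> \<phi> \<bullet> x i \<le> u. r i\<bar> \<le> sqrt (real n * \<Delta>)" if "norm \<phi> = 1" for \<phi> u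
      using real_sqrt_le_mono[OF half[OF that]] by simp
    have corr: "\<bar>\<Sum>i<n. r i * h (x i)\<bar> \<le> V * sqrt (real n * \<Delta>)"
      by (rule abs_sum_ridge_le[where a = \<alpha> and \<theta> = \<theta> and s = s and x = x, OF a])
        (use nD in simp, erule h, erule b)
    \<comment> \<open>Write \<open>h = r + m - (y - h)\<close>: the fit \<open>m\<close> is
      orthogonal to \<open>r\<close>, and Young's inequality leaves at least half of the excess
      \<open>R j - E\<close>.\<close>
    have "(\<Sum>i<n. r i * h (x i)) = (\<Sum>i<n. (r i)\<^sup>2 + r i * m j i - r i * (y i - h (x i)))"
      by (intro sum.cong refl) (simp add: r_def power2_eq_square algebra_simps)
    also have "\<dots> = R j - (\<Sum>i<n. r i * (y i - h (x i)))"
      using orth[of j] j by (simp add: sum.distrib sum_subtractf Rr) (simp add: r_def)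
    also have "(\<Sum>i<n. r i * (y i - h (x i))) \<le> (\<Sum>i<n. (r i)\<^sup>2 / 2 + (y i - h (x i))\<^sup>2 / 2)"
    proof (rule sum_mono)
      fix i
      have "0 \<le> (r i - (y i - h (x i)))\<^sup>2" by simp
      then show "r i * (y i - h (x i)) \<le> (r i)\<^sup>2 / 2 + (y i - h (x i))\<^sup>2 / 2"
        by (simp add: power2_diff[of "r i" "y i - h (x i)"])
    qed
    then have "R j - (\<Sum>i<n. r i * (y i - h (x i))) \<ge> (R j - E) / 2"
      by (simp add: sum.distrib sum_divide_distrib[symmetric] Rr E_def)
    finally have "(R j - E) / 2 \<le> V * sqrt (real n * \<Delta>)" using corr by linarith
    then have "((R j - E) / 2)\<^sup>2 \<le> (V * sqrt (real n * \<Delta>))\<^sup>2"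
      using pos by (intro power_mono) auto
    also have "\<dots> = V\<^sup>2 * (real n * \<Delta>)" using nD by (simp add: power_mult_distrib)
    finally have "(R j - E)\<^sup>2 \<le> K * \<Delta>" by (simp add: K_def power_divide)
    then have "(R j - E)\<^sup>2 / K \<le> \<Delta>" using K by (simp add: divide_le_eq mult.commute)
    then show ?thesis using step[OF j] by (simp add: \<Delta>_def r_def)
  qed
  have "real (card {i\<in>{1..j}. S i 1 = UNIV}) * (R j - E) \<le> K" if "j \<le> k" for j
    using that
  proof (induction j)
    case 0
    then show ?case using K by simp
  next
    case (Suc j)
    define N where "N = (\<lambda>j. card {i\<in>{1..j}. S i 1 = UNIV})"
    have IH: "real (N j) * (R j - E) \<le> K" using Suc by (simp add: N_def)
    show ?case
    proof (cases "S (Suc j) 1 = UNIV")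
      case True
      then have "{i\<in>{1..Suc j}. S i 1 = UNIV} = insert (Suc j) {i\<in>{1..j}. S i 1 = UNIV}"
        by (auto simp: le_Suc_eq)
      then have "N (Suc j) = Suc (N j)" by (simp add: N_def)
      moreover have "real (Suc (N j)) * (R (Suc j) - E) \<le> K"
        by (rule greedy_rate_step[OF IH _ _ K])
          (use mono[of j] gain[of j] True Suc.prems in auto)
      ultimately show ?thesis by (simp add: N_def)
    next
      case False
      then have "{i\<in>{1..Suc j}. S i 1 = UNIV} = {i\<in>{1..j}. S i 1 = UNIV}"
        by (auto simp: le_Suc_eq)
      then have "N (Suc j) = N j" by (simp add: N_def)
      moreover have "real (N j) * (R (Suc j) - E) \<le> real (N j) * (R j - E)"
        using mono[of j] Suc.prems by (intro mult_left_mono) auto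
      ultimately show ?thesis using IH by (simp add: N_def)
    qed
  qed
  from this[of k] show ?thesis by (simp add: R_def E_def K_def m_def f)
qed

text \<open>Growth may stop with fewer than \<open>t\<close> leaves; such a tree is padded by cells
  with coefficient 0, so that tree and leaf numbers combine to one index below
  \<open>k * t\<close>.\<close>

lemma boosting_tree_step_function:
  fixes x :: "nat \<Rightarrow> real ^ 'p"
  assumes "is_boosting_tree n x y t k S f"
  shows "f \<in> step_functions UNIV UNIV (t - 1) (k * t)"
proof -
  obtain g a where odt: "\<And>j. j \<in> {1..k} \<Longrightarrow>
        is_odt_estimator n x (\<lambda>i. y i - boost_comb g (j - 1) (a (j - 1)) (x i)) t (S j) (g j)"
    and f: "f = boost_comb g k (a k)"
    using assms unfolding is_boosting_tree_def by blast
  have "\<forall>j\<in>{1..k}. \<exists>w. (\<forall>i<t. snd w i \<in> cells UNIV (t - 1)) \<and>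
      g j = (\<lambda>z. \<Sum>i<t. fst w i * indicator (snd w i) z)"
  proof
    fix j assume j: "j \<in> {1..k}"
    define r where "r = (\<lambda>i. y i - boost_comb g (j - 1) (a (j - 1)) (x i))"
    obtain L where L: "odt_grow n x r t (S j) [unit_cube] [] L" "g j = tree_function n x r L"
      using odt[OF j] unfolding is_odt_estimator_def r_def by blast
    have len: "length L \<le> t" and cells: "set L \<subseteq> cells UNIV (t - 1)"
      using odt_grow_cells[OF L(1)] by auto
    define c where "c = (\<lambda>i. if i < length L then node_mean n x r (L ! i) else 0)"
    define A where "A = (\<lambda>i. if i < length L then L ! i else unit_cube)"
    have "A i \<in> cells UNIV (t - 1)" for i
      using cells cells_mono[of 0 "t - 1" UNIV] by (auto simp: A_def)
    moreover have "g j z = (\<Sum>i<t. c i * indicator (A i) z)" for z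
    proof -
      have "g j z = (\<Sum>i<length L. node_mean n x r (L ! i) * indicator (L ! i) z)"
        by (simp add: L(2) tree_function_def sum_list_sum_nth lessThan_atLeast0)
      also have "\<dots> = (\<Sum>i<length L. c i * indicator (A i) z)"
        by (intro sum.cong refl) (simp add: c_def A_def)
      also have "\<dots> = (\<Sum>i<t. c i * indicator (A i) z)"
        by (rule sum.mono_neutral_left) (use len in \<open>auto simp: c_def\<close>)
      finally show ?thesis .
    qed
    ultimately show "\<exists>w. (\<forall>i<t. snd w i \<in> cells UNIV (t - 1)) \<and>
        g j = (\<lambda>z. \<Sum>i<t. fst w i * indicator (snd w i) z)"
      by (intro exI[of _ "(c, A)"]) (simp add: fun_eq_iff)
  qed
  from bchoice[OF this] obtain w where w: "\<forall>j\<in>{1..k}. (\<forall>i<t. snd (w j) i \<in> cells UNIV (t - 1)) \<and>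
      g j = (\<lambda>z. \<Sum>i<t. fst (w j) i * indicator (snd (w j) i) z)" by blast
  define c A where "c = (\<lambda>j. fst (w j))" and "A = (\<lambda>j. snd (w j))"
  have cA: "\<forall>i<t. A j i \<in> cells UNIV (t - 1)"
    "g j = (\<lambda>z. \<Sum>i<t. c j i * indicator (A j i) z)" if "j \<in> {1..k}" for j
    using w that by (simp_all add: c_def A_def)
  define c' where "c' = (\<lambda>i. a k (i div t + 1) * c (i div t + 1) (i mod t))"
  define A' where "A' = (\<lambda>i. A (i div t + 1) (i mod t))"
  have idx: "i div t + 1 \<in> {1..k} \<and> i mod t < t" if "i < k * t" for i
  proof -
    have "t > 0" using that by (cases t) auto
    moreover have "i div t < k" using that by (simp add: less_mult_imp_div_less)
    ultimately show ?thesis by simp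
  qed
  have "f z = (\<Sum>i<k * t. c' i * indicator (A' i) z)" for z
  proof -
    have "f z = (\<Sum>l=1..k. a k l * (\<Sum>i<t. c l i * indicator (A l i) z))"
      unfolding f boost_comb_def by (intro sum.cong refl) (simp add: cA(2))
    also have "\<dots> = (\<Sum>l<k. a k (l + 1) * (\<Sum>i<t. c (l + 1) i * indicator (A (l + 1) i) z))"
      by (rule sum.reindex_bij_witness[of _ "\<lambda>l. l + 1" "\<lambda>l. l - 1"]) auto
    also have "\<dots> = (\<Sum>l<k. \<Sum>i<t. c' (l * t + i) * indicator (A' (l * t + i)) z)"
      unfolding sum_distrib_left by (intro sum.cong refl) (simp add: c'_def A'_def mult.assoc)
    also have "\<dots> = (\<Sum>i<k * t. c' i * indicator (A' i) z)"
    proof -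
      have shift: "(\<Sum>i<t. F (l * t + i)) = sum F {l * t..<l * t + t}" for l and F :: "nat \<Rightarrow> real"
        by (rule sum.reindex_bij_witness[of _ "\<lambda>i. i - l * t" "\<lambda>i. l * t + i"]) auto
      show ?thesis
        by (simp only: shift[where F = "\<lambda>i. c' i * indicator (A' i) z"] sum.nat_group)
    qed
    finally show ?thesis .
  qed
  moreover have "A' i \<in> cells UNIV (t - 1)" if "i < k * t" for i
    using cA(1) idx[OF that] by (simp add: A'_def)
  ultimately show ?thesis unfolding step_functions_def
    by (intro CollectI exI[of _ c'] exI[of _ A'] conjI allI impI ext) simp_all
qed

section \<open>Symmetrisation with a quadratic offset\<close>

lemma exp_plus_exp_minus_le:
  fixes z :: real
  shows "exp z + exp (- z) \<le> 2 * exp (z\<^sup>2 / 2)"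
proof -
  have pos: "exp \<bar>z\<bar> + exp (- \<bar>z\<bar>) \<le> 2 * exp (z\<^sup>2 / 2)"
  proof -
    have "0 < 1 + (1 / 2) * (u - 1)" if "u > 0" for u :: real
      using that by (simp add: field_simps)
    from this[OF exp_gt_zero] have p: "0 < 1 + (1 / 2) * (exp (2 * \<bar>z\<bar>) - 1)" .
    \<comment> \<open>Hoeffding's lemma for a fair coin on an interval of length
      \<open>2 * \<bar>z\<bar>\<close>; its \<open>(2 z)^2 / 8\<close> is the exponent
      \<open>z^2 / 2\<close>.\<close>
    have "- (2 * \<bar>z\<bar>) * (1 / 2) + ln (1 + (1 / 2) * (exp (2 * \<bar>z\<bar>) - 1)) \<le> (2 * \<bar>z\<bar>)\<^sup>2 / 8"
      by (rule Hoeffdings_lemma_aux) auto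
    then have "ln (1 + (1 / 2) * (exp (2 * \<bar>z\<bar>) - 1)) \<le> z\<^sup>2 / 2 + \<bar>z\<bar>"
      by (simp add: power_mult_distrib)
    then have "1 + (1 / 2) * (exp (2 * \<bar>z\<bar>) - 1) \<le> exp (z\<^sup>2 / 2 + \<bar>z\<bar>)"
      using p by (metis exp_le_cancel_iff exp_ln)
    moreover have "1 + u \<le> 2 * w" if "1 + (1 / 2) * (u - 1) \<le> w" for u w :: real
      using that by (simp add: field_simps)
    ultimately have "1 + exp (2 * \<bar>z\<bar>) \<le> 2 * exp (z\<^sup>2 / 2) * exp \<bar>z\<bar>"
      by (simp only: exp_add mult.assoc)
    then have "exp (- \<bar>z\<bar>) * (1 + exp (2 * \<bar>z\<bar>)) \<le> exp (- \<bar>z\<bar>) * (2 * exp (z\<^sup>2 / 2) * exp \<bar>z\<bar>)"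
      by (intro mult_left_mono) auto
    also have "\<dots> = 2 * exp (z\<^sup>2 / 2)" by (simp add: exp_minus)
    also have "exp (- \<bar>z\<bar>) * (1 + exp (2 * \<bar>z\<bar>)) = exp \<bar>z\<bar> + exp (- \<bar>z\<bar>)"
      by (simp add: distrib_left mult_exp_exp)
    finally show ?thesis .
  qed
  then show ?thesis by (cases "z \<ge> 0") (simp_all add: add.commute)
qed

text \<open>
  The offset \<open>d\<close> dominates the Gaussian bound for the moment generating function of the signed
  sum, so each vector has exponential moment at most 1. Sets \<open>J\<close> play the role of sign vectors.
\<close>

lemma offset_rademacher_Max:
  fixes s d :: "'v \<Rightarrow> nat \<Rightarrow> real"
  assumes V: "finite V" "V \<noteq> {}" and l: "l > 0"
    and off: "\<And>v i. v \<in> V \<Longrightarrow> i < n \<Longrightarrow> l * (s v i)\<^sup>2 / 2 \<le> d v i"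
  shows "(\<Sum>J\<in>Pow {..<n}. Max ((\<lambda>v. \<Sum>i<n. (if i \<in> J then s v i else - s v i) - d v i) ` V))
    \<le> 2 ^ n * (ln (card V) / l)"
proof -
  define G where "G = (\<lambda>J v. \<Sum>i<n. (if i \<in> J then s v i else - s v i) - d v i)"
  define K where "K = real (card V)"
  have K: "K > 0" using V by (simp add: K_def card_gt_0_iff)
  have mgf: "(\<Sum>J\<in>Pow {..<n}. exp (l * G J v)) \<le> 2 ^ n" if v: "v \<in> V" for v
  proof -
    have "exp (l * G J v) = (\<Prod>i\<in>J. exp (l * (s v i - d v i))) * (\<Prod>i\<in>{..<n} - J. exp (l * (- s v i - d v i)))"
      if "J \<in> Pow {..<n}" for J
    proof -
      have J: "finite J" "{..<n} = J \<union> ({..<n} - J)" using that finite_subset by auto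
      have "G J v = (\<Sum>i\<in>J. s v i - d v i) + (\<Sum>i\<in>{..<n} - J. - s v i - d v i)"
        unfolding G_def
        by (subst J(2), subst sum.union_disjoint) (use J(1) in \<open>auto intro!: arg_cong2[where f = "(+)"] sum.cong\<close>)
      then show ?thesis using J(1) by (simp add: distrib_left exp_add sum_distrib_left exp_sum)
    qed
    \<comment> \<open>Expanding a product of two-term sums over \<open>i\<close> runs through all
      sign choices, so the sum over \<open>J\<close> factorises. This is independence of the
      signs.\<close>
    then have "(\<Sum>J\<in>Pow {..<n}. exp (l * G J v))
        = (\<Prod>i<n. exp (l * (s v i - d v i)) + exp (l * (- s v i - d v i)))"
      by (subst prod_add) simp_all
    also have "\<dots> \<le> (\<Prod>i<n. 2)"
    proof (intro prod_mono conjI)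
      fix i assume i: "i \<in> {..<n}"
      have "exp (l * (s v i - d v i)) + exp (l * (- s v i - d v i))
          = exp (- l * d v i) * (exp (l * s v i) + exp (- (l * s v i)))"
        by (simp add: distrib_left right_diff_distrib exp_diff exp_minus field_simps)
      also have "\<dots> \<le> exp (- l * d v i) * (2 * exp ((l * s v i)\<^sup>2 / 2))"
        by (intro mult_left_mono exp_plus_exp_minus_le) simp
      also have "\<dots> = 2 * exp (l * (l * (s v i)\<^sup>2 / 2 - d v i))"
        by (simp add: mult_exp_exp power_mult_distrib power2_eq_square algebra_simps)
      also have "\<dots> \<le> 2"
        using off[OF v, of i] i l by (simp add: mult_nonneg_nonpos)
      finally show "exp (l * (s v i - d v i)) + exp (l * (- s v i - d v i)) \<le> 2" .
    qed (simp add: add_nonneg_nonneg)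
    finally show ?thesis by simp
  qed
  \<comment> \<open>The bound \<open>1 + u \<le> exp u\<close> at
    \<open>u = l * G J v - ln K\<close> takes the place of Jensen's inequality for the logarithm;
    the maximum is then bounded by the sum over \<open>V\<close>.\<close>
  have one: "l * Max (G J ` V) \<le> ln K + ((\<Sum>v\<in>V. exp (l * G J v)) / K - 1)" for J
  proof -
    have "Max (G J ` V) \<in> G J ` V" using V by (intro Max_in) auto
    then obtain v where v: "v \<in> V" "Max (G J ` V) = G J v" by auto
    have "1 + (l * G J v - ln K) \<le> exp (l * G J v - ln K)" by (rule exp_ge_add_one_self)
    also have "\<dots> = exp (l * G J v) / K" using K by (simp add: exp_diff)
    also have "\<dots> \<le> (\<Sum>v\<in>V. exp (l * G J v)) / K"
      using K V v by (intro divide_right_mono member_le_sum) auto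
    finally show ?thesis unfolding v(2) by linarith
  qed
  have "l * (\<Sum>J\<in>Pow {..<n}. Max (G J ` V))
      \<le> (\<Sum>J\<in>Pow {..<n}. ln K + ((\<Sum>v\<in>V. exp (l * G J v)) / K - 1))"
    unfolding sum_distrib_left by (intro sum_mono one)
  also have "\<dots> = 2 ^ n * ln K + ((\<Sum>v\<in>V. \<Sum>J\<in>Pow {..<n}. exp (l * G J v)) / K - 2 ^ n)"
    by (subst sum.swap) (simp add: sum.distrib sum_subtractf sum_divide_distrib[symmetric] card_Pow)
  also have "(\<Sum>v\<in>V. \<Sum>J\<in>Pow {..<n}. exp (l * G J v)) \<le> (\<Sum>v\<in>V. 2 ^ n)"
    by (intro sum_mono mgf)
  then have "(\<Sum>v\<in>V. \<Sum>J\<in>Pow {..<n}. exp (l * G J v)) / K \<le> 2 ^ n"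
    using K by (simp add: K_def divide_le_eq mult.commute)
  finally have "l * (\<Sum>J\<in>Pow {..<n}. Max (G J ` V)) \<le> 2 ^ n * ln K" by simp
  then show ?thesis using l by (simp add: G_def K_def field_simps)
qed

text \<open>\<open>w\<close> holds the sample at indices below \<open>n\<close> and the ghost sample
  at \<open>n + i\<close>. The offset is subtracted on both halves, so exchanging the two members of
  a pair only flips the sign of the \<open>\<psi>\<close> part.\<close>

definition ghost_gap :: "nat \<Rightarrow> ('e \<Rightarrow> real) \<Rightarrow> ('e \<Rightarrow> real) \<Rightarrow> (nat \<Rightarrow> 'e) \<Rightarrow> real" where
  "ghost_gap n \<psi> q w = (\<Sum>i<n. \<psi> (w (n + i)) - \<psi> (w i) - q (w (n + i)) - q (w i))"

lemma ghost_gap_close: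
  assumes "\<And>z. z \<in> w ` {..<2 * n} \<Longrightarrow> \<bar>\<psi> z - \<psi>' z\<bar> \<le> e \<and> \<bar>q z - q' z\<bar> \<le> e"
  shows "ghost_gap n \<psi> q w \<le> ghost_gap n \<psi>' q' w + 4 * real n * e"
proof -
  have "ghost_gap n \<psi> q w \<le> (\<Sum>i<n. (\<psi>' (w (n + i)) - \<psi>' (w i) - q' (w (n + i)) - q' (w i)) + 4 * e)"
    unfolding ghost_gap_def
  proof (rule sum_mono)
    fix i assume "i \<in> {..<n}"
    then show "\<psi> (w (n + i)) - \<psi> (w i) - q (w (n + i)) - q (w i)
        \<le> (\<psi>' (w (n + i)) - \<psi>' (w i) - q' (w (n + i)) - q' (w i)) + 4 * e"
      using assms[of "w i"] assms[of "w (n + i)"] by (auto simp: abs_le_iff)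
  qed
  then show ?thesis by (simp add: ghost_gap_def sum.distrib)
qed

lemma ghost_gap_abs_le:
  assumes "\<And>z. \<bar>\<psi> z\<bar> \<le> b \<and> \<bar>q z\<bar> \<le> b"
  shows "\<bar>ghost_gap n \<psi> q w\<bar> \<le> 4 * real n * b"
proof -
  have "\<bar>ghost_gap n \<psi> q w\<bar> \<le> (\<Sum>i<n. 4 * b)"
    unfolding ghost_gap_def
  proof (intro order_trans[OF sum_abs] sum_mono)
    fix i
    show "\<bar>\<psi> (w (n + i)) - \<psi> (w i) - q (w (n + i)) - q (w i)\<bar> \<le> 4 * b"
      using assms[of "w i"] assms[of "w (n + i)"] by (auto simp: abs_le_iff)
  qed
  then show ?thesis by simp
qed

text \<open>An involution of \<open>{..<2 * n}\<close>: \<open>J\<close> lists the pairs left alone,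
  the others exchange sample and ghost point.\<close>

definition swap_index :: "nat \<Rightarrow> nat set \<Rightarrow> nat \<Rightarrow> nat" where
  "swap_index n J i = (if i < n then (if i \<in> J then i else n + i) else (if i - n \<in> J then i else i - n))"

lemma ghost_gap_swap:
  "ghost_gap n \<psi> q (\<lambda>i\<in>{..<2 * n}. w (swap_index n J i)) =
    (\<Sum>i<n. (if i \<in> J then \<psi> (w (n + i)) - \<psi> (w i) else - (\<psi> (w (n + i)) - \<psi> (w i)))
      - (q (w (n + i)) + q (w i)))"
  unfolding ghost_gap_def by (intro sum.cong refl) (auto simp: swap_index_def)

text \<open>\<open>\<psi>\<close> carries the signed deviations, \<open>q\<close> is the offset that
  dominates their squares, and \<open>K\<close> is a covering number at resolution \<open>e\<close>,
  uniform over sets of at most \<open>2 * n\<close> points.\<close>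

locale countable_class = prob_space P for P :: "'e measure" +
  fixes I :: "'i set" and \<psi> q :: "'i \<Rightarrow> 'e \<Rightarrow> real" and b e l :: real and n K :: nat
  assumes I: "countable I" "I \<noteq> {}"
    and meas [measurable]: "\<And>i. i \<in> I \<Longrightarrow> \<psi> i \<in> borel_measurable P" "\<And>i. i \<in> I \<Longrightarrow> q i \<in> borel_measurable P"
    and bound: "\<And>i z. \<bar>\<psi> i z\<bar> \<le> b \<and> \<bar>q i z\<bar> \<le> b"
    and l: "l > 0"
    and offset: "\<And>i z. l * (\<psi> i z)\<^sup>2 \<le> q i z"
    and cover: "\<And>Q. finite Q \<Longrightarrow> card Q \<le> 2 * n \<Longrightarrow> \<exists>J\<subseteq>I. finite J \<and> card J \<le> K \<and>
      (\<forall>i\<in>I. \<exists>j\<in>J. \<forall>z\<in>Q. \<bar>\<psi> i z - \<psi> j z\<bar> \<le> e \<and> \<bar>q i z - q j z\<bar> \<le> e)"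
begin

definition gap :: "(nat \<Rightarrow> 'e) \<Rightarrow> real" where
  "gap w = (SUP i\<in>I. ghost_gap n (\<psi> i) (q i) w)"

lemma bdd_gap: "bdd_above ((\<lambda>i. ghost_gap n (\<psi> i) (q i) w) ` I)"
  using ghost_gap_abs_le[of "\<psi> _" b "q _" n w] bound
  by (intro bdd_aboveI2[of _ _ "4 * real n * b"]) (simp add: abs_le_iff)

lemma ghost_gap_le_gap: "i \<in> I \<Longrightarrow> ghost_gap n (\<psi> i) (q i) w \<le> gap w"
  unfolding gap_def by (rule cSUP_upper[OF _ bdd_gap])

lemma abs_gap_le: "\<bar>gap w\<bar> \<le> 4 * real n * b"
proof -
  obtain i where i: "i \<in> I" using I by blast
  have "gap w \<le> 4 * real n * b"
    unfolding gap_def using ghost_gap_abs_le[of "\<psi> _" b "q _" n w] bound I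
    by (intro cSUP_least) (auto simp: abs_le_iff)
  moreover have "- (4 * real n * b) \<le> gap w"
    using ghost_gap_le_gap[OF i, of w] ghost_gap_abs_le[of "\<psi> i" b "q i" n w] bound
    by (auto simp: abs_le_iff)
  ultimately show ?thesis by (simp add: abs_le_iff)
qed

lemma measurable_gap [measurable]: "gap \<in> borel_measurable (Pi\<^sub>M {..<2 * n} (\<lambda>_. P))"
  unfolding gap_def
proof (rule borel_measurable_cSUP[OF I(1) _ bdd_gap])
  fix i assume i: "i \<in> I"
  show "ghost_gap n (\<psi> i) (q i) \<in> borel_measurable (Pi\<^sub>M {..<2 * n} (\<lambda>_. P))"
    unfolding ghost_gap_def
  proof (rule borel_measurable_sum)
    fix j assume "j \<in> {..<n}"
    then have [measurable]: "(\<lambda>w. w j) \<in> measurable (Pi\<^sub>M {..<2 * n} (\<lambda>_. P)) P"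
      "(\<lambda>w. w (n + j)) \<in> measurable (Pi\<^sub>M {..<2 * n} (\<lambda>_. P)) P"
      by (auto intro!: measurable_component_singleton)
    show "(\<lambda>w. \<psi> i (w (n + j)) - \<psi> i (w j) - q i (w (n + j)) - q i (w j))
        \<in> borel_measurable (Pi\<^sub>M {..<2 * n} (\<lambda>_. P))"
      using i by measurable
  qed
qed

text \<open>With the points fixed this is a Rademacher average, written as a sum over all
  \<open>J\<close>. Passing to a finite cover costs \<open>4 n e\<close>; the bound for finite
  maxima does the rest.\<close>

lemma sum_gap_swap_le:
  "(\<Sum>J\<in>Pow {..<n}. gap (\<lambda>i\<in>{..<2 * n}. w (swap_index n J i)))
    \<le> 2 ^ n * (ln (real K) / l + 4 * real n * e)"
proof -
  define Q where "Q = w ` {..<2 * n}"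
  have Q: "finite Q" "card Q \<le> 2 * n"
    unfolding Q_def using card_image_le[of "{..<2 * n}" w] by auto
  obtain V where V: "V \<subseteq> I" "finite V" "card V \<le> K"
    and close: "\<And>i. i \<in> I \<Longrightarrow> \<exists>j\<in>V. \<forall>z\<in>Q. \<bar>\<psi> i z - \<psi> j z\<bar> \<le> e \<and> \<bar>q i z - q j z\<bar> \<le> e"
    using cover[OF Q] by blast
  have "V \<noteq> {}" using I close by blast
  have sw: "swap_index n J i < 2 * n" if "i < 2 * n" for i J
    using that by (auto simp: swap_index_def)
  define s where "s = (\<lambda>v i. \<psi> v (w (n + i)) - \<psi> v (w i))"
  define d where "d = (\<lambda>v i. q v (w (n + i)) + q v (w i))"
  define G where "G = (\<lambda>J v. \<Sum>i<n. (if i \<in> J then s v i else - s v i) - d v i)"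
  have gap_le: "gap (\<lambda>i\<in>{..<2 * n}. w (swap_index n J i)) \<le> Max (G J ` V) + 4 * real n * e" for J
    unfolding gap_def
  proof (rule cSUP_least[OF I(2)])
    fix i assume "i \<in> I"
    then obtain j where j: "j \<in> V" "\<And>z. z \<in> Q \<Longrightarrow> \<bar>\<psi> i z - \<psi> j z\<bar> \<le> e \<and> \<bar>q i z - q j z\<bar> \<le> e"
      using close by blast
    have "ghost_gap n (\<psi> i) (q i) (\<lambda>i\<in>{..<2 * n}. w (swap_index n J i))
        \<le> ghost_gap n (\<psi> j) (q j) (\<lambda>i\<in>{..<2 * n}. w (swap_index n J i)) + 4 * real n * e"
      by (rule ghost_gap_close) (use j(2) sw in \<open>auto simp: Q_def\<close>)
    moreover have "ghost_gap n (\<psi> j) (q j) (\<lambda>i\<in>{..<2 * n}. w (swap_index n J i)) = G J j"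
      unfolding ghost_gap_swap G_def s_def d_def ..
    moreover have "G J j \<le> Max (G J ` V)" using V j(1) by (intro Max_ge) auto
    ultimately show "ghost_gap n (\<psi> i) (q i) (\<lambda>i\<in>{..<2 * n}. w (swap_index n J i))
        \<le> Max (G J ` V) + 4 * real n * e" by linarith
  qed
  have "(\<Sum>J\<in>Pow {..<n}. Max (G J ` V)) \<le> 2 ^ n * (ln (card V) / l)"
    unfolding G_def
  proof (rule offset_rademacher_Max[OF V(2) \<open>V \<noteq> {}\<close> l])
    fix v i
    define \<alpha> \<gamma> where "\<alpha> = \<psi> v (w (n + i))" and "\<gamma> = \<psi> v (w i)"
    \<comment> \<open>The offsets at both points of a pair are available, which matches the factor
      1/2 in the Gaussian bound.\<close>
    have "(\<alpha> - \<gamma>)\<^sup>2 \<le> 2 * (\<alpha>\<^sup>2 + \<gamma>\<^sup>2)"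
      using zero_le_power2[of "\<alpha> + \<gamma>"] by (simp add: power2_eq_square algebra_simps)
    then have "l * (\<alpha> - \<gamma>)\<^sup>2 / 2 \<le> l * \<alpha>\<^sup>2 + l * \<gamma>\<^sup>2"
      using mult_left_mono[of "(\<alpha> - \<gamma>)\<^sup>2" "2 * (\<alpha>\<^sup>2 + \<gamma>\<^sup>2)" l] l by (simp add: algebra_simps)
    then show "l * (s v i)\<^sup>2 / 2 \<le> d v i"
      using offset[of v "w (n + i)"] offset[of v "w i"] by (simp add: s_def d_def \<alpha>_def \<gamma>_def)
  qed
  also have "\<dots> \<le> 2 ^ n * (ln (real K) / l)"
    using V \<open>V \<noteq> {}\<close> l by (intro mult_left_mono divide_right_mono ln_mono) (auto simp: card_gt_0_iff)
  finally have M: "(\<Sum>J\<in>Pow {..<n}. Max (G J ` V)) \<le> 2 ^ n * (ln (real K) / l)" .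
  have "(\<Sum>J\<in>Pow {..<n}. gap (\<lambda>i\<in>{..<2 * n}. w (swap_index n J i)))
      \<le> (\<Sum>J\<in>Pow {..<n}. Max (G J ` V) + 4 * real n * e)" by (intro sum_mono gap_le)
  also have "\<dots> = (\<Sum>J\<in>Pow {..<n}. Max (G J ` V)) + 2 ^ n * (4 * real n * e)"
    by (simp add: sum.distrib card_Pow)
  finally show ?thesis using M by (simp add: distrib_left)
qed

text \<open>The product law is invariant under each exchange of pairs, so the integral equals its
  average over all \<open>J\<close>.\<close>

lemma integral_gap_le:
  "(\<integral>w. gap w \<partial>Pi\<^sub>M {..<2 * n} (\<lambda>_. P)) \<le> ln (real K) / l + 4 * real n * e"
proof -
  let ?N = "Pi\<^sub>M {..<2 * n} (\<lambda>_. P)"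
  interpret N: prob_space ?N by (intro prob_space_PiM prob_space_axioms)
  define T where "T = (\<lambda>J w. \<lambda>i\<in>{..<2 * n}. w (swap_index n J i) :: 'e)"
  have T: "distr ?N ?N (T J) = ?N" for J
    unfolding T_def
  proof (rule distr_PiM_reindex[of "{..<2 * n}" "\<lambda>_. P" "swap_index n J" "{..<2 * n}"])
    show "inj_on (swap_index n J) {..<2 * n}"
      by (auto simp: inj_on_def swap_index_def split: if_splits)
    show "swap_index n J \<in> {..<2 * n} \<rightarrow> {..<2 * n}" by (auto simp: swap_index_def)
  qed (rule prob_space_axioms)
  have [measurable]: "T J \<in> measurable ?N ?N" for J
    unfolding T_def
    by (intro measurable_restrict measurable_component_singleton) (auto simp: swap_index_def)
  have inv: "(\<integral>w. gap (T J w) \<partial>?N) = (\<integral>w. gap w \<partial>?N)" for J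
  proof -
    have "(\<integral>w. gap w \<partial>?N) = (\<integral>w. gap w \<partial>distr ?N ?N (T J))" by (simp only: T)
    also have "\<dots> = (\<integral>w. gap (T J w) \<partial>?N)" by (rule integral_distr) measurable
    finally show ?thesis ..
  qed
  have int: "integrable ?N (\<lambda>w. gap (T J w))" for J
    by (rule N.integrable_const_bound[where B = "4 * real n * b"]) (auto simp: abs_gap_le)
  have "2 ^ n * (\<integral>w. gap w \<partial>?N) = (\<Sum>J\<in>Pow {..<n}. \<integral>w. gap (T J w) \<partial>?N)"
    by (simp add: inv card_Pow)
  also have "\<dots> = (\<integral>w. (\<Sum>J\<in>Pow {..<n}. gap (T J w)) \<partial>?N)"
    by (rule Bochner_Integration.integral_sum[symmetric]) (rule int)
  also have "\<dots> \<le> (\<integral>w. 2 ^ n * (ln (real K) / l + 4 * real n * e) \<partial>?N)"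
  proof (rule integral_mono)
    show "integrable ?N (\<lambda>w. \<Sum>J\<in>Pow {..<n}. gap (T J w))"
      by (rule Bochner_Integration.integrable_sum) (rule int)
    show "(\<Sum>J\<in>Pow {..<n}. gap (T J w)) \<le> 2 ^ n * (ln (real K) / l + 4 * real n * e)" for w
      unfolding T_def by (rule sum_gap_swap_le)
  qed simp
  also have "\<dots> = 2 ^ n * (ln (real K) / l + 4 * real n * e)" by (simp add: N.prob_space)
  finally show ?thesis by simp
qed

text \<open>
  Symmetrisation in expectation for a data-dependent function: only the supremum over the countable
  class has to be measurable.
\<close>

lemma symmetrization:
  fixes M :: "'w measure" and D :: "nat \<Rightarrow> 'w \<Rightarrow> 'e" and f g :: "'w \<Rightarrow> 'e \<Rightarrow> real"
  assumes M: "prob_space M"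
    and D: "\<And>i. i < n \<Longrightarrow> D i \<in> measurable M P"
    and iid: "distr M (Pi\<^sub>M {..<n} (\<lambda>_. P)) (\<lambda>\<omega>. \<lambda>i\<in>{..<n}. D i \<omega>) = Pi\<^sub>M {..<n} (\<lambda>_. P)"
    and f: "(\<lambda>(\<omega>, z). f \<omega> z) \<in> borel_measurable (M \<Otimes>\<^sub>M P)"
    and g: "(\<lambda>(\<omega>, z). g \<omega> z) \<in> borel_measurable (M \<Otimes>\<^sub>M P)"
    and fg: "\<And>\<omega> z. \<bar>f \<omega> z\<bar> \<le> b \<and> \<bar>g \<omega> z\<bar> \<le> b"
    and approx: "AE \<omega> in M. \<forall>Q. finite Q \<longrightarrow>
      (\<exists>i\<in>I. \<forall>z\<in>Q. \<bar>f \<omega> z - \<psi> i z\<bar> \<le> e \<and> \<bar>g \<omega> z - q i z\<bar> \<le> e)"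
  shows "(\<integral>\<omega>. real n * (\<integral>z. f \<omega> z - g \<omega> z \<partial>P) - (\<Sum>i<n. f \<omega> (D i \<omega>) + g \<omega> (D i \<omega>)) \<partial>M)
    \<le> ln (real K) / l + 8 * real n * e"
proof -
  let ?A = "{..<n}" and ?B = "{n..<2 * n}"
  let ?N = "Pi\<^sub>M {..<2 * n} (\<lambda>_. P)" and ?G = "Pi\<^sub>M ?B (\<lambda>_. P)"
  interpret M: prob_space M by (rule M)
  interpret N: prob_space ?N by (intro prob_space_PiM prob_space_axioms)
  interpret G: prob_space ?G by (intro prob_space_PiM prob_space_axioms)
  interpret MG: pair_prob_space M ?G ..
  interpret PP: product_sigma_finite "\<lambda>_ :: nat. P"
    by (rule product_sigma_finite.intro) unfold_locales
  have AB: "?A \<inter> ?B = {}" "?A \<union> ?B = {..<2 * n}" by auto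
  note [measurable] = f g
  have D' [measurable]: "(\<lambda>\<omega>. \<lambda>i\<in>?A. D i \<omega>) \<in> measurable M (Pi\<^sub>M ?A (\<lambda>_. P))"
    by (intro measurable_restrict D) simp
  \<comment> \<open>Appends an independent ghost sample to the sample of \<open>\<omega>\<close>.
    Only the joint law of these \<open>2 * n\<close> points has to be a product;
    \<open>\<omega>\<close> may carry seeds as well.\<close>
  define T where "T = (\<lambda>(\<omega>, w). merge ?A ?B (\<lambda>i\<in>?A. D i \<omega>, w))"
  have merge [measurable]: "merge ?A ?B \<in> measurable (Pi\<^sub>M ?A (\<lambda>_. P) \<Otimes>\<^sub>M ?G) ?N"
    using measurable_merge[of ?A ?B "\<lambda>_. P"] by (simp only: AB(2))
  have T [measurable]: "T \<in> measurable (M \<Otimes>\<^sub>M ?G) ?N" unfolding T_def by measurable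
  have law: "distr (M \<Otimes>\<^sub>M ?G) ?N T = ?N"
  proof -
    have "?N = distr (Pi\<^sub>M ?A (\<lambda>_. P) \<Otimes>\<^sub>M ?G) ?N (merge ?A ?B)"
      using PP.distr_merge[of ?A ?B] AB by simp
    also have "Pi\<^sub>M ?A (\<lambda>_. P) \<Otimes>\<^sub>M ?G
        = distr M (Pi\<^sub>M ?A (\<lambda>_. P)) (\<lambda>\<omega>. \<lambda>i\<in>?A. D i \<omega>) \<Otimes>\<^sub>M distr ?G ?G (\<lambda>w. w)"
      by (simp add: iid distr_id2)
    also have "\<dots> = distr (M \<Otimes>\<^sub>M ?G) (Pi\<^sub>M ?A (\<lambda>_. P) \<Otimes>\<^sub>M ?G) (\<lambda>(\<omega>, w). (\<lambda>i\<in>?A. D i \<omega>, w))"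
      by (rule pair_measure_distr[OF D']) (simp_all add: distr_id2 G.sigma_finite_measure_axioms)
    also have "distr \<dots> ?N (merge ?A ?B) = distr (M \<Otimes>\<^sub>M ?G) ?N T"
      by (subst distr_distr) (auto simp: T_def comp_def case_prod_beta intro!: distr_cong)
    finally show ?thesis ..
  qed
  have T1: "T (\<omega>, w) i = D i \<omega>" and T2: "T (\<omega>, w) (n + i) = w (n + i)" if "i < n" for \<omega> w i
    using that by (auto simp: T_def merge_def)
  have intT: "integrable (M \<Otimes>\<^sub>M ?G) (\<lambda>x. gap (T x))"
    by (rule MG.integrable_const_bound[where B = "4 * real n * b"]) (auto simp: abs_gap_le)
  define F where "F = (\<lambda>\<omega> w. ghost_gap n (f \<omega>) (g \<omega>) (T (\<omega>, w)))"
  have F_eq: "F \<omega> w = (\<Sum>i<n. f \<omega> (w (n + i)) - f \<omega> (D i \<omega>) - g \<omega> (w (n + i)) - g \<omega> (D i \<omega>))" for \<omega> w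
    unfolding F_def ghost_gap_def by (intro sum.cong refl) (simp add: T1 T2)
  have mF: "(\<lambda>(\<omega>, w). F \<omega> w) \<in> borel_measurable (M \<Otimes>\<^sub>M ?G)"
    unfolding F_eq case_prod_beta
  proof (rule borel_measurable_sum)
    fix i assume i: "i \<in> ?A"
    have Di [measurable]: "D i \<in> measurable M P" using D i by simp
    have wi [measurable]: "(\<lambda>w. w (n + i)) \<in> measurable ?G P"
      using i by (intro measurable_component_singleton) simp
    have "(\<lambda>x. (\<lambda>(\<omega>, z). f \<omega> z) (fst x, snd x (n + i))) \<in> borel_measurable (M \<Otimes>\<^sub>M ?G)"
      "(\<lambda>x. (\<lambda>(\<omega>, z). g \<omega> z) (fst x, snd x (n + i))) \<in> borel_measurable (M \<Otimes>\<^sub>M ?G)"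
      "(\<lambda>x. (\<lambda>(\<omega>, z). f \<omega> z) (fst x, D i (fst x))) \<in> borel_measurable (M \<Otimes>\<^sub>M ?G)"
      "(\<lambda>x. (\<lambda>(\<omega>, z). g \<omega> z) (fst x, D i (fst x))) \<in> borel_measurable (M \<Otimes>\<^sub>M ?G)"
      by measurable
    then show "(\<lambda>x. f (fst x) (snd x (n + i)) - f (fst x) (D i (fst x)) - g (fst x) (snd x (n + i))
        - g (fst x) (D i (fst x))) \<in> borel_measurable (M \<Otimes>\<^sub>M ?G)"
      unfolding prod.case by (intro borel_measurable_diff)
  qed
  have Fb: "\<bar>F \<omega> w\<bar> \<le> 4 * real n * b" for \<omega> w
    unfolding F_def by (rule ghost_gap_abs_le) (rule fg)
  have intF: "integrable (M \<Otimes>\<^sub>M ?G) (\<lambda>(\<omega>, w). F \<omega> w)"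
    by (rule MG.integrable_const_bound[where B = "4 * real n * b"]) (use Fb mF in auto)
  \<comment> \<open>For fixed \<open>\<omega>\<close> the selected functions do not depend on the
    ghost sample, so integrating it out produces population means.\<close>
  have inner: "(\<integral>w. F \<omega> w \<partial>?G) = real n * (\<integral>z. f \<omega> z - g \<omega> z \<partial>P) - (\<Sum>i<n. f \<omega> (D i \<omega>) + g \<omega> (D i \<omega>))"
    if \<omega>: "\<omega> \<in> space M" for \<omega>
  proof -
    have fm [measurable]: "f \<omega> \<in> borel_measurable P" "g \<omega> \<in> borel_measurable P"
      using measurable_Pair2[OF f \<omega>] measurable_Pair2[OF g \<omega>] by simp_all
    have comp: "(\<integral>w. f \<omega> (w (n + i)) - g \<omega> (w (n + i)) \<partial>?G) = (\<integral>z. f \<omega> z - g \<omega> z \<partial>P)"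
      and int: "integrable ?G (\<lambda>w. f \<omega> (w (n + i)) - g \<omega> (w (n + i)))" if i: "i < n" for i
    proof -
      have wi [measurable]: "(\<lambda>w. w (n + i)) \<in> measurable ?G P"
        using i by (intro measurable_component_singleton) simp
      have "distr ?G P (\<lambda>w. w (n + i)) = P"
        by (rule distr_PiM_component[of ?B "\<lambda>_. P"]) (use i prob_space_axioms in auto)
      then have "(\<integral>z. f \<omega> z - g \<omega> z \<partial>P) = (\<integral>z. f \<omega> z - g \<omega> z \<partial>distr ?G P (\<lambda>w. w (n + i)))"
        by simp
      also have "\<dots> = (\<integral>w. f \<omega> (w (n + i)) - g \<omega> (w (n + i)) \<partial>?G)"
        by (rule integral_distr[OF wi]) measurable
      finally show "(\<integral>w. f \<omega> (w (n + i)) - g \<omega> (w (n + i)) \<partial>?G) = (\<integral>z. f \<omega> z - g \<omega> z \<partial>P)" ..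
      show "integrable ?G (\<lambda>w. f \<omega> (w (n + i)) - g \<omega> (w (n + i)))"
      proof (rule G.integrable_const_bound[where B = "2 * b"])
        show "AE w in ?G. norm (f \<omega> (w (n + i)) - g \<omega> (w (n + i))) \<le> 2 * b"
          using fg[of \<omega>] by (auto intro!: AE_I2 simp: abs_le_iff) (smt (verit))+
        show "(\<lambda>w. f \<omega> (w (n + i)) - g \<omega> (w (n + i))) \<in> borel_measurable ?G"
          by measurable
      qed
    qed
    have "F \<omega> w = (\<Sum>i<n. f \<omega> (w (n + i)) - g \<omega> (w (n + i))) - (\<Sum>i<n. f \<omega> (D i \<omega>) + g \<omega> (D i \<omega>))" for w
      unfolding F_eq sum_subtractf[symmetric] by (intro sum.cong refl) simp
    moreover have "integrable ?G (\<lambda>w. \<Sum>i<n. f \<omega> (w (n + i)) - g \<omega> (w (n + i)))"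
      by (rule Bochner_Integration.integrable_sum) (rule int, simp)
    ultimately have "(\<integral>w. F \<omega> w \<partial>?G) = (\<integral>w. (\<Sum>i<n. f \<omega> (w (n + i)) - g \<omega> (w (n + i))) \<partial>?G)
        - (\<Sum>i<n. f \<omega> (D i \<omega>) + g \<omega> (D i \<omega>))"
      by (simp only: Bochner_Integration.integral_diff[OF _ G.integrable_const]) (simp add: G.prob_space)
    also have "(\<integral>w. (\<Sum>i<n. f \<omega> (w (n + i)) - g \<omega> (w (n + i))) \<partial>?G)
        = (\<Sum>i<n. \<integral>w. f \<omega> (w (n + i)) - g \<omega> (w (n + i)) \<partial>?G)"
      by (rule Bochner_Integration.integral_sum) (use int in simp)
    also have "\<dots> = (\<Sum>i<n. \<integral>z. f \<omega> z - g \<omega> z \<partial>P)" by (intro sum.cong refl comp) simp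
    finally show ?thesis by simp
  qed
  have "(\<integral>\<omega>. real n * (\<integral>z. f \<omega> z - g \<omega> z \<partial>P) - (\<Sum>i<n. f \<omega> (D i \<omega>) + g \<omega> (D i \<omega>)) \<partial>M)
      = (\<integral>\<omega>. (\<integral>w. F \<omega> w \<partial>?G) \<partial>M)"
    by (rule Bochner_Integration.integral_cong) (simp_all add: inner)
  also have "\<dots> = (\<integral>x. (case x of (\<omega>, w) \<Rightarrow> F \<omega> w) \<partial>(M \<Otimes>\<^sub>M ?G))"
    by (rule MG.integral_fst[OF intF])
  \<comment> \<open>The selected functions may lie outside the countable class and are replaced by
    members that are \<open>e\<close>-close on the points in question; together with the cover this
    gives \<open>8 n e\<close>.\<close>
  also have "\<dots> \<le> (\<integral>x. gap (T x) + 4 * real n * e \<partial>(M \<Otimes>\<^sub>M ?G))"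
  proof (rule integral_mono_AE[OF intF])
    show "integrable (M \<Otimes>\<^sub>M ?G) (\<lambda>x. gap (T x) + 4 * real n * e)" using intT by simp
    define R where "R = (\<lambda>\<omega>. \<forall>Q. finite Q \<longrightarrow>
      (\<exists>i\<in>I. \<forall>z\<in>Q. \<bar>f \<omega> z - \<psi> i z\<bar> \<le> e \<and> \<bar>g \<omega> z - q i z\<bar> \<le> e))"
    have "AE \<omega> in M. R \<omega>" using approx unfolding R_def .
    then have "AE \<omega> in distr (M \<Otimes>\<^sub>M ?G) M fst. R \<omega>"
      by (subst G.distr_pair_fst)
    then have "AE x in M \<Otimes>\<^sub>M ?G. R (fst x)" by (rule AE_distrD[OF measurable_fst])
    then show "AE x in M \<Otimes>\<^sub>M ?G. (case x of (\<omega>, w) \<Rightarrow> F \<omega> w) \<le> gap (T x) + 4 * real n * e"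
    proof (rule AE_mp, intro AE_I2 impI)
      fix x :: "'w \<times> (nat \<Rightarrow> 'e)" assume ap: "R (fst x)"
      obtain \<omega> w where x: "x = (\<omega>, w)" by (cases x)
      have "finite (T x ` {..<2 * n})" by simp
      then obtain i where i: "i \<in> I"
        "\<And>z. z \<in> T x ` {..<2 * n} \<Longrightarrow> \<bar>f \<omega> z - \<psi> i z\<bar> \<le> e \<and> \<bar>g \<omega> z - q i z\<bar> \<le> e"
        using ap unfolding x fst_conv R_def by blast
      have "F \<omega> w \<le> ghost_gap n (\<psi> i) (q i) (T x) + 4 * real n * e"
        unfolding F_def x[symmetric] by (rule ghost_gap_close[OF i(2)])
      also have "\<dots> \<le> gap (T x) + 4 * real n * e" using ghost_gap_le_gap[OF i(1)] by simp
      finally show "(case x of (\<omega>, w) \<Rightarrow> F \<omega> w) \<le> gap (T x) + 4 * real n * e" by (simp add: x)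
    qed
  qed
  also have "\<dots> = (\<integral>x. gap (T x) \<partial>(M \<Otimes>\<^sub>M ?G)) + 4 * real n * e"
    using intT by (simp add: MG.prob_space)
  also have "(\<integral>x. gap (T x) \<partial>(M \<Otimes>\<^sub>M ?G)) = (\<integral>w. gap w \<partial>distr (M \<Otimes>\<^sub>M ?G) ?N T)"
    by (rule integral_distr[symmetric]) measurable
  also have "\<dots> \<le> ln (real K) / l + 4 * real n * e" unfolding law by (rule integral_gap_le)
  finally show ?thesis by (simp add: ac_simps)
qed

end

section \<open>Generalisation error of truncated step functions\<close>

lemma regression_function_orthogonal:
  fixes X :: "'w \<Rightarrow> real ^ 'p"
  assumes "prob_space M" and X: "X \<in> borel_measurable M" and Y: "integrable M Y"
    and m: "is_regression_function M X Y m" and h: "AE \<omega> in M. h (X \<omega>) = m (X \<omega>)"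
    and hm: "h \<in> borel_measurable borel" and d: "d \<in> borel_measurable borel" and db: "\<And>z. \<bar>d z\<bar> \<le> b"
  shows "integrable M (\<lambda>\<omega>. d (X \<omega>) * Y \<omega>)" "integrable M (\<lambda>\<omega>. d (X \<omega>) * h (X \<omega>))"
    "(\<integral>\<omega>. d (X \<omega>) * (Y \<omega> - h (X \<omega>)) \<partial>M) = 0"
proof -
  interpret prob_space M by fact
  let ?F = "vimage_algebra (space M) X borel"
  have sub: "subalgebra M ?F"
    unfolding subalgebra_def
    using X by (auto simp: sets_vimage_algebra2 intro: measurable_sets)
  interpret finite_measure_subalgebra M ?F by unfold_locales (rule sub)
  note [measurable] = X d hm borel_measurable_integrable[OF Y]
  have XF: "X \<in> borel_measurable ?F" by (rule measurable_vimage_algebra1) (use X in auto)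
  have dF: "(\<lambda>\<omega>. d (X \<omega>)) \<in> borel_measurable ?F" using measurable_compose[OF XF d] .
  show int: "integrable M (\<lambda>\<omega>. d (X \<omega>) * Y \<omega>)"
  proof (rule Bochner_Integration.integrable_bound[of M "\<lambda>\<omega>. b * Y \<omega>"])
    show "AE \<omega> in M. norm (d (X \<omega>) * Y \<omega>) \<le> norm (b * Y \<omega>)"
      using db by (auto intro!: AE_I2 mult_right_mono simp: abs_mult intro: order_trans[OF _ abs_ge_self])
  qed (use Y in auto)
  have ce: "AE \<omega> in M. d (X \<omega>) * real_cond_exp M ?F Y \<omega> = d (X \<omega>) * h (X \<omega>)"
    using h m unfolding is_regression_function_def by auto
  have Ym: "Y \<in> borel_measurable M" by measurable
  note R = real_cond_exp_intg[OF int dF Ym]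
  show int': "integrable M (\<lambda>\<omega>. d (X \<omega>) * h (X \<omega>))"
    by (rule integrable_cong_AE_imp[OF R(1)]) (use ce in auto)
  have "(\<integral>\<omega>. d (X \<omega>) * h (X \<omega>) \<partial>M) = (\<integral>\<omega>. d (X \<omega>) * real_cond_exp M ?F Y \<omega> \<partial>M)"
  proof (rule integral_cong_AE)
    show "(\<lambda>\<omega>. d (X \<omega>) * real_cond_exp M ?F Y \<omega>) \<in> borel_measurable M"
      using R(1) by (rule borel_measurable_integrable)
  qed (use ce in auto)
  also have "\<dots> = (\<integral>\<omega>. d (X \<omega>) * Y \<omega> \<partial>M)" by (rule R(2))
  finally show "(\<integral>\<omega>. d (X \<omega>) * (Y \<omega> - h (X \<omega>)) \<partial>M) = 0"
    using int int' by (simp add: right_diff_distrib)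
qed

lemma abs_le_exp_square:
  fixes u c :: real
  assumes "c > 0"
  shows "\<bar>u\<bar> \<le> 1 + exp (c * u\<^sup>2) / c"
proof -
  have "\<bar>u\<bar> \<le> 1 + u\<^sup>2"
    using zero_le_power2[of "\<bar>u\<bar> - 1"] by (simp add: power2_eq_square algebra_simps abs_mult_self_eq)
  moreover have "c * u\<^sup>2 \<le> exp (c * u\<^sup>2)" using exp_ge_add_one_self[of "c * u\<^sup>2"] by linarith
  then have "u\<^sup>2 \<le> exp (c * u\<^sup>2) / c" using assms by (simp add: pos_le_divide_eq mult.commute)
  ultimately show ?thesis by linarith
qed

text \<open>Half of the exponent absorbs the factor \<open>u^2\<close>, the other half gives the
  decay in \<open>\<beta>\<close>.\<close>

lemma abs_minus_truncate_le:
  fixes u c :: real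
  assumes c: "c > 0" and b: "\<beta> \<ge> 1"
  shows "\<bar>u - truncate \<beta> u\<bar> \<le> 2 / c * exp (- c * \<beta>\<^sup>2 / 2) * exp (c * u\<^sup>2)"
proof (cases "\<bar>u\<bar> \<le> \<beta>")
  case True
  then show ?thesis using c by (simp add: truncate_id)
next
  case False
  then have u: "\<bar>u\<bar> > \<beta>" "\<bar>u\<bar> \<ge> 1" using b by auto
  have "\<bar>u - truncate \<beta> u\<bar> \<le> \<bar>u\<bar>" using u b by (auto simp: truncate_def)
  also have "\<dots> \<le> u\<^sup>2" using u self_le_power[of "\<bar>u\<bar>" 2] by simp
  also have "c * u\<^sup>2 / 2 \<le> exp (c * u\<^sup>2 / 2)" using exp_ge_add_one_self[of "c * u\<^sup>2 / 2"] by linarith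
  then have "u\<^sup>2 \<le> 2 / c * exp (c * u\<^sup>2 / 2)" using c by (simp add: field_simps)
  also have "\<dots> \<le> 2 / c * (exp (- c * \<beta>\<^sup>2 / 2) * exp (c * u\<^sup>2))"
  proof -
    have "\<beta>\<^sup>2 \<le> u\<^sup>2" using u b by (metis abs_le_square_iff abs_of_nonneg less_imp_le order_trans zero_le_one)
    then have "c * u\<^sup>2 / 2 \<le> - c * \<beta>\<^sup>2 / 2 + c * u\<^sup>2" using c by (simp add: field_simps)
    then show ?thesis using c by (intro mult_left_mono) (simp_all add: mult_exp_exp)
  qed
  finally show ?thesis by simp
qed

text \<open>
  With \<open>d\<close> the error of the truncated fit, the difference of the two functions is \<open>d\<^sup>2\<close> up to a
  multiple of the noise, whose mean vanishes, and their sum is twice the excess loss on the sample.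
\<close>

definition loss_term :: "real \<Rightarrow> (real ^ 'p \<Rightarrow> real) \<Rightarrow> (real ^ 'p \<Rightarrow> real) \<Rightarrow> (real ^ 'p) \<times> real \<Rightarrow> real" where
  "loss_term \<beta> h f w = (let d = truncate \<beta> (f (fst w)) - h (fst w) in
     3 / 2 * d\<^sup>2 - 4 * d * (truncate \<beta> (snd w) - h (fst w)))"

definition loss_offset :: "real \<Rightarrow> (real ^ 'p \<Rightarrow> real) \<Rightarrow> (real ^ 'p \<Rightarrow> real) \<Rightarrow> (real ^ 'p) \<times> real \<Rightarrow> real" where
  "loss_offset \<beta> h f w = (truncate \<beta> (f (fst w)) - h (fst w))\<^sup>2 / 2"

lemma truncate_diff_bound:
  assumes "\<bar>v\<bar> \<le> \<beta>"
  shows "\<bar>truncate \<beta> u - v\<bar> \<le> 2 * \<beta>"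
  using abs_truncate_le[of \<beta> u] assms by linarith

text \<open>Since \<open>d\<close> and \<open>e\<close> are bounded by \<open>2 \<beta>\<close>, the
  factor \<open>3/2 d - 4 e\<close> is bounded by \<open>11 \<beta>\<close>; this gives
  \<open>22 = 2 * 11\<close> and, the offset being \<open>d^2 / 2\<close>,
  \<open>242 = 2 * 11^2\<close>.\<close>

lemma loss_bounds:
  assumes h: "\<And>z. \<bar>h z\<bar> \<le> \<beta>"
  shows "\<bar>loss_term \<beta> h f w\<bar> \<le> 22 * \<beta>\<^sup>2" "\<bar>loss_offset \<beta> h f w\<bar> \<le> 22 * \<beta>\<^sup>2"
    "\<beta> > 0 \<Longrightarrow> 1 / (242 * \<beta>\<^sup>2) * (loss_term \<beta> h f w)\<^sup>2 \<le> loss_offset \<beta> h f w"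
proof -
  define d where "d = truncate \<beta> (f (fst w)) - h (fst w)"
  define e where "e = truncate \<beta> (snd w) - h (fst w)"
  have d: "\<bar>d\<bar> \<le> 2 * \<beta>" and e: "\<bar>e\<bar> \<le> 2 * \<beta>"
    unfolding d_def e_def by (rule truncate_diff_bound[OF h])+
  have lt: "loss_term \<beta> h f w = d * (3 / 2 * d - 4 * e)"
    unfolding loss_term_def Let_def d_def[symmetric] e_def[symmetric]
    by (simp add: power2_eq_square field_simps)
  have lo: "loss_offset \<beta> h f w = d\<^sup>2 / 2" by (simp add: loss_offset_def d_def)
  have k: "\<bar>3 / 2 * d - 4 * e\<bar> \<le> 11 * \<beta>" using d e by linarith
  have "\<bar>d * (3 / 2 * d - 4 * e)\<bar> \<le> (2 * \<beta>) * (11 * \<beta>)"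
    unfolding abs_mult using d k by (intro mult_mono) auto
  then show "\<bar>loss_term \<beta> h f w\<bar> \<le> 22 * \<beta>\<^sup>2" by (simp add: lt power2_eq_square)
  have d2: "d\<^sup>2 \<le> (2 * \<beta>)\<^sup>2" using d by (metis abs_ge_zero power2_abs power_mono)
  then have "d\<^sup>2 \<le> 4 * \<beta>\<^sup>2" by (simp add: power_mult_distrib)
  then have "\<bar>d\<^sup>2 / 2\<bar> \<le> 22 * \<beta>\<^sup>2" using zero_le_power2[of \<beta>] zero_le_power2[of d] by linarith
  then show "\<bar>loss_offset \<beta> h f w\<bar> \<le> 22 * \<beta>\<^sup>2" by (simp only: lo)
  assume b: "\<beta> > 0"
  have "(3 / 2 * d - 4 * e)\<^sup>2 \<le> (11 * \<beta>)\<^sup>2" using k by (metis abs_ge_zero power2_abs power_mono)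
  then have "d\<^sup>2 * (3 / 2 * d - 4 * e)\<^sup>2 \<le> d\<^sup>2 * (121 * \<beta>\<^sup>2)"
    by (intro mult_left_mono) (simp_all add: power_mult_distrib)
  then have "(loss_term \<beta> h f w)\<^sup>2 \<le> 121 * \<beta>\<^sup>2 * d\<^sup>2" by (simp add: lt power_mult_distrib mult_ac)
  then show "1 / (242 * \<beta>\<^sup>2) * (loss_term \<beta> h f w)\<^sup>2 \<le> loss_offset \<beta> h f w"
    using b by (simp add: lo field_simps)
qed

text \<open>Both differences contain the factor \<open>d - d'\<close>; the larger cofactor is at
  most \<open>3/2 * 4 \<beta> + 4 * 2 \<beta> = 14 \<beta>\<close>.\<close>

lemma loss_close:
  assumes h: "\<And>z. \<bar>h z\<bar> \<le> \<beta>"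
    and close: "\<bar>truncate \<beta> (f (fst w)) - truncate \<beta> (g (fst w))\<bar> \<le> \<eta>"
  shows "\<bar>loss_term \<beta> h f w - loss_term \<beta> h g w\<bar> \<le> 14 * \<beta> * \<eta>"
    "\<bar>loss_offset \<beta> h f w - loss_offset \<beta> h g w\<bar> \<le> 14 * \<beta> * \<eta>"
proof -
  define d where "d = truncate \<beta> (f (fst w)) - h (fst w)"
  define d' where "d' = truncate \<beta> (g (fst w)) - h (fst w)"
  define e where "e = truncate \<beta> (snd w) - h (fst w)"
  have d: "\<bar>d\<bar> \<le> 2 * \<beta>" and d': "\<bar>d'\<bar> \<le> 2 * \<beta>" and e: "\<bar>e\<bar> \<le> 2 * \<beta>"
    unfolding d_def d'_def e_def by (rule truncate_diff_bound[OF h])+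
  have dd: "\<bar>d - d'\<bar> \<le> \<eta>" using close by (simp add: d_def d'_def)
  have "loss_term \<beta> h f w - loss_term \<beta> h g w = (3 / 2 * (d + d') - 4 * e) * (d - d')"
    unfolding loss_term_def Let_def d_def[symmetric] d'_def[symmetric] e_def[symmetric]
    by (simp add: power2_eq_square field_simps)
  moreover have "\<bar>(3 / 2 * (d + d') - 4 * e) * (d - d')\<bar> \<le> (14 * \<beta>) * \<eta>"
    unfolding abs_mult
  proof (rule mult_mono)
    show "\<bar>3 / 2 * (d + d') - 4 * e\<bar> \<le> 14 * \<beta>"
    proof (rule abs_leI)
      have "d \<le> 2 * \<beta>" "- d \<le> 2 * \<beta>" "d' \<le> 2 * \<beta>" "- d' \<le> 2 * \<beta>" "e \<le> 2 * \<beta>" "- e \<le> 2 * \<beta>"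
        using d d' e by (simp_all add: abs_le_iff)
      then show "3 / 2 * (d + d') - 4 * e \<le> 14 * \<beta>" "- (3 / 2 * (d + d') - 4 * e) \<le> 14 * \<beta>"
        by (simp_all add: field_simps)
    qed
  qed (use d dd in auto)
  ultimately show "\<bar>loss_term \<beta> h f w - loss_term \<beta> h g w\<bar> \<le> 14 * \<beta> * \<eta>" by simp
  have "loss_offset \<beta> h f w - loss_offset \<beta> h g w = ((d + d') / 2) * (d - d')"
    unfolding loss_offset_def d_def[symmetric] d'_def[symmetric]
    by (simp add: power2_eq_square field_simps)
  moreover have "\<bar>((d + d') / 2) * (d - d')\<bar> \<le> (14 * \<beta>) * \<eta>"
    unfolding abs_mult
  proof (rule mult_mono)
    have "0 \<le> \<beta>" "\<bar>d + d'\<bar> \<le> 4 * \<beta>" using d d' by linarith+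
    then show "\<bar>(d + d') / 2\<bar> \<le> 14 * \<beta>" by simp
  qed (use d dd in auto)
  ultimately show "\<bar>loss_offset \<beta> h f w - loss_offset \<beta> h g w\<bar> \<le> 14 * \<beta> * \<eta>" by simp
qed

lemma (in prob_space) iid_copies_PiM:
  fixes Xs :: "nat \<Rightarrow> 'a \<Rightarrow> real ^ 'p"
  assumes "iid_copies M X Y Xs Ys" and n: "n \<ge> 1"
  defines "P \<equiv> distr M borel (\<lambda>\<omega>. (X \<omega>, Y \<omega>))"
  shows "\<And>i. (\<lambda>\<omega>. (Xs i \<omega>, Ys i \<omega>)) \<in> borel_measurable M"
    and "distr M (Pi\<^sub>M {..<n} (\<lambda>_. P)) (\<lambda>\<omega>. \<lambda>i\<in>{..<n}. (Xs i \<omega>, Ys i \<omega>)) = Pi\<^sub>M {..<n} (\<lambda>_. P)"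
proof -
  have ind: "indep_vars (\<lambda>_. borel) (\<lambda>i \<omega>. (Xs i \<omega>, Ys i \<omega>)) UNIV"
    and law: "\<And>i. distr M borel (\<lambda>\<omega>. (Xs i \<omega>, Ys i \<omega>)) = P"
    using assms unfolding iid_copies_def by auto
  show rv: "(\<lambda>\<omega>. (Xs i \<omega>, Ys i \<omega>)) \<in> borel_measurable M" for i
    using ind unfolding indep_vars_def by auto
  have "indep_vars (\<lambda>_. borel) (\<lambda>i \<omega>. (Xs i \<omega>, Ys i \<omega>)) {..<n}"
    by (rule indep_vars_subset[OF ind]) simp
  then have "distr M (Pi\<^sub>M {..<n} (\<lambda>_. borel)) (\<lambda>\<omega>. \<lambda>i\<in>{..<n}. (Xs i \<omega>, Ys i \<omega>))
      = Pi\<^sub>M {..<n} (\<lambda>i. distr M borel (\<lambda>\<omega>. (Xs i \<omega>, Ys i \<omega>)))"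
  proof (subst (asm) indep_vars_iff_distr_eq_PiM')
    show "{..<n} \<noteq> {}" using n by (simp add: lessThan_empty_iff)
  qed (use rv in auto)
  also have "\<dots> = Pi\<^sub>M {..<n} (\<lambda>_. P)" by (simp only: law)
  also have "distr M (Pi\<^sub>M {..<n} (\<lambda>_. borel)) (\<lambda>\<omega>. \<lambda>i\<in>{..<n}. (Xs i \<omega>, Ys i \<omega>))
      = distr M (Pi\<^sub>M {..<n} (\<lambda>_. P)) (\<lambda>\<omega>. \<lambda>i\<in>{..<n}. (Xs i \<omega>, Ys i \<omega>))"
    by (rule distr_cong) (auto simp: P_def intro!: sets_PiM_cong)
  finally show "distr M (Pi\<^sub>M {..<n} (\<lambda>_. P)) (\<lambda>\<omega>. \<lambda>i\<in>{..<n}. (Xs i \<omega>, Ys i \<omega>)) = Pi\<^sub>M {..<n} (\<lambda>_. P)" .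
qed

lemma borel_measurable_fst_snd [measurable]:
  "fst \<in> borel_measurable (borel :: ('a :: second_countable_topology \<times> 'b :: second_countable_topology) measure)"
  "snd \<in> borel_measurable (borel :: ('a \<times> 'b) measure)"
  by (intro borel_measurable_continuous_onI continuous_intros)+

lemma truncate_diff_square_bound:
  assumes "\<bar>v\<bar> \<le> \<beta>"
  shows "(truncate \<beta> u - v)\<^sup>2 \<le> 4 * \<beta>\<^sup>2"
  using power_mono[OF truncate_diff_bound[OF assms] abs_ge_zero, of u 2] by (simp add: power_mult_distrib)

lemma (in prob_space) truncated_risk_integrable:
  fixes X :: "'a \<Rightarrow> real ^ 'p" and F :: "'a \<Rightarrow> real ^ 'p \<Rightarrow> real"
  assumes X: "X \<in> borel_measurable M"
    and hm: "h \<in> borel_measurable borel" and hb: "\<And>z. \<bar>h z\<bar> \<le> \<beta>"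
    and F: "(\<lambda>(\<omega>, z). F \<omega> z) \<in> borel_measurable (M \<Otimes>\<^sub>M borel)"
  shows "\<And>\<omega>. \<omega> \<in> space M \<Longrightarrow> integrable (distr M borel X) (\<lambda>z. (truncate \<beta> (F \<omega> z) - h z)\<^sup>2)"
    and "integrable M (\<lambda>\<omega>. \<integral>z. (truncate \<beta> (F \<omega> z) - h z)\<^sup>2 \<partial>distr M borel X)"
proof -
  define \<mu> where "\<mu> = distr M borel X"
  have sets\<mu> [measurable_cong]: "sets \<mu> = sets borel" by (simp add: \<mu>_def)
  note [measurable] = hm
  interpret \<mu>: prob_space \<mu> unfolding \<mu>_def by (rule prob_space_distr[OF X])
  have Fw: "F \<omega> \<in> borel_measurable borel" if "\<omega> \<in> space M" for \<omega>
    using measurable_Pair2[OF F that] by simp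
  have inner: "integrable \<mu> (\<lambda>z. (truncate \<beta> (F \<omega> z) - h z)\<^sup>2)" if "\<omega> \<in> space M" for \<omega>
  proof (rule \<mu>.integrable_const_bound[where B = "4 * \<beta>\<^sup>2"])
    note [measurable] = Fw[OF that]
    show "(\<lambda>z. (truncate \<beta> (F \<omega> z) - h z)\<^sup>2) \<in> borel_measurable \<mu>" by measurable
  qed (use truncate_diff_square_bound[OF hb] in auto)
  then show "\<And>\<omega>. \<omega> \<in> space M \<Longrightarrow> integrable (distr M borel X) (\<lambda>z. (truncate \<beta> (F \<omega> z) - h z)\<^sup>2)"
    unfolding \<mu>_def .
  define R where "R = (\<lambda>\<omega>. \<integral>z. (truncate \<beta> (F \<omega> z) - h z)\<^sup>2 \<partial>\<mu>)"
  have Rm: "R \<in> borel_measurable M"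
  proof -
    have "(\<lambda>(\<omega>, z). (truncate \<beta> (F \<omega> z) - h z)\<^sup>2) \<in> borel_measurable (M \<Otimes>\<^sub>M \<mu>)"
      using F by measurable
    then show ?thesis unfolding R_def by (rule \<mu>.borel_measurable_lebesgue_integral)
  qed
  have R0: "R \<omega> \<ge> 0" for \<omega> unfolding R_def by (rule integral_nonneg_AE) simp
  have R1: "R \<omega> \<le> 4 * \<beta>\<^sup>2" if "\<omega> \<in> space M" for \<omega>
  proof -
    have "R \<omega> \<le> (\<integral>z. 4 * \<beta>\<^sup>2 \<partial>\<mu>)"
      unfolding R_def
      by (rule integral_mono[OF inner[OF that]]) (use truncate_diff_square_bound[OF hb] in auto)
    then show ?thesis by (simp add: \<mu>.prob_space)
  qed
  have "integrable M R"
    by (rule integrable_const_bound[where B = "4 * \<beta>\<^sup>2"]) (use Rm R0 R1 in auto)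
  then show "integrable M (\<lambda>\<omega>. \<integral>z. (truncate \<beta> (F \<omega> z) - h z)\<^sup>2 \<partial>distr M borel X)"
    unfolding R_def \<mu>_def .
qed

text \<open>The fit \<open>F\<close> may depend on sample and seeds in any jointly measurable way.
  The last three terms come from truncating the responses, from the covering number and from the
  resolution: levels \<open>1 / n\<close> apart change the loss by \<open>14 \<beta> / n\<close>,
  and \<open>8 * 14 = 112\<close>.\<close>

lemma (in prob_space) truncated_risk_bound:
  fixes X :: "'a \<Rightarrow> real ^ 'p" and F :: "'a \<Rightarrow> real ^ 'p \<Rightarrow> real"
  assumes X: "X \<in> borel_measurable M" and Y: "integrable M Y"
    and iid: "iid_copies M X Y Xs Ys" and n: "n \<ge> 1"
    and m: "is_regression_function M X Y m" and hmX: "AE \<omega> in M. h (X \<omega>) = m (X \<omega>)"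
    and hm: "h \<in> borel_measurable borel" and hb: "\<And>z. \<bar>h z\<bar> \<le> \<beta>" and \<beta>: "\<beta> > 0"
    and F: "(\<lambda>(\<omega>, z). F \<omega> z) \<in> borel_measurable (M \<Otimes>\<^sub>M borel)"
    and step: "AE \<omega> in M. F \<omega> \<in> step_functions UNIV UNIV d D"
    and N: "real N \<ge> 2 * \<beta> * real n"
  shows "(\<integral>\<omega>. (\<integral>z. (truncate \<beta> (F \<omega> z) - h z)\<^sup>2 \<partial>distr M borel X) \<partial>M)
    \<le> (\<integral>\<omega>. 2 / real n * (\<Sum>i<n. (truncate \<beta> (F \<omega> (Xs i \<omega>)) - truncate \<beta> (Ys i \<omega>))\<^sup>2
          - (truncate \<beta> (Ys i \<omega>) - h (Xs i \<omega>))\<^sup>2) \<partial>M)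
      + 8 * \<beta> * (\<integral>\<omega>. \<bar>Y \<omega> - truncate \<beta> (Y \<omega>)\<bar> \<partial>M)
      + 242 * \<beta>\<^sup>2 * ln (real (cover_bound CARD('p) d D N (2 * n))) / real n + 112 * \<beta> / real n"
proof -
  define P where "P = distr M borel (\<lambda>\<omega>. (X \<omega>, Y \<omega>))"
  define K where "K = cover_bound CARD('p) d D N (2 * n)"
  define \<mu> where "\<mu> = distr M borel X"
  have n0: "real n > 0" using n by simp
  have Ym [measurable]: "Y \<in> borel_measurable M" using Y by (rule borel_measurable_integrable)
  note [measurable] = X hm
  have XY [measurable]: "(\<lambda>\<omega>. (X \<omega>, Y \<omega>)) \<in> borel_measurable M"
    by (simp add: borel_prod[symmetric])
  have setsP [measurable_cong]: "sets P = sets borel" by (simp add: P_def)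
  have sets\<mu> [measurable_cong]: "sets \<mu> = sets borel" by (simp add: \<mu>_def)
  interpret P: prob_space P unfolding P_def by (rule prob_space_distr[OF XY])
  define D' where "D' = (\<lambda>i \<omega>. (Xs i \<omega>, Ys i \<omega>))"
  have D'm [measurable]: "D' i \<in> borel_measurable M" for i
    unfolding D'_def by (rule iid_copies_PiM(1)[OF iid n])
  have Xsm [measurable]: "Xs i \<in> borel_measurable M" and Ysm [measurable]: "Ys i \<in> borel_measurable M" for i
    using measurable_compose[OF D'm[of i] borel_measurable_fst_snd(1)]
      measurable_compose[OF D'm[of i] borel_measurable_fst_snd(2)] by (simp_all add: D'_def)
  have D'law: "distr M (Pi\<^sub>M {..<n} (\<lambda>_. P)) (\<lambda>\<omega>. \<lambda>i\<in>{..<n}. D' i \<omega>) = Pi\<^sub>M {..<n} (\<lambda>_. P)"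
    unfolding P_def D'_def by (rule iid_copies_PiM(2)[OF iid n])
  obtain H :: "((real ^ 'p) \<times> real) set" where H: "countable H"
    and Hd: "\<And>Q \<theta> s. finite Q \<Longrightarrow> \<exists>(\<theta>', s')\<in>H. \<forall>z\<in>Q. \<theta> \<bullet> z \<le> s \<longleftrightarrow> \<theta>' \<bullet> z \<le> s'"
    using countable_halfspaces[where 'p = 'p] by blast
  define I where "I = step_functions H \<rat> d D"
  have "(\<lambda>z. \<Sum>i<D. 0 * indicator unit_cube z :: real) \<in> I"
    unfolding I_def step_functions_def
    using cells_mono[of 0 d H] by (intro CollectI exI[of _ "\<lambda>_. 0"] exI[of _ "\<lambda>_. unit_cube"]) auto
  then have I0: "I \<noteq> {}" by blast
  have loss_meas: "loss_term \<beta> h f \<in> borel_measurable P" "loss_offset \<beta> h f \<in> borel_measurable P"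
    if "f \<in> I" for f
  proof -
    have [measurable]: "f \<in> borel_measurable borel"
      using that unfolding I_def by (rule borel_measurable_step_functions)
    show "loss_term \<beta> h f \<in> borel_measurable P" "loss_offset \<beta> h f \<in> borel_measurable P"
      unfolding loss_term_def[abs_def] loss_offset_def[abs_def] Let_def by measurable
  qed
  have lc: "\<bar>loss_term \<beta> h f w - loss_term \<beta> h g w\<bar> \<le> 14 * \<beta> * (1 / real n)
      \<and> \<bar>loss_offset \<beta> h f w - loss_offset \<beta> h g w\<bar> \<le> 14 * \<beta> * (1 / real n)"
    if "\<bar>truncate \<beta> (f (fst w)) - truncate \<beta> (g (fst w))\<bar> \<le> 1 / real n" for f g w
    using loss_close[of h \<beta> f w g "1 / real n", OF hb that] by blast
  interpret C: countable_class P I "loss_term \<beta> h" "loss_offset \<beta> h" "22 * \<beta>\<^sup>2"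
    "14 * \<beta> * (1 / real n)" "1 / (242 * \<beta>\<^sup>2)" n K
  proof (unfold_locales)
    show "countable I" unfolding I_def by (intro countable_step_functions H countable_rat)
    show "I \<noteq> {}" by (rule I0)
    show "loss_term \<beta> h f \<in> borel_measurable P" "loss_offset \<beta> h f \<in> borel_measurable P"
      if "f \<in> I" for f using loss_meas that by blast+
    show "\<bar>loss_term \<beta> h f w\<bar> \<le> 22 * \<beta>\<^sup>2 \<and> \<bar>loss_offset \<beta> h f w\<bar> \<le> 22 * \<beta>\<^sup>2" for f w
      using loss_bounds(1,2)[of h \<beta>, OF hb] by blast
    show "0 < 1 / (242 * \<beta>\<^sup>2)" using \<beta> by simp
    show "1 / (242 * \<beta>\<^sup>2) * (loss_term \<beta> h f w)\<^sup>2 \<le> loss_offset \<beta> h f w" for f w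
      by (rule loss_bounds(3)[of h \<beta>, OF hb \<beta>])
    fix Q :: "((real ^ 'p) \<times> real) set" assume Q: "finite Q" "card Q \<le> 2 * n"
    have fQ: "finite (fst ` Q)" "card (fst ` Q) \<le> 2 * n"
      using Q card_image_le[OF Q(1), of fst] by auto
    obtain J where J: "J \<subseteq> I" "finite J" "card J \<le> K"
      and Jc: "\<And>f. f \<in> I \<Longrightarrow> \<exists>g\<in>J. \<forall>z\<in>fst ` Q. \<bar>truncate \<beta> (f z) - truncate \<beta> (g z)\<bar> \<le> 1 / real n"
      unfolding I_def K_def
      by (rule step_functions_cover[OF fQ, of "1 / real n" \<beta> N H \<rat> d D])
        (use n0 N in \<open>simp_all add: field_simps\<close>)
    show "\<exists>J\<subseteq>I. finite J \<and> card J \<le> K \<and> (\<forall>f\<in>I. \<exists>g\<in>J. \<forall>w\<in>Q.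
      \<bar>loss_term \<beta> h f w - loss_term \<beta> h g w\<bar> \<le> 14 * \<beta> * (1 / real n)
      \<and> \<bar>loss_offset \<beta> h f w - loss_offset \<beta> h g w\<bar> \<le> 14 * \<beta> * (1 / real n))"
    proof (intro exI[of _ J] conjI J ballI)
      fix f assume "f \<in> I"
      then obtain g where g: "g \<in> J" "\<forall>z\<in>fst ` Q. \<bar>truncate \<beta> (f z) - truncate \<beta> (g z)\<bar> \<le> 1 / real n"
        using Jc by blast
      show "\<exists>g\<in>J. \<forall>w\<in>Q. \<bar>loss_term \<beta> h f w - loss_term \<beta> h g w\<bar> \<le> 14 * \<beta> * (1 / real n)
        \<and> \<bar>loss_offset \<beta> h f w - loss_offset \<beta> h g w\<bar> \<le> 14 * \<beta> * (1 / real n)"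
        by (intro bexI[OF _ g(1)] ballI lc) (use g(2) in simp)
    qed
  qed
  have Ffst: "(\<lambda>x. F (fst x) (fst (snd x))) \<in> borel_measurable (M \<Otimes>\<^sub>M P)"
  proof -
    have "(\<lambda>x. (fst x, fst (snd x))) \<in> measurable (M \<Otimes>\<^sub>M P) (M \<Otimes>\<^sub>M borel)" by measurable
    from measurable_compose[OF this F] show ?thesis by simp
  qed
  note [measurable] = Ffst
  have lm1: "(\<lambda>(\<omega>, w). loss_term \<beta> h (F \<omega>) w) \<in> borel_measurable (M \<Otimes>\<^sub>M P)"
    and lm2: "(\<lambda>(\<omega>, w). loss_offset \<beta> h (F \<omega>) w) \<in> borel_measurable (M \<Otimes>\<^sub>M P)"
    unfolding loss_term_def loss_offset_def Let_def case_prod_beta by measurable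
  define L where "L = (\<lambda>\<omega>. real n * (\<integral>w. loss_term \<beta> h (F \<omega>) w - loss_offset \<beta> h (F \<omega>) w \<partial>P)
    - (\<Sum>i<n. loss_term \<beta> h (F \<omega>) (D' i \<omega>) + loss_offset \<beta> h (F \<omega>) (D' i \<omega>)))"
  have sym: "(\<integral>\<omega>. L \<omega> \<partial>M) \<le> ln (real K) / (1 / (242 * \<beta>\<^sup>2)) + 8 * real n * (14 * \<beta> * (1 / real n))"
    unfolding L_def
  proof (rule C.symmetrization[OF prob_space_axioms _ D'law lm1 lm2])
    show "D' i \<in> measurable M P" for i by measurable
    show "\<bar>loss_term \<beta> h (F \<omega>) w\<bar> \<le> 22 * \<beta>\<^sup>2 \<and> \<bar>loss_offset \<beta> h (F \<omega>) w\<bar> \<le> 22 * \<beta>\<^sup>2" for \<omega> w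
      using loss_bounds(1,2)[of h \<beta>, OF hb] by blast
    show "AE \<omega> in M. \<forall>Q. finite Q \<longrightarrow> (\<exists>f\<in>I. \<forall>w\<in>Q.
      \<bar>loss_term \<beta> h (F \<omega>) w - loss_term \<beta> h f w\<bar> \<le> 14 * \<beta> * (1 / real n)
      \<and> \<bar>loss_offset \<beta> h (F \<omega>) w - loss_offset \<beta> h f w\<bar> \<le> 14 * \<beta> * (1 / real n))"
      using step
    proof (rule AE_mp, intro AE_I2 impI allI)
      fix \<omega> and Q :: "((real ^ 'p) \<times> real) set"
      assume s: "F \<omega> \<in> step_functions UNIV UNIV d D" and Q: "finite Q"
      have "finite (fst ` Q)" using Q by simp
      from step_functions_dense[OF Hd[OF this] s, of "1 / real n"] n0
      obtain g where g: "g \<in> I" "\<forall>z\<in>fst ` Q. \<bar>F \<omega> z - g z\<bar> \<le> 1 / real n"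
        unfolding I_def by auto
      show "\<exists>f\<in>I. \<forall>w\<in>Q. \<bar>loss_term \<beta> h (F \<omega>) w - loss_term \<beta> h f w\<bar> \<le> 14 * \<beta> * (1 / real n)
        \<and> \<bar>loss_offset \<beta> h (F \<omega>) w - loss_offset \<beta> h f w\<bar> \<le> 14 * \<beta> * (1 / real n)"
        by (intro bexI[OF _ g(1)] ballI lc order_trans[OF truncate_lipschitz]) (use g(2) in simp)
    qed
  qed
  define \<delta> where "\<delta> = (\<integral>\<omega>. \<bar>Y \<omega> - truncate \<beta> (Y \<omega>)\<bar> \<partial>M)"
  define R where "R = (\<lambda>\<omega>. \<integral>z. (truncate \<beta> (F \<omega> z) - h z)\<^sup>2 \<partial>\<mu>)"
  define emp where "emp = (\<lambda>\<omega>. 2 / real n * (\<Sum>i<n. (truncate \<beta> (F \<omega> (Xs i \<omega>)) - truncate \<beta> (Ys i \<omega>))\<^sup>2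
          - (truncate \<beta> (Ys i \<omega>) - h (Xs i \<omega>))\<^sup>2))"
  have FXs [measurable]: "(\<lambda>\<omega>. F \<omega> (Xs i \<omega>)) \<in> borel_measurable M" for i
  proof -
    have "(\<lambda>\<omega>. (\<omega>, Xs i \<omega>)) \<in> measurable M (M \<Otimes>\<^sub>M borel)" by measurable
    from measurable_compose[OF this F] show ?thesis by simp
  qed
  have db: "\<bar>truncate \<beta> u - h z\<bar> \<le> 2 * \<beta>" for u z by (rule truncate_diff_bound[OF hb])
  have sq: "u\<^sup>2 \<le> 4 * \<beta>\<^sup>2" if "\<bar>u\<bar> \<le> 2 * \<beta>" for u
    using power_mono[OF that abs_ge_zero, of 2] by (simp add: power_mult_distrib)
  have key: "R \<omega> \<le> L \<omega> / real n + emp \<omega> + 8 * \<beta> * \<delta>" if \<omega>: "\<omega> \<in> space M" for \<omega>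
  proof -
    have Fw [measurable]: "F \<omega> \<in> borel_measurable borel" using measurable_Pair2[OF F \<omega>] by simp
    define d where "d = (\<lambda>z. truncate \<beta> (F \<omega> z) - h z)"
    have dm [measurable]: "d \<in> borel_measurable borel" unfolding d_def by measurable
    have dle: "\<bar>d z\<bar> \<le> 2 * \<beta>" for z unfolding d_def by (rule db)
    note orth = regression_function_orthogonal[where d = d and h = h, OF prob_space_axioms X Y m hmX hm dm dle]
    have iT: "integrable M (\<lambda>\<omega>. \<bar>Y \<omega> - truncate \<beta> (Y \<omega>)\<bar>)"
      by (intro integrable_abs Bochner_Integration.integrable_diff Y
          integrable_const_bound[where B = \<beta>]) (use \<beta> abs_truncate_le in auto)
    have idT: "integrable M (\<lambda>\<omega>. d (X \<omega>) * (truncate \<beta> (Y \<omega>) - h (X \<omega>)))"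
    proof (rule integrable_const_bound[where B = "2 * \<beta> * (2 * \<beta>)"])
      show "AE \<omega> in M. norm (d (X \<omega>) * (truncate \<beta> (Y \<omega>) - h (X \<omega>))) \<le> 2 * \<beta> * (2 * \<beta>)"
        unfolding real_norm_def abs_mult using \<beta> by (intro AE_I2 mult_mono dle db) auto
    qed measurable
    have i2: "integrable M (\<lambda>\<omega>. (d (X \<omega>))\<^sup>2)"
      by (rule integrable_const_bound[where B = "4 * \<beta>\<^sup>2"]) (use sq[OF dle] in auto)
    \<comment> \<open>The untruncated noise is orthogonal to \<open>d (X \<omega>)\<close>; what
      remains is the cut-off part of the response, weighted by at most
      \<open>2 * \<beta>\<close>.\<close>
    have "(\<integral>\<omega>. d (X \<omega>) * (truncate \<beta> (Y \<omega>) - h (X \<omega>)) \<partial>M)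
        \<le> (\<integral>\<omega>. d (X \<omega>) * (Y \<omega> - h (X \<omega>)) + 2 * \<beta> * \<bar>Y \<omega> - truncate \<beta> (Y \<omega>)\<bar> \<partial>M)"
    proof (rule integral_mono[OF idT])
      show "integrable M (\<lambda>\<omega>. d (X \<omega>) * (Y \<omega> - h (X \<omega>)) + 2 * \<beta> * \<bar>Y \<omega> - truncate \<beta> (Y \<omega>)\<bar>)"
        using orth(1,2) iT by (simp add: right_diff_distrib)
      fix \<omega>'
      have "d (X \<omega>') * (truncate \<beta> (Y \<omega>') - Y \<omega>') \<le> 2 * \<beta> * \<bar>Y \<omega>' - truncate \<beta> (Y \<omega>')\<bar>"
        using mult_mono[OF dle[of "X \<omega>'"] order_refl[of "\<bar>Y \<omega>' - truncate \<beta> (Y \<omega>')\<bar>"]] \<beta>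
          abs_ge_self[of "d (X \<omega>') * (truncate \<beta> (Y \<omega>') - Y \<omega>')"]
        by (simp add: abs_mult abs_minus_commute)
      then show "d (X \<omega>') * (truncate \<beta> (Y \<omega>') - h (X \<omega>'))
          \<le> d (X \<omega>') * (Y \<omega>' - h (X \<omega>')) + 2 * \<beta> * \<bar>Y \<omega>' - truncate \<beta> (Y \<omega>')\<bar>"
        by (simp add: right_diff_distrib)
    qed
    also have "\<dots> = 2 * \<beta> * \<delta>"
      using orth iT by (simp add: right_diff_distrib \<delta>_def)
    finally have bias: "(\<integral>\<omega>. d (X \<omega>) * (truncate \<beta> (Y \<omega>) - h (X \<omega>)) \<partial>M) \<le> 2 * \<beta> * \<delta>" .
    have "(\<integral>w. loss_term \<beta> h (F \<omega>) w - loss_offset \<beta> h (F \<omega>) w \<partial>P)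
        = (\<integral>\<omega>'. loss_term \<beta> h (F \<omega>) (X \<omega>', Y \<omega>') - loss_offset \<beta> h (F \<omega>) (X \<omega>', Y \<omega>') \<partial>M)"
      unfolding P_def
      by (rule integral_distr[OF XY]) (simp add: loss_term_def[abs_def] loss_offset_def[abs_def] Let_def)
    also have "\<dots> = (\<integral>\<omega>'. (d (X \<omega>'))\<^sup>2 - 4 * (d (X \<omega>') * (truncate \<beta> (Y \<omega>') - h (X \<omega>'))) \<partial>M)"
      by (rule Bochner_Integration.integral_cong) (simp_all add: loss_term_def loss_offset_def Let_def d_def)
    also have "\<dots> = (\<integral>\<omega>'. (d (X \<omega>'))\<^sup>2 \<partial>M) - 4 * (\<integral>\<omega>'. d (X \<omega>') * (truncate \<beta> (Y \<omega>') - h (X \<omega>')) \<partial>M)"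
      using i2 idT by simp
    also have "(\<integral>\<omega>'. (d (X \<omega>'))\<^sup>2 \<partial>M) = R \<omega>"
    proof -
      have "(\<integral>z. (d z)\<^sup>2 \<partial>\<mu>) = (\<integral>\<omega>'. (d (X \<omega>'))\<^sup>2 \<partial>M)"
        unfolding \<mu>_def by (rule integral_distr[OF X]) measurable
      then show ?thesis by (simp add: R_def d_def)
    qed
    finally have I1: "R \<omega> - 8 * \<beta> * \<delta> \<le> (\<integral>w. loss_term \<beta> h (F \<omega>) w - loss_offset \<beta> h (F \<omega>) w \<partial>P)"
      using bias by linarith
    have I2: "(\<Sum>i<n. loss_term \<beta> h (F \<omega>) (D' i \<omega>) + loss_offset \<beta> h (F \<omega>) (D' i \<omega>)) = real n * emp \<omega>"
    proof -
      \<comment> \<open>The identity \<open>2 d^2 - 4 d e = 2 ((d - e)^2 - e^2)\<close>, where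
        \<open>d - e\<close> no longer involves \<open>h\<close>.\<close>
      have "loss_term \<beta> h (F \<omega>) (D' i \<omega>) + loss_offset \<beta> h (F \<omega>) (D' i \<omega>)
        = 2 * ((truncate \<beta> (F \<omega> (Xs i \<omega>)) - truncate \<beta> (Ys i \<omega>))\<^sup>2 - (truncate \<beta> (Ys i \<omega>) - h (Xs i \<omega>))\<^sup>2)" for i
        by (simp add: loss_term_def loss_offset_def Let_def D'_def power2_eq_square field_simps)
      then show ?thesis using n0 by (simp add: emp_def sum_distrib_left)
    qed
    have "real n * (R \<omega> - 8 * \<beta> * \<delta>) - real n * emp \<omega> \<le> L \<omega>"
      unfolding L_def I2 using I1 n0 by simp
    then have "real n * (R \<omega> - 8 * \<beta> * \<delta> - emp \<omega>) \<le> L \<omega>" by (simp add: algebra_simps)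
    then have "R \<omega> - 8 * \<beta> * \<delta> - emp \<omega> \<le> L \<omega> / real n"
      using n0 by (simp add: pos_le_divide_eq mult.commute)
    then show ?thesis by linarith
  qed
  have iR: "integrable M R"
    unfolding R_def \<mu>_def by (rule truncated_risk_integrable(2)[OF X hm hb F])
  have ie: "integrable M emp"
  proof -
    have *: "integrable M (\<lambda>\<omega>. (truncate \<beta> (F \<omega> (Xs i \<omega>)) - truncate \<beta> (Ys i \<omega>))\<^sup>2
          - (truncate \<beta> (Ys i \<omega>) - h (Xs i \<omega>))\<^sup>2)" for i
    proof (rule Bochner_Integration.integrable_diff)
      have "\<bar>truncate \<beta> (F \<omega> (Xs i \<omega>)) - truncate \<beta> (Ys i \<omega>)\<bar> \<le> 2 * \<beta>" for \<omega>
        using abs_truncate_le[of \<beta>] \<beta> by (intro truncate_diff_bound) simp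
      from sq[OF this] show "integrable M (\<lambda>\<omega>. (truncate \<beta> (F \<omega> (Xs i \<omega>)) - truncate \<beta> (Ys i \<omega>))\<^sup>2)"
        by (intro integrable_const_bound[where B = "4 * \<beta>\<^sup>2"]) auto
      show "integrable M (\<lambda>\<omega>. (truncate \<beta> (Ys i \<omega>) - h (Xs i \<omega>))\<^sup>2)"
        using sq[OF db] by (intro integrable_const_bound[where B = "4 * \<beta>\<^sup>2"]) auto
    qed
    show ?thesis unfolding emp_def
      by (intro integrable_mult_right Bochner_Integration.integrable_sum *)
  qed
  have iL: "integrable M L"
  proof -
    have "(\<lambda>(\<omega>, w). loss_term \<beta> h (F \<omega>) w - loss_offset \<beta> h (F \<omega>) w) \<in> borel_measurable (M \<Otimes>\<^sub>M P)"
      using borel_measurable_diff[OF lm1 lm2] by (simp add: case_prod_beta)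
    then have m1: "(\<lambda>\<omega>. \<integral>w. loss_term \<beta> h (F \<omega>) w - loss_offset \<beta> h (F \<omega>) w \<partial>P) \<in> borel_measurable M"
      by (rule P.borel_measurable_lebesgue_integral)
    have b1: "\<bar>\<integral>w. loss_term \<beta> h (F \<omega>) w - loss_offset \<beta> h (F \<omega>) w \<partial>P\<bar> \<le> 44 * \<beta>\<^sup>2" for \<omega>
    proof -
      have "\<bar>\<integral>w. loss_term \<beta> h (F \<omega>) w - loss_offset \<beta> h (F \<omega>) w \<partial>P\<bar> \<le> (\<integral>w. 44 * \<beta>\<^sup>2 \<partial>P)"
      \<comment> \<open>Outside the space of \<open>M\<close> the integrand need not be measurable;
        a function that is not integrable has integral 0.\<close>
      proof (cases "integrable P (\<lambda>w. loss_term \<beta> h (F \<omega>) w - loss_offset \<beta> h (F \<omega>) w)")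
        case True
        have "\<bar>loss_term \<beta> h (F \<omega>) w - loss_offset \<beta> h (F \<omega>) w\<bar> \<le> 44 * \<beta>\<^sup>2" for w
          using loss_bounds(1,2)[of h \<beta>, OF hb, of "F \<omega>" w] by linarith
        then have "(\<integral>w. \<bar>loss_term \<beta> h (F \<omega>) w - loss_offset \<beta> h (F \<omega>) w\<bar> \<partial>P) \<le> (\<integral>w. 44 * \<beta>\<^sup>2 \<partial>P)"
          using True by (intro integral_mono) auto
        from order_trans[OF integral_abs_bound this] show ?thesis .
      qed (simp add: not_integrable_integral_eq)
      then show ?thesis by (simp add: P.prob_space)
    qed
    have m2: "(\<lambda>\<omega>. loss_term \<beta> h (F \<omega>) (D' i \<omega>) + loss_offset \<beta> h (F \<omega>) (D' i \<omega>)) \<in> borel_measurable M" for i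
    proof -
      have "(\<lambda>\<omega>. (\<omega>, D' i \<omega>)) \<in> measurable M (M \<Otimes>\<^sub>M P)" by measurable
      from measurable_compose[OF this borel_measurable_add[OF lm1 lm2]] show ?thesis by simp
    qed
    have b2: "\<bar>loss_term \<beta> h (F \<omega>) (D' i \<omega>) + loss_offset \<beta> h (F \<omega>) (D' i \<omega>)\<bar> \<le> 44 * \<beta>\<^sup>2" for \<omega> i
      using loss_bounds(1,2)[of h \<beta>, OF hb, of "F \<omega>" "D' i \<omega>"] by linarith
    show ?thesis unfolding L_def
      by (intro Bochner_Integration.integrable_diff integrable_mult_right Bochner_Integration.integrable_sum
          integrable_const_bound[where B = "44 * \<beta>\<^sup>2"]) (use m1 m2 b1 b2 in auto)
  qed
  have "(\<integral>\<omega>. R \<omega> \<partial>M) \<le> (\<integral>\<omega>. L \<omega> / real n + emp \<omega> + 8 * \<beta> * \<delta> \<partial>M)"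
    by (rule integral_mono[OF iR _ key]) (use iL ie in auto)
  also have "\<dots> = (\<integral>\<omega>. L \<omega> \<partial>M) / real n + (\<integral>\<omega>. emp \<omega> \<partial>M) + 8 * \<beta> * \<delta>"
    using iL ie by (simp add: prob_space)
  also have "(\<integral>\<omega>. L \<omega> \<partial>M) / real n
      \<le> (ln (real K) / (1 / (242 * \<beta>\<^sup>2)) + 8 * real n * (14 * \<beta> * (1 / real n))) / real n"
    using sym n0 by (intro divide_right_mono) auto
  also have "\<dots> = 242 * \<beta>\<^sup>2 * ln (real K) / real n + 112 * \<beta> / real n"
    using n0 by (simp add: field_simps)
  finally show ?thesis by (simp add: R_def emp_def \<delta>_def K_def \<mu>_def)
qed

section \<open>Risk of boosted trees\<close>

text \<open>A seed is the full set with probability \<open>1 / p\<close>, so \<open>k / p\<close>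
  such trees are expected. A shortfall of \<open>k / (2 p)\<close> has the Hoeffding exponent
  \<open>2 (k / (2 p))^2 / k = k / (2 p^2)\<close>.\<close>

lemma (in prob_space) full_first_split_count:
  fixes S :: "nat \<times> nat \<times> nat \<Rightarrow> 'a \<Rightarrow> 'p :: finite set" and Xs :: "nat \<Rightarrow> 'a \<Rightarrow> real ^ 'p"
  assumes adm: "admissible_seeds M n Xs Ys (seed_index B k t) S"
    and b: "b \<in> {1..B}" and t: "t \<ge> 2" and k: "k \<ge> 1"
  defines "N \<equiv> \<lambda>\<omega>. card {j\<in>{1..k}. S (b, j, 1) \<omega> = UNIV}"
  shows "{\<omega>\<in>space M. real (N \<omega>) \<le> real k / (2 * real CARD('p))} \<in> events"
    and "prob {\<omega>\<in>space M. real (N \<omega>) \<le> real k / (2 * real CARD('p))}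
      \<le> exp (- real k / (2 * (real CARD('p))\<^sup>2))"
proof -
  define p where "p = real CARD('p)"
  have p: "p > 0" by (simp add: p_def)
  define I where "I = (\<lambda>j. (b, j, 1 :: nat)) ` {1..k}"
  have I: "I \<subseteq> seed_index B k t" using b t by (auto simp: I_def seed_index_def)
  have cI: "card I = k" unfolding I_def by (subst card_image) (auto simp: inj_on_def)
  have finI: "finite I" by (simp add: I_def)
  define Z where "Z = (\<lambda>e \<omega>. if S e \<omega> = UNIV then 1 else 0 :: real)"
  have indS: "indep_vars (\<lambda>_. count_space UNIV) S (seed_index B k t)"
    and pr: "\<And>e. e \<in> seed_index B k t \<Longrightarrow> prob {\<omega>\<in>space M. S e \<omega> = UNIV} = 1 / p"
    using adm unfolding admissible_seeds_def by (auto simp: p_def)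
  have indZ: "indep_vars (\<lambda>_. borel) Z I"
    unfolding Z_def
    by (rule indep_vars_compose2[OF indep_vars_subset[OF indS I], of "\<lambda>_ s. if s = UNIV then 1 else 0"]) simp
  have ZE: "expectation (Z e) = 1 / p" if "e \<in> I" for e
  proof -
    have e: "e \<in> seed_index B k t" using I that by blast
    have "S e \<in> measurable M (count_space UNIV)" using indS e unfolding indep_vars_def by blast
    then have "{\<omega>\<in>space M. S e \<omega> = UNIV} \<in> events" by measurable
    moreover have "expectation (Z e) = expectation (indicator {\<omega>\<in>space M. S e \<omega> = UNIV})"
      by (rule Bochner_Integration.integral_cong) (auto simp: Z_def indicator_def)
    ultimately show ?thesis using pr[OF e] by simp
  qed
  interpret H: Hoeffding_ineq M I Z "\<lambda>_. 0" "\<lambda>_. 1" "real k / p"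
  proof unfold_locales
    show "finite I" by (rule finI)
    show "indep_vars (\<lambda>_. borel) Z I" by (rule indZ)
    show "AE \<omega> in M. Z e \<omega> \<in> {0..1}" if "e \<in> I" for e by (simp add: Z_def)
    show "real k / p \<equiv> (\<Sum>e\<in>I. expectation (Z e))" by (rule eq_reflection) (simp add: ZE cI)
  qed
  have NZ: "real (N \<omega>) = (\<Sum>e\<in>I. Z e \<omega>)" for \<omega>
  proof -
    have "(\<Sum>e\<in>I. Z e \<omega>) = (\<Sum>j\<in>{1..k}. if S (b, j, 1) \<omega> = UNIV then 1 else 0)"
      unfolding I_def Z_def by (subst sum.reindex) (auto simp: inj_on_def)
    also have "\<dots> = real (card {j\<in>{1..k}. S (b, j, 1) \<omega> = UNIV})"
      by (simp add: sum.inter_filter[symmetric])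
    finally show ?thesis by (simp add: N_def)
  qed
  have half: "real k / (2 * p) = real k / p - real k / (2 * p)" using p by (simp add: field_simps)
  have [measurable]: "Z e \<in> borel_measurable M" if "e \<in> I" for e
    using indZ that unfolding indep_vars_def by blast
  show "{\<omega>\<in>space M. real (N \<omega>) \<le> real k / (2 * real CARD('p))} \<in> events"
    unfolding NZ by measurable
  have "prob {\<omega>\<in>space M. (\<Sum>e\<in>I. Z e \<omega>) \<le> real k / p - real k / (2 * p)}
      \<le> exp (- 2 * (real k / (2 * p))\<^sup>2 / (\<Sum>e\<in>I. (1 - 0)\<^sup>2))"
    by (rule H.Hoeffding_ineq_le) (use k p cI in auto)
  also have "- 2 * (real k / (2 * p))\<^sup>2 / (\<Sum>e\<in>I. (1 - 0)\<^sup>2) = - real k / (2 * p\<^sup>2)"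
    using k p by (simp add: cI power2_eq_square field_simps)
  finally show "prob {\<omega>\<in>space M. real (N \<omega>) \<le> real k / (2 * real CARD('p))}
      \<le> exp (- real k / (2 * (real CARD('p))\<^sup>2))"
    unfolding NZ half[symmetric] p_def[symmetric] .
qed

lemma abs_ridge_le:
  assumes a: "summable (\<lambda>j. \<bar>a j\<bar>)"
  shows "\<bar>\<Sum>j. a j * heaviside (u j)\<bar> \<le> (\<Sum>j. \<bar>a j\<bar>)"
proof -
  have le: "\<bar>a j * heaviside (u j)\<bar> \<le> \<bar>a j\<bar>" for j by (simp add: heaviside_def)
  have s: "summable (\<lambda>j. \<bar>a j * heaviside (u j)\<bar>)"
    by (rule summable_comparison_test'[OF a, of 0]) (use le in simp)
  have "\<bar>\<Sum>j. a j * heaviside (u j)\<bar> \<le> (\<Sum>j. \<bar>a j * heaviside (u j)\<bar>)" by (rule summable_rabs[OF s])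
  also have "\<dots> \<le> (\<Sum>j. \<bar>a j\<bar>)" by (rule suminf_le[OF le s a])
  finally show ?thesis .
qed

text \<open>Projection onto an interval brings no point further away from the elements of the
  interval.\<close>

lemma truncate_residual_le: "\<bar>y\<bar> \<le> \<beta> \<Longrightarrow> (truncate \<beta> u - y)\<^sup>2 \<le> (u - y)\<^sup>2"
  unfolding truncate_def by (rule iffD1[OF abs_le_square_iff]) (auto simp: max_def min_def)

lemma (in prob_space) exceed_prob_le:
  assumes Y: "Y \<in> borel_measurable M" and c: "c > 0" and \<beta>: "\<beta> \<ge> 0"
    and int: "integrable M (\<lambda>\<omega>. exp (c * (Y \<omega>)\<^sup>2))"
  shows "prob {\<omega>\<in>space M. \<bar>Y \<omega>\<bar> > \<beta>} \<le> exp (- c * \<beta>\<^sup>2) * expectation (\<lambda>\<omega>. exp (c * (Y \<omega>)\<^sup>2))"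
proof -
  note [measurable] = Y
  have "prob {\<omega>\<in>space M. \<bar>Y \<omega>\<bar> > \<beta>} = expectation (indicator {\<omega>\<in>space M. \<bar>Y \<omega>\<bar> > \<beta>})" by simp
  also have "\<dots> \<le> expectation (\<lambda>\<omega>. exp (- c * \<beta>\<^sup>2) * exp (c * (Y \<omega>)\<^sup>2))"
  proof (rule integral_mono)
    show "integrable M (indicator {\<omega>\<in>space M. \<bar>Y \<omega>\<bar> > \<beta>} :: 'a \<Rightarrow> real)"
      by (rule integrable_real_indicator) (auto simp: less_top[symmetric])
    show "integrable M (\<lambda>\<omega>. exp (- c * \<beta>\<^sup>2) * exp (c * (Y \<omega>)\<^sup>2))" using int by simp
    fix \<omega>
    show "indicator {\<omega>\<in>space M. \<bar>Y \<omega>\<bar> > \<beta>} \<omega> \<le> exp (- c * \<beta>\<^sup>2) * exp (c * (Y \<omega>)\<^sup>2)"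
    proof (cases "\<bar>Y \<omega>\<bar> > \<beta>")
      case True
      then have "\<beta>\<^sup>2 \<le> (Y \<omega>)\<^sup>2" using \<beta> power_mono[of \<beta> "\<bar>Y \<omega>\<bar>" 2] by simp
      then have "0 \<le> - c * \<beta>\<^sup>2 + c * (Y \<omega>)\<^sup>2" using c by simp
      then have "1 \<le> exp (- c * \<beta>\<^sup>2) * exp (c * (Y \<omega>)\<^sup>2)" by (simp add: mult_exp_exp)
      then show ?thesis by (simp add: indicator_def)
    qed simp
  qed
  also have "\<dots> = exp (- c * \<beta>\<^sup>2) * expectation (\<lambda>\<omega>. exp (c * (Y \<omega>)\<^sup>2))" by simp
  finally show ?thesis .
qed

text \<open>Off the event \<open>Bad\<close> more than \<open>k / (2 p)\<close> trees are greedy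
  steps, so the empirical excess is at most \<open>2 / n * 4 V^2 n * 2 p / k = 16 V^2 p / k\<close>.
  On \<open>Bad\<close> it is at most \<open>8 \<beta>^2\<close>.\<close>

lemma (in prob_space) boosting_run_risk:
  fixes X :: "'a \<Rightarrow> real ^ 'p" and F :: "'a \<Rightarrow> real ^ 'p \<Rightarrow> real"
    and S :: "nat \<times> nat \<times> nat \<Rightarrow> 'a \<Rightarrow> 'p set"
  assumes X: "X \<in> borel_measurable M" and cube: "AE \<omega> in M. X \<omega> \<in> unit_cube"
    and Y: "Y \<in> borel_measurable M" and c: "c > 0"
    and expY: "integrable M (\<lambda>\<omega>. exp (c * (Y \<omega>)\<^sup>2))"
    and iid: "iid_copies M X Y Xs Ys" and m: "is_regression_function M X Y m"
    and a: "summable (\<lambda>j. \<bar>\<alpha> j\<bar>)" "(\<Sum>j. \<bar>\<alpha> j\<bar>) \<le> V" and V: "V > 0"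
    and ridge: "\<And>z. z \<in> unit_cube \<Longrightarrow> m z = (\<Sum>j. \<alpha> j * heaviside (\<theta> j \<bullet> z + s j))"
    and n: "n \<ge> 2" and t: "t \<ge> 2" and k: "k \<ge> 1" and \<beta>: "\<beta> \<ge> 1" "\<beta> \<ge> V"
    and adm: "admissible_seeds M n Xs Ys (seed_index B k t) S" and b: "b \<in> {1..B}"
    and boost: "AE \<omega> in M. is_boosting_tree n (\<lambda>i. Xs i \<omega>) (\<lambda>i. Ys i \<omega>) t k (\<lambda>j \<tau>. S (b, j, \<tau>) \<omega>) (F \<omega>)"
    and F: "(\<lambda>(\<omega>, z). F \<omega> z) \<in> borel_measurable (M \<Otimes>\<^sub>M borel)"
    and N: "real N \<ge> 2 * \<beta> * real n"
  defines "W \<equiv> expectation (\<lambda>\<omega>. exp (c * (Y \<omega>)\<^sup>2))" and "p \<equiv> real CARD('p)"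
  shows "(\<integral>\<omega>. (\<integral>z. (truncate \<beta> (F \<omega> z) - truncate V (m z))\<^sup>2 \<partial>distr M borel X) \<partial>M)
    \<le> 16 * V\<^sup>2 * p / real k + 8 * \<beta>\<^sup>2 * (real n * (exp (- c * \<beta>\<^sup>2) * W) + exp (- real k / (2 * p\<^sup>2)))
      + 8 * \<beta> * (2 / c * exp (- c * \<beta>\<^sup>2 / 2) * W)
      + 242 * \<beta>\<^sup>2 * ln (real (cover_bound CARD('p) (t - 1) (k * t) N (2 * n))) / real n + 112 * \<beta> / real n"
proof -
  \<comment> \<open>On the cube \<open>m\<close> is bounded by \<open>V\<close>, so \<open>h\<close>
    is a version of \<open>m\<close> that is bounded everywhere, as the uniform estimates
    require.\<close>
  define h where "h = (\<lambda>z. truncate V (m z))"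
  have mm: "m \<in> borel_measurable borel" using m unfolding is_regression_function_def by blast
  have hm: "h \<in> borel_measurable borel" unfolding h_def using mm by measurable
  have hb: "\<bar>h z\<bar> \<le> \<beta>" for z using abs_truncate_le[of V "m z"] V \<beta> by (simp add: h_def)
  have h_cube: "h z = m z" if "z \<in> unit_cube" for z
    unfolding h_def ridge[OF that] by (rule truncate_id) (rule order_trans[OF abs_ridge_le[OF a(1)] a(2)])
  have p: "p > 0" by (simp add: p_def)
  have Yint: "integrable M Y"
  proof (rule Bochner_Integration.integrable_bound[of M "\<lambda>\<omega>. 1 + exp (c * (Y \<omega>)\<^sup>2) / c"])
    show "integrable M (\<lambda>\<omega>. 1 + exp (c * (Y \<omega>)\<^sup>2) / c)" using expY by simp
    show "AE \<omega> in M. norm (Y \<omega>) \<le> norm (1 + exp (c * (Y \<omega>)\<^sup>2) / c)"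
      unfolding real_norm_def
      by (intro AE_I2 order_trans[OF abs_le_exp_square[OF c] abs_ge_self])
  qed (rule Y)
  have XYs: "(\<lambda>\<omega>. (Xs i \<omega>, Ys i \<omega>)) \<in> borel_measurable M" for i
    by (rule iid_copies_PiM(1)[OF iid, of n]) (use n in simp)
  have XY: "(\<lambda>\<omega>. (X \<omega>, Y \<omega>)) \<in> borel_measurable M"
    using X Y by (simp add: borel_prod[symmetric])
  have law: "distr M borel (\<lambda>\<omega>. (Xs i \<omega>, Ys i \<omega>)) = distr M borel (\<lambda>\<omega>. (X \<omega>, Y \<omega>))" for i
    using iid unfolding iid_copies_def by blast
  have Ysm [measurable]: "Ys i \<in> borel_measurable M" for i
    using measurable_compose[OF XYs[of i] borel_measurable_fst_snd(2)] by simp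
  have cubes: "AE \<omega> in M. Xs i \<omega> \<in> unit_cube" for i
  proof -
    have cl: "{w \<in> space borel. fst w \<in> unit_cube} \<in> sets (borel :: ((real ^ 'p) \<times> real) measure)"
      using measurable_sets[OF borel_measurable_fst_snd(1) borel_closed[OF closed_cbox]]
      by (simp add: vimage_def)
    have "AE w in distr M borel (\<lambda>\<omega>. (X \<omega>, Y \<omega>)). fst w \<in> unit_cube"
      using cube by (subst AE_distr_iff[OF XY]) (use cl in simp_all)
    then show ?thesis unfolding law[of i, symmetric]
      by (subst (asm) AE_distr_iff[OF XYs]) (use cl in simp_all)
  qed
  define Bad where "Bad = (\<Union>i<n. {\<omega>\<in>space M. \<bar>Ys i \<omega>\<bar> > \<beta>})
    \<union> {\<omega>\<in>space M. real (card {j\<in>{1..k}. S (b, j, 1) \<omega> = UNIV}) \<le> real k / (2 * p)}"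
  have Yexc: "{\<omega>\<in>space M. \<bar>Ys i \<omega>\<bar> > \<beta>} \<in> events" for i by measurable
  have Nexc: "{\<omega>\<in>space M. real (card {j\<in>{1..k}. S (b, j, 1) \<omega> = UNIV}) \<le> real k / (2 * p)} \<in> events"
    using full_first_split_count(1)[OF adm b t k] unfolding p_def .
  have Bad: "Bad \<in> events" unfolding Bad_def by (intro sets.Un sets.finite_UN Yexc Nexc finite_lessThan)
  have probY: "prob {\<omega>\<in>space M. \<bar>Ys i \<omega>\<bar> > \<beta>} \<le> exp (- c * \<beta>\<^sup>2) * W" for i
  proof -
    define E :: "((real ^ 'p) \<times> real) set" where "E = {w. \<bar>snd w\<bar> > \<beta>}"
    have E: "E \<in> sets borel"
      unfolding E_def by (intro borel_open open_Collect_less continuous_intros)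
    have "prob {\<omega>\<in>space M. \<bar>Ys i \<omega>\<bar> > \<beta>} = measure (distr M borel (\<lambda>\<omega>. (Xs i \<omega>, Ys i \<omega>))) E"
      by (subst measure_distr[OF XYs E]) (auto simp: E_def intro!: arg_cong[where f = prob])
    also have "\<dots> = prob {\<omega>\<in>space M. \<bar>Y \<omega>\<bar> > \<beta>}"
      unfolding law by (subst measure_distr[OF XY E]) (auto simp: E_def intro!: arg_cong[where f = prob])
    also have "\<dots> \<le> exp (- c * \<beta>\<^sup>2) * W"
      unfolding W_def by (rule exceed_prob_le[OF Y c _ expY]) (use \<beta> in simp)
    finally show ?thesis .
  qed
  have probBad: "prob Bad \<le> real n * (exp (- c * \<beta>\<^sup>2) * W) + exp (- real k / (2 * p\<^sup>2))"
  proof -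
    have "prob Bad \<le> prob (\<Union>i<n. {\<omega>\<in>space M. \<bar>Ys i \<omega>\<bar> > \<beta>})
        + prob {\<omega>\<in>space M. real (card {j\<in>{1..k}. S (b, j, 1) \<omega> = UNIV}) \<le> real k / (2 * p)}"
      unfolding Bad_def by (intro measure_Un_le sets.finite_UN Yexc Nexc finite_lessThan)
    also have "prob (\<Union>i<n. {\<omega>\<in>space M. \<bar>Ys i \<omega>\<bar> > \<beta>}) \<le> (\<Sum>i<n. prob {\<omega>\<in>space M. \<bar>Ys i \<omega>\<bar> > \<beta>})"
      by (intro finite_measure_subadditive_finite finite_lessThan image_subsetI Yexc)
    also have "\<dots> \<le> (\<Sum>i<n. exp (- c * \<beta>\<^sup>2) * W)" by (intro sum_mono probY)
    also have "prob {\<omega>\<in>space M. real (card {j\<in>{1..k}. S (b, j, 1) \<omega> = UNIV}) \<le> real k / (2 * p)}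
        \<le> exp (- real k / (2 * p\<^sup>2))"
      using full_first_split_count(2)[OF adm b t k] unfolding p_def .
    finally show ?thesis by simp
  qed
  define emp where "emp = (\<lambda>\<omega>. 2 / real n * (\<Sum>i<n. (truncate \<beta> (F \<omega> (Xs i \<omega>)) - truncate \<beta> (Ys i \<omega>))\<^sup>2
          - (truncate \<beta> (Ys i \<omega>) - h (Xs i \<omega>))\<^sup>2))"
  have n0: "real n > 0" using n by simp
  have emp_le: "AE \<omega> in M. emp \<omega> \<le> 16 * V\<^sup>2 * p / real k + 8 * \<beta>\<^sup>2 * indicator Bad \<omega>"
  proof -
    have "AE \<omega> in M. \<forall>i<n. Xs i \<omega> \<in> unit_cube"
      using cubes by (simp add: AE_all_countable)
    then show ?thesis using boost AE_space
    proof (eventually_elim, goal_cases)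
      case (1 \<omega>)
      show ?case
      proof (cases "\<omega> \<in> Bad")
        case False
        then have Yb: "\<bar>Ys i \<omega>\<bar> \<le> \<beta>" if "i < n" for i
          using that 1(3) unfolding Bad_def by (metis (mono_tags, lifting) UN_I UnI1 lessThan_iff mem_Collect_eq not_le)
        define J where "J = real (card {j\<in>{1..k}. S (b, j, 1) \<omega> = UNIV})"
        define G where "G = (\<Sum>i<n. (Ys i \<omega> - F \<omega> (Xs i \<omega>))\<^sup>2) - (\<Sum>i<n. (Ys i \<omega> - h (Xs i \<omega>))\<^sup>2)"
        have J: "J > real k / (2 * p)" using False 1(3) unfolding Bad_def J_def by (metis (mono_tags, lifting) UnI2 mem_Collect_eq not_le)
        have kp: "real k / (2 * p) > 0" using k p by simp
        have "J * G \<le> 4 * V\<^sup>2 * real n"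
          unfolding J_def G_def
          by (rule boosting_training_error[OF 1(2) t n _ a V, where \<theta> = \<theta> and s = s])
            (use 1(1) in \<open>auto simp: h_cube ridge\<close>)
        have "G \<le> 4 * V\<^sup>2 * real n / J"
          using \<open>J * G \<le> _\<close> J kp by (simp add: pos_le_divide_eq mult.commute)
        also have "\<dots> \<le> 4 * V\<^sup>2 * real n / (real k / (2 * p))"
        proof (rule divide_left_mono)
          show "real k / (2 * p) \<le> J" using J by simp
          show "0 < J * (real k / (2 * p))" using J kp by (intro mult_pos_pos) linarith+
        qed simp
        also have "\<dots> = 8 * V\<^sup>2 * p * real n / real k" by simp
        finally have G: "G \<le> 8 * V\<^sup>2 * p * real n / real k" .
        \<comment> \<open>Off \<open>Bad\<close> each truncated response is the response itself, and
          truncating the fit only lowers the residual.\<close>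
        have "(\<Sum>i<n. (truncate \<beta> (F \<omega> (Xs i \<omega>)) - truncate \<beta> (Ys i \<omega>))\<^sup>2
            - (truncate \<beta> (Ys i \<omega>) - h (Xs i \<omega>))\<^sup>2) \<le> G"
          unfolding G_def sum_subtractf[symmetric]
        proof (rule sum_mono)
          fix i assume "i \<in> {..<n}"
          then have y: "\<bar>Ys i \<omega>\<bar> \<le> \<beta>" using Yb by simp
          then show "(truncate \<beta> (F \<omega> (Xs i \<omega>)) - truncate \<beta> (Ys i \<omega>))\<^sup>2 - (truncate \<beta> (Ys i \<omega>) - h (Xs i \<omega>))\<^sup>2
              \<le> (Ys i \<omega> - F \<omega> (Xs i \<omega>))\<^sup>2 - (Ys i \<omega> - h (Xs i \<omega>))\<^sup>2"
            using truncate_residual_le[OF y] by (simp add: truncate_id power2_commute[of "Ys i \<omega>" "F \<omega> (Xs i \<omega>)"])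
        qed
        then have "emp \<omega> \<le> 2 / real n * (8 * V\<^sup>2 * p * real n / real k)"
          unfolding emp_def using G n0 by (intro mult_left_mono) auto
        also have "\<dots> = 16 * V\<^sup>2 * p / real k" using n0 by simp
        finally show ?thesis using False by (simp add: indicator_def)
      next
        case True
        have "(\<Sum>i<n. (truncate \<beta> (F \<omega> (Xs i \<omega>)) - truncate \<beta> (Ys i \<omega>))\<^sup>2
            - (truncate \<beta> (Ys i \<omega>) - h (Xs i \<omega>))\<^sup>2) \<le> (\<Sum>i<n. 4 * \<beta>\<^sup>2)"
        proof (rule sum_mono)
          fix i
          have "\<bar>truncate \<beta> (Ys i \<omega>)\<bar> \<le> \<beta>" using \<beta> by (intro abs_truncate_le) simp
          from truncate_diff_square_bound[OF this]
          show "(truncate \<beta> (F \<omega> (Xs i \<omega>)) - truncate \<beta> (Ys i \<omega>))\<^sup>2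
              - (truncate \<beta> (Ys i \<omega>) - h (Xs i \<omega>))\<^sup>2 \<le> 4 * \<beta>\<^sup>2" by (smt (verit) zero_le_power2)
        qed
        then have "emp \<omega> \<le> 2 / real n * (real n * (4 * \<beta>\<^sup>2))"
          unfolding emp_def using n0 by (intro mult_left_mono) auto
        also have "\<dots> = 8 * \<beta>\<^sup>2" using n0 by simp
        finally have "emp \<omega> \<le> 8 * \<beta>\<^sup>2" .
        moreover have "16 * V\<^sup>2 * p / real k \<ge> 0" using p by simp
        ultimately show ?thesis using True by simp
      qed
    qed
  qed
  have R0: "16 * V\<^sup>2 * p / real k \<ge> 0" using p by simp
  have emp: "(\<integral>\<omega>. emp \<omega> \<partial>M) \<le> 16 * V\<^sup>2 * p / real k + 8 * \<beta>\<^sup>2 * prob Bad"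
  \<comment> \<open>If \<open>emp\<close> is not integrable, its integral is 0 and a nonnegative
    bound suffices.\<close>
  proof (cases "integrable M emp")
    case True
    have "(\<integral>\<omega>. emp \<omega> \<partial>M) \<le> (\<integral>\<omega>. 16 * V\<^sup>2 * p / real k + 8 * \<beta>\<^sup>2 * indicator Bad \<omega> \<partial>M)"
      by (rule integral_mono_AE[OF True _ emp_le]) (use Bad in \<open>simp add: less_top[symmetric]\<close>)
    also have "\<dots> = 16 * V\<^sup>2 * p / real k + 8 * \<beta>\<^sup>2 * prob Bad"
      using Bad by (simp add: prob_space less_top[symmetric])
    finally show ?thesis .
  qed (use R0 in \<open>simp add: not_integrable_integral_eq\<close>)
  have bias: "(\<integral>\<omega>. \<bar>Y \<omega> - truncate \<beta> (Y \<omega>)\<bar> \<partial>M) \<le> 2 / c * exp (- c * \<beta>\<^sup>2 / 2) * W"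
  proof -
    have "(\<integral>\<omega>. \<bar>Y \<omega> - truncate \<beta> (Y \<omega>)\<bar> \<partial>M)
        \<le> (\<integral>\<omega>. 2 / c * exp (- c * \<beta>\<^sup>2 / 2) * exp (c * (Y \<omega>)\<^sup>2) \<partial>M)"
    proof (rule integral_mono)
      show "integrable M (\<lambda>\<omega>. \<bar>Y \<omega> - truncate \<beta> (Y \<omega>)\<bar>)"
        by (intro integrable_abs Bochner_Integration.integrable_diff Yint
            integrable_const_bound[where B = \<beta>]) (use \<beta> Y abs_truncate_le[of \<beta>] in auto)
      show "integrable M (\<lambda>\<omega>. 2 / c * exp (- c * \<beta>\<^sup>2 / 2) * exp (c * (Y \<omega>)\<^sup>2))" using expY by simp
    qed (rule abs_minus_truncate_le[OF c \<beta>(1)])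
    then show ?thesis by (simp add: W_def)
  qed
  have step: "AE \<omega> in M. F \<omega> \<in> step_functions UNIV UNIV (t - 1) (k * t)"
    using boost by eventually_elim (rule boosting_tree_step_function)
  have hmX: "AE \<omega> in M. h (X \<omega>) = m (X \<omega>)" using cube by eventually_elim (rule h_cube)
  have "(\<integral>\<omega>. (\<integral>z. (truncate \<beta> (F \<omega> z) - h z)\<^sup>2 \<partial>distr M borel X) \<partial>M)
    \<le> (\<integral>\<omega>. emp \<omega> \<partial>M) + 8 * \<beta> * (\<integral>\<omega>. \<bar>Y \<omega> - truncate \<beta> (Y \<omega>)\<bar> \<partial>M)
      + 242 * \<beta>\<^sup>2 * ln (real (cover_bound CARD('p) (t - 1) (k * t) N (2 * n))) / real n + 112 * \<beta> / real n"
    unfolding emp_def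
    by (rule truncated_risk_bound[OF X Yint iid _ m hmX hm hb _ F step N]) (use n \<beta> in auto)
  moreover have "8 * \<beta> * (\<integral>\<omega>. \<bar>Y \<omega> - truncate \<beta> (Y \<omega>)\<bar> \<partial>M) \<le> 8 * \<beta> * (2 / c * exp (- c * \<beta>\<^sup>2 / 2) * W)"
    using \<beta> by (intro mult_left_mono bias) simp
  moreover have "8 * \<beta>\<^sup>2 * prob Bad \<le> 8 * \<beta>\<^sup>2 * (real n * (exp (- c * \<beta>\<^sup>2) * W) + exp (- real k / (2 * p\<^sup>2)))"
    by (intro mult_left_mono probBad) simp
  ultimately show ?thesis using emp unfolding h_def by linarith
qed

section \<open>Orders of magnitude\<close>

lemma exp_minus_le_inverse:
  fixes u :: real
  assumes "u > 0"
  shows "exp (- u) \<le> 1 / u"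
proof -
  have "u \<le> exp u" using exp_ge_add_one_self[of u] by linarith
  then show ?thesis using assms by (simp add: exp_minus field_simps)
qed

text \<open>For \<open>n \<ge> 3\<close> the quantities \<open>3\<close>, \<open>2 n + 1\<close> and
  \<open>2 n N + 1\<close> are at most \<open>n\<close>, \<open>n^2\<close> and \<open>n^5\<close>;
  the constant collects these exponents.\<close>

lemma ln_cover_bound_le:
  fixes n k t p N :: nat
  assumes n: "n \<ge> 3" and N: "real N \<le> real n ^ 3"
  shows "ln (real (cover_bound p (t - 1) (k * t) N (2 * n)))
    \<le> real k * (real t * (real t * (1 + 2 * (real p + 1)) + 5)) * ln (real n)"
proof -
  define L where "L = ln (real n)"
  have n0: "real n \<ge> 3" using n by simp
  have L: "L \<ge> 0" using n0 by (simp add: L_def)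
  have "2 * real n + 1 \<le> 3 * real n" using n0 by simp
  also have "\<dots> \<le> real n * real n" using n0 by (intro mult_right_mono) auto
  finally have "ln (2 * real n + 1) \<le> ln (real n ^ 2)"
    using n0 by (intro ln_mono) (auto simp: power2_eq_square)
  then have l1: "ln (2 * real n + 1) \<le> 2 * L" using n0 by (simp add: L_def ln_realpow)
  have l3: "ln 3 \<le> L" unfolding L_def using n0 by (intro ln_mono) auto
  have "2 * real n * real N + 1 \<le> 2 * real n * real n ^ 3 + real n ^ 4"
    using N n0 by (intro add_mono mult_left_mono) auto
  also have "\<dots> = 3 * real n ^ 4" by (simp add: power_numeral_reduce)
  also have "\<dots> \<le> real n * real n ^ 4" using n0 by (intro mult_right_mono) auto
  also have "\<dots> = real n ^ 5" by (simp add: power_numeral_reduce)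
  finally have "ln (2 * real n * real N + 1) \<le> ln (real n ^ 5)"
    by (intro ln_mono) (auto intro!: add_nonneg_pos)
  then have l5: "ln (2 * real n * real N + 1) \<le> 5 * L" using n0 by (simp add: L_def ln_realpow)
  define T where "T = real (cell_trace_bound p (t - 1) (2 * n))"
  have T: "T = (3 * (2 * real n + 1) ^ (p + 1)) ^ (t - 1)"
    by (simp only: T_def cell_trace_bound_def of_nat_power of_nat_mult of_nat_add of_nat_1 of_nat_numeral)
  have T0: "T > 0" unfolding T by (intro zero_less_power mult_pos_pos) auto
  have "ln T = real (t - 1) * (ln 3 + real (p + 1) * ln (2 * real n + 1))"
  proof -
    have u: "2 * real n + 1 > 0" by simp
    have "ln T = real (t - 1) * ln (3 * (2 * real n + 1) ^ (p + 1))"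
      unfolding T by (rule ln_realpow)
    also have "ln (3 * (2 * real n + 1) ^ (p + 1)) = ln 3 + ln ((2 * real n + 1) ^ (p + 1))"
      by (rule ln_mult_pos) (intro zero_less_power u | simp)+
    also have "ln ((2 * real n + 1) ^ (p + 1)) = real (p + 1) * ln (2 * real n + 1)"
      by (rule ln_realpow)
    finally show ?thesis .
  qed
  also have "\<dots> \<le> real t * (L + real (p + 1) * (2 * L))"
    using l1 l3 L n0 by (intro mult_mono add_mono) (auto intro!: add_nonneg_nonneg mult_nonneg_nonneg)
  also have "\<dots> = real t * (1 + 2 * (real p + 1)) * L" by (simp add: algebra_simps)
  finally have lT: "ln T \<le> real t * (1 + 2 * (real p + 1)) * L" .
  have "real (cover_bound p (t - 1) (k * t) N (2 * n)) = (T * (2 * real n * real N + 1)) ^ (k * t)"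
    by (simp only: cover_bound_def T_def of_nat_power of_nat_mult of_nat_add of_nat_1 of_nat_numeral)
  moreover have "2 * real n * real N + 1 > 0" by (intro add_nonneg_pos) auto
  ultimately have "ln (real (cover_bound p (t - 1) (k * t) N (2 * n)))
      = real (k * t) * (ln T + ln (2 * real n * real N + 1))"
    by (simp only: ln_realpow ln_mult_pos[OF T0])
  also have "\<dots> \<le> real (k * t) * (real t * (1 + 2 * (real p + 1)) * L + 5 * L)"
    by (intro mult_left_mono add_mono lT l5) simp
  also have "\<dots> = real k * (real t * (real t * (1 + 2 * (real p + 1)) + 5)) * L"
    by (simp add: algebra_simps)
  finally show ?thesis by (simp add: L_def)
qed

text \<open>\<open>c * c\<^sub>1\<^sup>2 * L \<ge> 4\<close> turns the square-exponential tails into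
  powers of \<open>n\<close>, namely \<open>exp (- c \<beta>^2 / 2) \<le> 1 / n^2\<close>, and
  \<open>n \<ge> 2 C\<^sub>1 + 1\<close> makes the number of levels at most \<open>n^3\<close>. The
  complexity term gets the largest bound, of order \<open>L^3 / r\<close>; all terms are rounded up
  to \<open>L^4 / r\<close>.\<close>

lemma boosting_rate_bound:
  fixes n k t p :: nat and \<beta> c c\<^sub>1 C\<^sub>1 c\<^sub>2 C\<^sub>2 V W :: real
  defines "L \<equiv> ln (real n)" and "r \<equiv> sqrt (real n)"
  defines "A \<equiv> real t * (real t * (1 + 2 * (real p + 1)) + 5)"
  assumes n: "n \<ge> 3" "real n \<ge> 2 * C\<^sub>1 + 1" and L: "L \<ge> 1" "c * c\<^sub>1\<^sup>2 * L \<ge> 4"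
    and \<beta>: "c\<^sub>1 * L \<le> \<beta>" "\<beta> \<le> C\<^sub>1 * L" and k: "c\<^sub>2 * r \<le> real k" "real k \<le> C\<^sub>2 * r"
    and pos: "c > 0" "c\<^sub>1 > 0" "C\<^sub>1 > 0" "c\<^sub>2 > 0" "W \<ge> 0" "p > 0"
    and N: "real N \<le> 2 * \<beta> * real n + 1"
  shows "16 * V\<^sup>2 * real p / real k
      + 8 * \<beta>\<^sup>2 * (real n * (exp (- c * \<beta>\<^sup>2) * W) + exp (- real k / (2 * (real p)\<^sup>2)))
      + 8 * \<beta> * (2 / c * exp (- c * \<beta>\<^sup>2 / 2) * W)
      + 242 * \<beta>\<^sup>2 * ln (real (cover_bound p (t - 1) (k * t) N (2 * n))) / real n + 112 * \<beta> / real n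
    \<le> (16 * V\<^sup>2 * real p / c\<^sub>2 + 8 * C\<^sub>1\<^sup>2 * (W + 2 * (real p)\<^sup>2 / c\<^sub>2) + 16 * C\<^sub>1 * W / c
      + 242 * C\<^sub>1\<^sup>2 * C\<^sub>2 * A + 112 * C\<^sub>1) * (L ^ 4 / r)"
proof -
  have n0: "real n \<ge> 3" using n by simp
  have r: "r > 0" "r * r = real n" "r \<ge> 1" using n0 by (simp_all add: r_def)
  have rn: "r \<le> real n" using r mult_right_mono[of 1 r r] by simp
  have L4: "L \<le> L ^ 4" "L ^ 2 \<le> L ^ 4" "L ^ 3 \<le> L ^ 4" "1 \<le> L ^ 4"
    using L(1) power_increasing[of 1 4 L] power_increasing[of 2 4 L] power_increasing[of 3 4 L]
    by simp_all
  have b0: "\<beta> > 0" using \<beta>(1) pos L by (smt (verit) mult_pos_pos)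
  have b2: "\<beta>\<^sup>2 \<le> C\<^sub>1\<^sup>2 * L\<^sup>2" using power_mono[OF \<beta>(2), of 2] b0 by (simp add: power_mult_distrib)
  have kr: "c\<^sub>2 * r > 0" using pos r by simp
  have k0: "real k > 0" using k(1) kr by linarith
  have inv: "1 / real n \<le> 1 / r" using rn r by (simp add: frac_le)
  have e2: "exp (- c * \<beta>\<^sup>2 / 2) \<le> 1 / (real n)\<^sup>2"
  proof -
    have "4 * L \<le> c * c\<^sub>1\<^sup>2 * L * L" using L by (intro mult_right_mono) auto
    also have "\<dots> = c * (c\<^sub>1 * L)\<^sup>2" by (simp add: power2_eq_square)
    also have "\<dots> \<le> c * \<beta>\<^sup>2" using \<beta>(1) pos L by (intro mult_left_mono power_mono) auto
    finally have "- c * \<beta>\<^sup>2 / 2 \<le> - (2 * L)" by simp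
    then have "exp (- c * \<beta>\<^sup>2 / 2) \<le> exp (- (2 * L))" by simp
    also have "\<dots> = 1 / (real n)\<^sup>2"
    proof -
      have "exp L = real n" using n0 by (simp add: L_def)
      then show ?thesis by (simp add: exp_minus exp_double divide_inverse)
    qed
    finally show ?thesis .
  qed
  have e2': "exp (- c * \<beta>\<^sup>2 / 2) \<le> 1 / r"
  proof -
    have "1 / (real n)\<^sup>2 \<le> 1 / real n" using n0 by (simp add: power2_eq_square field_simps)
    then show ?thesis using e2 inv by linarith
  qed
  have e1: "real n * exp (- c * \<beta>\<^sup>2) \<le> 1 / r"
  proof -
    have "exp (- c * \<beta>\<^sup>2) \<le> 1 / (real n)\<^sup>2" by (rule order_trans[OF _ e2]) (use pos in simp)
    then have "real n * exp (- c * \<beta>\<^sup>2) \<le> real n * (1 / (real n)\<^sup>2)" by (rule mult_left_mono) simp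
    also have "\<dots> = 1 / real n" using n0 by (simp add: power2_eq_square)
    finally show ?thesis using inv by linarith
  qed
  have e3: "exp (- real k / (2 * (real p)\<^sup>2)) \<le> 2 * (real p)\<^sup>2 / c\<^sub>2 * (1 / r)"
  proof -
    have "exp (- (real k / (2 * (real p)\<^sup>2))) \<le> 1 / (real k / (2 * (real p)\<^sup>2))"
      using k0 pos by (intro exp_minus_le_inverse) simp
    also have "\<dots> = 2 * (real p)\<^sup>2 / real k" by simp
    also have "\<dots> \<le> 2 * (real p)\<^sup>2 / (c\<^sub>2 * r)" using k(1) pos r by (intro divide_left_mono mult_pos_pos k0) auto
    finally show ?thesis by simp
  qed
  have t1: "16 * V\<^sup>2 * real p / real k \<le> 16 * V\<^sup>2 * real p / c\<^sub>2 * (L ^ 4 / r)"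
  proof -
    have "16 * V\<^sup>2 * real p / real k \<le> 16 * V\<^sup>2 * real p / (c\<^sub>2 * r)"
      using k(1) pos r by (intro divide_left_mono mult_pos_pos k0) auto
    also have "\<dots> = 16 * V\<^sup>2 * real p / c\<^sub>2 * (1 / r)" by simp
    also have "\<dots> \<le> 16 * V\<^sup>2 * real p / c\<^sub>2 * (L ^ 4 / r)"
      using pos r L4 by (intro mult_left_mono divide_right_mono) auto
    finally show ?thesis .
  qed
  have t2: "8 * \<beta>\<^sup>2 * (real n * (exp (- c * \<beta>\<^sup>2) * W) + exp (- real k / (2 * (real p)\<^sup>2)))
      \<le> 8 * C\<^sub>1\<^sup>2 * (W + 2 * (real p)\<^sup>2 / c\<^sub>2) * (L ^ 4 / r)"
  proof -
    have "real n * (exp (- c * \<beta>\<^sup>2) * W) \<le> 1 / r * W"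
      using mult_right_mono[OF e1 pos(5)] by (simp add: mult.assoc)
    then have "real n * (exp (- c * \<beta>\<^sup>2) * W) + exp (- real k / (2 * (real p)\<^sup>2))
        \<le> 1 / r * W + 2 * (real p)\<^sup>2 / c\<^sub>2 * (1 / r)" using e3 by linarith
    also have "\<dots> = (W + 2 * (real p)\<^sup>2 / c\<^sub>2) * (1 / r)" by (simp add: distrib_right add_divide_distrib)
    finally have "8 * \<beta>\<^sup>2 * (real n * (exp (- c * \<beta>\<^sup>2) * W) + exp (- real k / (2 * (real p)\<^sup>2)))
        \<le> 8 * (C\<^sub>1\<^sup>2 * L\<^sup>2) * ((W + 2 * (real p)\<^sup>2 / c\<^sub>2) * (1 / r))"
      using b2 pos by (intro mult_mono) auto
    also have "\<dots> = 8 * C\<^sub>1\<^sup>2 * (W + 2 * (real p)\<^sup>2 / c\<^sub>2) * (L\<^sup>2 / r)" by simp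
    also have "\<dots> \<le> 8 * C\<^sub>1\<^sup>2 * (W + 2 * (real p)\<^sup>2 / c\<^sub>2) * (L ^ 4 / r)"
      using pos r L4 by (intro mult_left_mono divide_right_mono) auto
    finally show ?thesis .
  qed
  have t3: "8 * \<beta> * (2 / c * exp (- c * \<beta>\<^sup>2 / 2) * W) \<le> 16 * C\<^sub>1 * W / c * (L ^ 4 / r)"
  proof -
    have "8 * \<beta> * (2 / c * exp (- c * \<beta>\<^sup>2 / 2) * W) \<le> 8 * (C\<^sub>1 * L) * (2 / c * (1 / r) * W)"
      using \<beta>(2) b0 e2' pos L r by (intro mult_mono) auto
    also have "\<dots> = 16 * C\<^sub>1 * W / c * (L / r)" by simp
    also have "\<dots> \<le> 16 * C\<^sub>1 * W / c * (L ^ 4 / r)"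
      using pos r L4 by (intro mult_left_mono divide_right_mono) auto
    finally show ?thesis .
  qed
  have N3: "real N \<le> real n ^ 3"
  proof -
    have "L \<le> real n" unfolding L_def using n0 ln_le_minus_one[of "real n"] by linarith
    then have "\<beta> \<le> C\<^sub>1 * real n" using \<beta>(2) pos by (meson mult_left_mono less_imp_le order_trans)
    then have "2 * \<beta> * real n + 1 \<le> 2 * (C\<^sub>1 * real n) * real n + real n * real n"
      using n0 mult_mono[of 1 "real n" 1 "real n"] by (intro add_mono mult_right_mono) auto
    also have "\<dots> = (2 * C\<^sub>1 + 1) * (real n * real n)" by (simp add: algebra_simps)
    also have "\<dots> \<le> real n * (real n * real n)" using n by (intro mult_right_mono) auto
    finally show ?thesis using N by (simp add: power3_eq_cube)
  qed
  have A0: "A \<ge> 0" by (simp add: A_def)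
  have t4: "242 * \<beta>\<^sup>2 * ln (real (cover_bound p (t - 1) (k * t) N (2 * n))) / real n
      \<le> 242 * C\<^sub>1\<^sup>2 * C\<^sub>2 * A * (L ^ 4 / r)"
  proof -
    have C2: "C\<^sub>2 \<ge> 0" using k k0 r by (smt (verit) mult_nonpos_nonneg)
    have "ln (real (cover_bound p (t - 1) (k * t) N (2 * n))) \<le> real k * A * L"
      unfolding A_def L_def by (rule ln_cover_bound_le[OF n(1) N3])
    also have "\<dots> \<le> C\<^sub>2 * r * A * L" using k(2) A0 L by (intro mult_right_mono) auto
    finally have ln: "ln (real (cover_bound p (t - 1) (k * t) N (2 * n))) \<le> C\<^sub>2 * r * A * L" .
    have "242 * \<beta>\<^sup>2 * ln (real (cover_bound p (t - 1) (k * t) N (2 * n)))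
        \<le> 242 * \<beta>\<^sup>2 * (C\<^sub>2 * r * A * L)"
      by (rule mult_left_mono[OF ln]) simp
    also have "\<dots> \<le> 242 * (C\<^sub>1\<^sup>2 * L\<^sup>2) * (C\<^sub>2 * r * A * L)"
      using b2 C2 A0 L r by (intro mult_right_mono mult_left_mono) auto
    finally have "242 * \<beta>\<^sup>2 * ln (real (cover_bound p (t - 1) (k * t) N (2 * n))) / real n
        \<le> 242 * (C\<^sub>1\<^sup>2 * L\<^sup>2) * (C\<^sub>2 * r * A * L) / real n" using n0 by (intro divide_right_mono) auto
    also have "\<dots> = 242 * C\<^sub>1\<^sup>2 * C\<^sub>2 * A * (L ^ 3 / r)"
      unfolding r(2)[symmetric] using r(1) by (simp add: power2_eq_square power3_eq_cube)
    also have "\<dots> \<le> 242 * C\<^sub>1\<^sup>2 * C\<^sub>2 * A * (L ^ 4 / r)"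
      using C2 A0 r L4 by (intro mult_left_mono divide_right_mono) auto
    finally show ?thesis .
  qed
  have t5: "112 * \<beta> / real n \<le> 112 * C\<^sub>1 * (L ^ 4 / r)"
  proof -
    have "112 * \<beta> / real n \<le> 112 * (C\<^sub>1 * L) * (1 / r)"
      using mult_mono[of "112 * \<beta>" "112 * (C\<^sub>1 * L)" "1 / real n" "1 / r"] inv \<beta>(2) pos L by simp
    also have "\<dots> = 112 * C\<^sub>1 * (L / r)" by simp
    also have "\<dots> \<le> 112 * C\<^sub>1 * (L ^ 4 / r)"
      using pos r L4 by (intro mult_left_mono divide_right_mono) auto
    finally show ?thesis .
  qed
  from t1 t2 t3 t4 t5 show ?thesis unfolding distrib_right by linarith
qed

text \<open>Convexity of the square reduces the ensemble to its single runs, whatever their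
  dependence.\<close>

lemma truncated_ensemble_square_le:
  assumes B: "B \<ge> 1"
  shows "(truncated_ensemble B \<beta> f z - u)\<^sup>2 \<le> (\<Sum>b=1..B. (truncate \<beta> (f b z) - u)\<^sup>2) / real B"
proof -
  define v where "v = (\<lambda>b. truncate \<beta> (f b z) - u)"
  have "truncated_ensemble B \<beta> f z - u = (\<Sum>b=1..B. v b) / real B"
    using B by (simp add: truncated_ensemble_def truncate_def v_def sum_subtractf diff_divide_distrib)
  then have "(truncated_ensemble B \<beta> f z - u)\<^sup>2 = (\<Sum>b=1..B. v b * 1)\<^sup>2 / (real B)\<^sup>2"
    by (simp add: power_divide)
  also have "\<dots> \<le> ((\<Sum>b=1..B. (v b)\<^sup>2) * (\<Sum>b=1..B. 1\<^sup>2)) / (real B)\<^sup>2"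
    by (intro divide_right_mono Cauchy_Schwarz_ineq_sum) simp
  also have "\<dots> = (\<Sum>b=1..B. (v b)\<^sup>2) / real B" using B by (simp add: power2_eq_square)
  finally show ?thesis by (simp add: v_def)
qed

theorem theorem5p3:
  fixes M :: "'w measure"
    and X :: "'w \<Rightarrow> real ^ 'p" and Y :: "'w \<Rightarrow> real"
    and Xs :: "nat \<Rightarrow> 'w \<Rightarrow> real ^ 'p" and Ys :: "nat \<Rightarrow> 'w \<Rightarrow> real"
    and m :: "real ^ 'p \<Rightarrow> real"
    and t B :: nat and k :: "nat \<Rightarrow> nat" and \<beta> :: "nat \<Rightarrow> real" and c :: real
    and S :: "nat \<Rightarrow> nat \<times> nat \<times> nat \<Rightarrow> 'w \<Rightarrow> 'p set"
    and mb :: "nat \<Rightarrow> nat \<Rightarrow> 'w \<Rightarrow> real ^ 'p \<Rightarrow> real"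
  assumes "prob_space M"
    and "X \<in> borel_measurable M" and "AE \<omega> in M. X \<omega> \<in> unit_cube"
    and "Y \<in> borel_measurable M"
    and "c > 0" and "integrable M (\<lambda>\<omega>. exp (c * (Y \<omega>)\<^sup>2))"
    and "is_regression_function M X Y m" and "m \<in> ridge_step_class"
    and "iid_copies M X Y Xs Ys"
    and "t \<ge> 2" and "B \<ge> 1"
    and "\<And>n. admissible_seeds M n Xs Ys (seed_index B (k n) t) (S n)"
    and "\<And>n b. b \<in> {1..B} \<Longrightarrow>
          AE \<omega> in M. is_boosting_tree n (\<lambda>i. Xs i \<omega>) (\<lambda>i. Ys i \<omega>) t (k n)
            (\<lambda>j \<tau>. S n (b, j, \<tau>) \<omega>) (mb n b \<omega>)"
    and "\<And>n b. b \<in> {1..B} \<Longrightarrow>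
          (\<lambda>(\<omega>, z). mb n b \<omega> z) \<in> borel_measurable (M \<Otimes>\<^sub>M borel)"
    and "same_order \<beta> (\<lambda>n. ln (real n))"
    and "same_order (\<lambda>n. real (k n)) (\<lambda>n. sqrt (real n))"
  shows "\<exists>C. \<forall>\<^sub>F n in sequentially.
    (\<integral>\<^sup>+ \<omega>. (\<integral>\<^sup>+ z. ennreal (\<bar>truncated_ensemble B (\<beta> n) (\<lambda>b. mb n b \<omega>) z - m z\<bar>\<^sup>2)
        \<partial>distr M borel X) \<partial>M)
      \<le> ennreal (C * (ln (real n) ^ 4 / sqrt (real n)))"
proof -
  interpret prob_space M by fact
  note X = assms(2) and cube = assms(3) and Y = assms(4) and c = assms(5) and expY = assms(6)
    and reg = assms(7) and iid = assms(9) and t = assms(10) and B = assms(11)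
    and adm = assms(12) and boost = assms(13) and mb = assms(14)
  obtain \<alpha> and \<theta> :: "nat \<Rightarrow> real ^ 'p" and s where a: "summable (\<lambda>j. \<bar>\<alpha> j\<bar>)"
    and ridge: "\<And>z. z \<in> unit_cube \<Longrightarrow> m z = (\<Sum>j. \<alpha> j * heaviside (\<theta> j \<bullet> z + s j))"
    using assms(8) unfolding ridge_step_class_def by auto
  \<comment> \<open>The summand 1 keeps \<open>V\<close> positive when all coefficients
    vanish.\<close>
  define V where "V = (\<Sum>j. \<bar>\<alpha> j\<bar>) + 1"
  have V: "V > 0" "(\<Sum>j. \<bar>\<alpha> j\<bar>) \<le> V"
    using suminf_nonneg[OF a] by (simp_all add: V_def)
  define W where "W = expectation (\<lambda>\<omega>. exp (c * (Y \<omega>)\<^sup>2))"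
  have W: "W \<ge> 0" unfolding W_def by (rule integral_nonneg_AE) simp
  define p where "p = CARD('p)"
  obtain c1 C1 where c1: "c1 > 0" "C1 > 0"
    and ev1: "\<forall>\<^sub>F n in sequentially. c1 \<le> \<beta> n / ln (real n) \<and> \<beta> n / ln (real n) \<le> C1"
    using assms(15) unfolding same_order_def by blast
  obtain c2 C2 where c2: "c2 > 0" "C2 > 0"
    and ev2: "\<forall>\<^sub>F n in sequentially. c2 \<le> real (k n) / sqrt (real n) \<and> real (k n) / sqrt (real n) \<le> C2"
    using assms(16) unfolding same_order_def by blast
  define A where "A = real t * (real t * (1 + 2 * (real p + 1)) + 5)"
  define C where "C = 16 * V\<^sup>2 * real p / c2 + 8 * C1\<^sup>2 * (W + 2 * (real p)\<^sup>2 / c2) + 16 * C1 * W / c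
      + 242 * C1\<^sup>2 * C2 * A + 112 * C1"
  \<comment> \<open>A lower bound for \<open>ln n\<close> from which
    \<open>\<beta> n \<ge> 1\<close>, \<open>\<beta> n \<ge> V\<close> and the tail condition
    \<open>c * c1\<^sup>2 * ln n \<ge> 4\<close> follow.\<close>
  define lo where "lo = max 1 (max (4 / (c * c1\<^sup>2)) (max (V / c1) (1 / c1)))"
  have "filterlim (\<lambda>n. ln (real n)) at_top sequentially"
    by (rule filterlim_compose[OF ln_at_top filterlim_real_sequentially])
  then have evL: "\<forall>\<^sub>F n in sequentially. lo \<le> ln (real n)" by (simp add: filterlim_at_top)
  have evn: "\<forall>\<^sub>F n in sequentially. 2 * C1 + 1 \<le> real n"
    using filterlim_real_sequentially by (simp add: filterlim_at_top)
  have "\<forall>\<^sub>F n in sequentially.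
    (\<integral>\<^sup>+ \<omega>. (\<integral>\<^sup>+ z. ennreal (\<bar>truncated_ensemble B (\<beta> n) (\<lambda>b. mb n b \<omega>) z - m z\<bar>\<^sup>2)
        \<partial>distr M borel X) \<partial>M)
      \<le> ennreal (C * (ln (real n) ^ 4 / sqrt (real n)))"
    using ev1 ev2 evL evn eventually_ge_at_top[of 3]
  proof eventually_elim
    case (elim n)
    define L where "L = ln (real n)"
    have L: "L \<ge> 1" "L \<ge> 4 / (c * c1\<^sup>2)" "L \<ge> V / c1" "L \<ge> 1 / c1"
      using elim(3) by (auto simp: lo_def L_def)
    have b: "c1 * L \<le> \<beta> n" "\<beta> n \<le> C1 * L"
      using elim(1) L by (auto simp: L_def pos_le_divide_eq pos_divide_le_eq)
    have r: "sqrt (real n) > 0" using elim(5) by simp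
    have kk: "c2 * sqrt (real n) \<le> real (k n)" "real (k n) \<le> C2 * sqrt (real n)"
      using elim(2) r by (auto simp: pos_le_divide_eq pos_divide_le_eq)
    have "V \<le> c1 * L" "1 \<le> c1 * L" using L c1 by (simp_all add: pos_divide_le_eq mult.commute)
    then have bV: "\<beta> n \<ge> 1" "\<beta> n \<ge> V" using b by linarith+
    have "real (k n) > 0" using kk(1) c2 r by (smt (verit) mult_pos_pos)
    then have k1: "k n \<ge> 1" by simp
    have cL: "c * c1\<^sup>2 * L \<ge> 4" using L(2) c c1 by (simp add: pos_divide_le_eq mult.commute)
    \<comment> \<open>So many levels at distance \<open>1 / n\<close> fill an interval of length
      \<open>2 * \<beta> n\<close>.\<close>
    define N where "N = nat \<lceil>2 * \<beta> n * real n\<rceil>"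
    have N: "real N \<ge> 2 * \<beta> n * real n" "real N \<le> 2 * \<beta> n * real n + 1"
      using bV by (simp_all add: N_def)
    define \<mu> where "\<mu> = distr M borel X"
    define h where "h = (\<lambda>z. truncate V (m z))"
    have mm: "m \<in> borel_measurable borel" using reg unfolding is_regression_function_def by blast
    have hm: "h \<in> borel_measurable borel" unfolding h_def using mm by measurable
    have hb: "\<bar>h z\<bar> \<le> \<beta> n" for z using abs_truncate_le[of V "m z"] V bV by (simp add: h_def)
    have h_cube: "h z = m z" if "z \<in> unit_cube" for z
      unfolding h_def ridge[OF that] by (rule truncate_id) (rule order_trans[OF abs_ridge_le[OF a] V(2)])
    have AEm: "AE z in \<mu>. h z = m z"
    proof -
      have "AE z in \<mu>. z \<in> unit_cube" unfolding \<mu>_def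
        using cube by (subst AE_distr_iff[OF X]) auto
      then show ?thesis by eventually_elim (rule h_cube)
    qed
    define R where "R = (\<lambda>b \<omega>. \<integral>z. (truncate (\<beta> n) (mb n b \<omega> z) - h z)\<^sup>2 \<partial>\<mu>)"
    have Ri: "integrable \<mu> (\<lambda>z. (truncate (\<beta> n) (mb n b \<omega> z) - h z)\<^sup>2)"
      if "b \<in> {1..B}" "\<omega> \<in> space M" for b \<omega>
      unfolding \<mu>_def by (rule truncated_risk_integrable(1)[OF X hm hb mb[OF that(1)] that(2)])
    have RI: "integrable M (R b)" if "b \<in> {1..B}" for b
      unfolding \<mu>_def R_def by (rule truncated_risk_integrable(2)[OF X hm hb mb[OF that]])
    have R0: "R b \<omega> \<ge> 0" for b \<omega> unfolding R_def by (rule integral_nonneg_AE) simp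
    have RC: "(\<integral>\<omega>. R b \<omega> \<partial>M) \<le> C * (L ^ 4 / sqrt (real n))" if bB: "b \<in> {1..B}" for b
    proof -
      have n2: "n \<ge> 2" using elim(5) by simp
      have "(\<integral>\<omega>. R b \<omega> \<partial>M) \<le> 16 * V\<^sup>2 * real p / real (k n)
        + 8 * (\<beta> n)\<^sup>2 * (real n * (exp (- c * (\<beta> n)\<^sup>2) * W) + exp (- real (k n) / (2 * (real p)\<^sup>2)))
        + 8 * \<beta> n * (2 / c * exp (- c * (\<beta> n)\<^sup>2 / 2) * W)
        + 242 * (\<beta> n)\<^sup>2 * ln (real (cover_bound p (t - 1) (k n * t) N (2 * n))) / real n + 112 * \<beta> n / real n"
        unfolding R_def h_def \<mu>_def p_def W_def
        by (rule boosting_run_risk[OF X cube Y c expY iid reg a V(2) V(1) ridge n2 t k1 bV adm bB boost[OF bB] mb[OF bB] N(1)])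
      also have "\<dots> \<le> C * (L ^ 4 / sqrt (real n))"
        unfolding C_def A_def L_def
        by (rule boosting_rate_bound[where c\<^sub>1 = c1 and C\<^sub>1 = C1 and c\<^sub>2 = c2 and C\<^sub>2 = C2, OF elim(5) elim(4)])
          (use L cL b kk c c1 c2 W N(2) in \<open>auto simp: L_def p_def\<close>)
      finally show ?thesis .
    qed
    \<comment> \<open>Nonnegative integrals are monotone without measurability, so the ensemble is
      compared with a Bochner integrable majorant; \<open>h\<close> may replace \<open>m\<close>
      because the law of \<open>X\<close> lives on the cube.\<close>
    have inner: "(\<integral>\<^sup>+ z. ennreal (\<bar>truncated_ensemble B (\<beta> n) (\<lambda>b. mb n b \<omega>) z - m z\<bar>\<^sup>2) \<partial>\<mu>)
        \<le> ennreal ((\<Sum>b=1..B. R b \<omega>) / real B)" if \<omega>: "\<omega> \<in> space M" for \<omega>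
    proof -
      have "(\<integral>\<^sup>+ z. ennreal (\<bar>truncated_ensemble B (\<beta> n) (\<lambda>b. mb n b \<omega>) z - m z\<bar>\<^sup>2) \<partial>\<mu>)
          \<le> (\<integral>\<^sup>+ z. ennreal ((\<Sum>b=1..B. (truncate (\<beta> n) (mb n b \<omega> z) - h z)\<^sup>2) / real B) \<partial>\<mu>)"
      proof (rule nn_integral_mono_AE)
        show "AE z in \<mu>. ennreal (\<bar>truncated_ensemble B (\<beta> n) (\<lambda>b. mb n b \<omega>) z - m z\<bar>\<^sup>2)
          \<le> ennreal ((\<Sum>b=1..B. (truncate (\<beta> n) (mb n b \<omega> z) - h z)\<^sup>2) / real B)"
          using AEm
        proof eventually_elim
          case (elim z)
          then show ?case
            using truncated_ensemble_square_le[OF B, of "\<beta> n" "\<lambda>b. mb n b \<omega>" z "h z"]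
            by (simp add: ennreal_leI)
        qed
      qed
      also have "\<dots> = ennreal (\<integral>z. (\<Sum>b=1..B. (truncate (\<beta> n) (mb n b \<omega> z) - h z)\<^sup>2) / real B \<partial>\<mu>)"
        by (rule nn_integral_eq_integral)
          (auto intro!: integrable_divide Bochner_Integration.integrable_sum Ri \<omega> divide_nonneg_nonneg sum_nonneg)
      also have "(\<integral>z. (\<Sum>b=1..B. (truncate (\<beta> n) (mb n b \<omega> z) - h z)\<^sup>2) / real B \<partial>\<mu>)
          = (\<Sum>b=1..B. R b \<omega>) / real B"
        unfolding R_def by (simp add: Bochner_Integration.integral_sum Ri \<omega>)
      finally show ?thesis .
    qed
    have "(\<integral>\<^sup>+ \<omega>. (\<integral>\<^sup>+ z. ennreal (\<bar>truncated_ensemble B (\<beta> n) (\<lambda>b. mb n b \<omega>) z - m z\<bar>\<^sup>2) \<partial>\<mu>) \<partial>M)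
        \<le> (\<integral>\<^sup>+ \<omega>. ennreal ((\<Sum>b=1..B. R b \<omega>) / real B) \<partial>M)"
      by (rule nn_integral_mono) (rule inner)
    also have "\<dots> = ennreal (\<integral>\<omega>. (\<Sum>b=1..B. R b \<omega>) / real B \<partial>M)"
      by (rule nn_integral_eq_integral)
        (auto intro!: integrable_divide Bochner_Integration.integrable_sum RI R0 divide_nonneg_nonneg sum_nonneg)
    also have "(\<integral>\<omega>. (\<Sum>b=1..B. R b \<omega>) / real B \<partial>M) = (\<Sum>b=1..B. \<integral>\<omega>. R b \<omega> \<partial>M) / real B"
      by (simp add: Bochner_Integration.integral_sum RI)
    also have "ennreal \<dots> \<le> ennreal (C * (L ^ 4 / sqrt (real n)))"
    proof (rule ennreal_leI)
      have "(\<Sum>b=1..B. \<integral>\<omega>. R b \<omega> \<partial>M) \<le> (\<Sum>b=1..B. C * (L ^ 4 / sqrt (real n)))"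
        by (intro sum_mono RC) simp
      then show "(\<Sum>b=1..B. \<integral>\<omega>. R b \<omega> \<partial>M) / real B \<le> C * (L ^ 4 / sqrt (real n))"
        using B by (simp add: pos_divide_le_eq mult.commute)
    qed
    finally show ?case unfolding \<mu>_def L_def .
  qed
  then show ?thesis by blast
qed

end
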